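(* Let $\ell>3$ be prime, $N_\ell=\frac16(\ell^2-1)$, and let $A(q)=\sum_{n\ge0}\alpha(n)q^n=\prod_{n\ge1}\frac{(1-q^{2n})^3}{(1-q^n)^2}$, with $\alpha(x)=0$ unless $x$ is a nonnegative integer. Define, for $\tau$ in the upper half-plane and $q=e^{2\pi i\tau}$, $$\widetilde Z_\ell(\tau)=\frac{1}{A(q)}\sum_{n\ge0}\left(\ell\,\alpha(\ell^2n+N_\ell)+\left(\frac{-1}{\ell}\right)\left(\frac{N_\ell-n}{\ell}\right)\alpha(n)+\alpha\!\left(\frac{n-N_\ell}{\ell^2}\right)\right)q^n.$$ Then $\widetilde Z_\ell$ is a weakly holomorphic modular function on $\Gamma_0(2)$ whose only pole is at the cusp $0$, and consequently $\widetilde Z_\ell(\tau)$ is a polynomial in $\Phi_2(\tau)=\left(\frac{\eta(2\tau)}{\eta(\tau)}\right)^{24}$.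
   Context: $\eta(\tau)=q^{1/24}\prod_{n\ge1}(1-q^n)$; $\Phi_2$ is a Hauptmodul for $\Gamma_0(2)=\{\left(\begin{smallmatrix}a&b\\c&d\end{smallmatrix}\right)\in SL_2(\mathbb Z): c\equiv0\pmod 2\}$. A weakly holomorphic modular function on $\Gamma_0(2)$ is a function invariant under $\Gamma_0(2)$, holomorphic on the upper half-plane, meromorphic at the cusps (its only poles are at cusps); the inequivalent cusps are $0$ and $i\infty$. $\left(\frac{\cdot}{\ell}\right)$ is the Legendre symbol. *)

theory Defs
  imports "HOL-Complex_Analysis.Complex_Analysis" "HOL-Number_Theory.Number_Theory"
begin

definition upper_half_plane :: "complex set" where
  "upper_half_plane = {\<tau>. Im \<tau> > 0}"

definition SL2Z :: "(int ^ 2 ^ 2) set" where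
  "SL2Z = {\<gamma>. det \<gamma> = 1}"

definition Gamma0 :: "int \<Rightarrow> (int ^ 2 ^ 2) set" where
  "Gamma0 N = {\<gamma> \<in> SL2Z. [\<gamma> $ 2 $ 1 = 0] (mod N)}"

definition act :: "int ^ 2 ^ 2 \<Rightarrow> complex \<Rightarrow> complex" where
  "act \<gamma> = moebius (of_int (\<gamma> $ 1 $ 1)) (of_int (\<gamma> $ 1 $ 2))
                  (of_int (\<gamma> $ 2 $ 1)) (of_int (\<gamma> $ 2 $ 2))"

text \<open>
  A cusp is represented by a matrix \<open>\<gamma>\<close> in \<open>SL2Z\<close> that maps \<open>i\<infinity>\<close> to it. The behaviour of \<open>f\<close> at
  that cusp is the behaviour at \<open>0\<close> of the function \<open>F\<close> with \<open>f (\<gamma> \<tau>) = F (exp (2 \<pi> i \<tau> / h))\<close> near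
  \<open>i\<infinity>\<close>. Whether \<open>F\<close> is meromorphic at \<open>0\<close>, or has a pole there, does not depend on the choice of
  \<open>h\<close>, which may be any positive multiple of the width of the cusp.
\<close>

definition cusp_expansion ::
    "(complex \<Rightarrow> complex) \<Rightarrow> int ^ 2 ^ 2 \<Rightarrow> nat \<Rightarrow> (complex \<Rightarrow> complex) \<Rightarrow> bool" where
  "cusp_expansion f \<gamma> h F \<longleftrightarrow> h > 0 \<and> F meromorphic_on {0} \<and>
     (\<exists>y>0. \<forall>\<tau>. Im \<tau> > y \<longrightarrow> f (act \<gamma> \<tau>) = F (exp (2 * of_real pi * \<i> * \<tau> / of_nat h)))"

definition meromorphic_at_cusp :: "(complex \<Rightarrow> complex) \<Rightarrow> int ^ 2 ^ 2 \<Rightarrow> bool" where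
  "meromorphic_at_cusp f \<gamma> \<longleftrightarrow> (\<exists>h F. cusp_expansion f \<gamma> h F)"

definition pole_at_cusp :: "(complex \<Rightarrow> complex) \<Rightarrow> int ^ 2 ^ 2 \<Rightarrow> bool" where
  "pole_at_cusp f \<gamma> \<longleftrightarrow> (\<exists>h F. cusp_expansion f \<gamma> h F \<and> is_pole F 0)"

definition cusp_infinity :: "int ^ 2 ^ 2" where
  "cusp_infinity = mat 1"

text \<open>The matrix of \<open>\<tau> \<mapsto> -1/\<tau>\<close>, which maps \<open>i\<infinity>\<close> to \<open>0\<close>.\<close>

definition cusp_zero :: "int ^ 2 ^ 2" where
  "cusp_zero = vector [vector [0, -1], vector [1, 0]]"

definition weakly_holomorphic_modular_function ::
    "(int ^ 2 ^ 2) set \<Rightarrow> (complex \<Rightarrow> complex) \<Rightarrow> bool" where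
  "weakly_holomorphic_modular_function \<Gamma> f \<longleftrightarrow>
     (\<forall>\<gamma>\<in>\<Gamma>. \<forall>\<tau>\<in>upper_half_plane. f (act \<gamma> \<tau>) = f \<tau>) \<and>
     f holomorphic_on upper_half_plane \<and>
     (\<forall>\<gamma>\<in>SL2Z. meromorphic_at_cusp f \<gamma>)"

definition nome :: "complex \<Rightarrow> complex" where
  "nome \<tau> = exp (2 * of_real pi * \<i> * \<tau>)"

definition eta :: "complex \<Rightarrow> complex" where
  "eta \<tau> = exp (2 * of_real pi * \<i> * \<tau> / 24) * (\<Prod>n. 1 - nome \<tau> ^ Suc n)"

definition Phi2 :: "complex \<Rightarrow> complex" where
  "Phi2 \<tau> = (eta (2 * \<tau>) / eta \<tau>) ^ 24"

definition A_gen :: "complex \<Rightarrow> complex" where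
  "A_gen q = (\<Prod>n. (1 - q ^ (2 * Suc n)) ^ 3 / (1 - q ^ Suc n) ^ 2)"

definition alpha :: "rat \<Rightarrow> complex" where
  "alpha x = (if x \<in> \<nat> then fps_nth (fps_expansion A_gen 0) (nat \<lfloor>x\<rfloor>) else 0)"

text \<open>The division is exact for every prime \<open>l > 3\<close>, since then \<open>24\<close> divides \<open>l\<^sup>2 - 1\<close>.\<close>

definition N_ell :: "nat \<Rightarrow> int" where
  "N_ell l = (int l ^ 2 - 1) div 6"

definition Z_coeff :: "nat \<Rightarrow> nat \<Rightarrow> complex" where
  "Z_coeff l n =
     of_nat l * alpha (of_nat (l ^ 2 * n) + of_int (N_ell l))
     + of_int (Legendre (-1) (int l)) * of_int (Legendre (N_ell l - int n) (int l)) * alpha (of_nat n)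
     + alpha ((of_nat n - of_int (N_ell l)) / of_nat (l ^ 2))"

definition Z_tilde :: "nat \<Rightarrow> complex \<Rightarrow> complex" where
  "Z_tilde l \<tau> = 1 / A_gen (nome \<tau>) * (\<Sum>n. Z_coeff l n * nome \<tau> ^ n)"

end

theory Submission
  imports Defs
begin

text \<open>
  Write \<open>F(\<tau>) = \<eta>(2\<tau>)\<^sup>3 / \<eta>(\<tau>)\<^sup>2 = q\<^bsup>1/6\<^esup> A(q)\<close> and \<open>G(\<tau>) = \<eta>(\<tau>/2)\<^sup>3 / \<eta>(\<tau>)\<^sup>2\<close>, so that
  \<open>F(\<tau>)\<close> is a multiple of \<open>G(-1/\<tau>)\<close>. The numerator of \<open>Z_tilde\<close> is the Hecke operator of index \<open>l\<^sup>2\<close>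
  applied to \<open>F\<close>, a sum of translates \<open>F((\<tau> + 24b)/l\<^sup>2)\<close>, of twisted translates \<open>F(\<tau> + 24b/l)\<close>
  and of \<open>F(l\<^sup>2\<tau>)\<close>.

  By the pentagonal number theorem \<open>\<eta>\<close> is a theta series, and Poisson summation over residue classes
  computes \<open>\<eta>(24b/c + \<tau>)\<close> for \<open>c = 1, l, l\<^sup>2\<close> with Gauss sums as multipliers. The inversion
  \<open>\<tau> \<mapsto> -1/\<tau>\<close> therefore turns the Hecke sum of \<open>F\<close> into the analogous sum for \<open>G\<close>, whose
  quotient by \<open>G\<close> is visibly invariant under \<open>\<sigma> \<mapsto> \<sigma> + 2\<close> and of order \<open>-(l\<^sup>2 - 1)/24\<close> in
  \<open>exp (\<pi>i\<sigma>)\<close>. Together with \<open>\<tau> \<mapsto> \<tau> + 1\<close> this gives invariance under \<open>Gamma0 2\<close>.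
  Subtracting powers of \<open>Phi2\<close>, which has a simple pole at the cusp 0, leaves a bounded, hence
  constant, function.
\<close>

section \<open>The Euler product and the pentagonal number theorem\<close>

text \<open>F has weight 1/2, so the obstacle is the multiplier: eta brings a square root and a 24th
  root of unity into every transformation. Shifts by multiples of 24 remove the root of unity, and
  the square root stays inside the abstract \<open>eta_factor\<close>, known through its behaviour
  under scaling. The inversion of theta comes from uniqueness: entire functions with period 1 and
  the quasi-period of theta form a line, so both sides of the formula are proportional. The Hecke
  sum is stable because inversion permutes its pieces. Among the l^2 translates, those with b prime
  to l are permuted by b -> 1/(1152 b); the nonzero multiples of l are exchanged with the twisted
  sum, and b = 0 with F(l^2 \<tau>). Gauss sums modulo l supply the Legendre symbols of the twist,
  those modulo l^2 equal l, and quadratic reciprocity for 3 and l makes the signs agree. The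
  arithmetic input throughout is l^2 = 24 M + 1.\<close>

lemma nome_0 [simp]: "nome 0 = 1"
  by (simp add: nome_def)

lemma nome_add: "nome (a + b) = nome a * nome b"
  by (simp add: nome_def ring_distribs exp_add)

lemma nome_minus: "nome (- a) = inverse (nome a)"
  by (simp add: nome_def exp_minus)

lemma nome_diff: "nome (a - b) = nome a / nome b"
  by (simp add: nome_def ring_distribs exp_diff)

lemma nome_nonzero [simp]: "nome a \<noteq> 0"
  by (simp add: nome_def)

lemma nome_power: "nome a ^ n = nome (of_nat n * a)"
  by (simp add: nome_def exp_of_nat_mult [symmetric] mult_ac)

lemma norm_nome: "norm (nome a) = exp (- 2 * pi * Im a)"
  by (simp add: nome_def)

lemma norm_nome_less_1_iff: "norm (nome a) < 1 \<longleftrightarrow> Im a > 0"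
  by (simp add: norm_nome zero_less_mult_iff)

lemma nome_of_int [simp]: "nome (of_int n) = 1"
  using exp_integer_2pi[of "of_int n"] by (simp add: nome_def mult_ac)

lemma nome_of_nat [simp]: "nome (of_nat n) = 1"
  using nome_of_int[of "int n"] by simp

lemma nome_numeral [simp]: "nome (numeral n) = 1"
  using nome_of_int[of "numeral n"] by (simp del: nome_of_int)

lemma nome_1 [simp]: "nome 1 = 1"
  using nome_of_int[of 1] by (simp del: nome_of_int)

lemma nome_half: "nome (1/2) = -1"
  by (simp add: nome_def exp_eq_polar)

lemma nome_eq_1_iff: "nome a = 1 \<longleftrightarrow> a \<in> \<int>"
proof
  assume "nome a = 1"
  then obtain n :: int where n: "Re (2 * complex_of_real pi * \<i> * a) = 0"
     "Im (2 * complex_of_real pi * \<i> * a) = of_int (2 * n) * pi"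
    unfolding nome_def by (subst (asm) exp_eq_1) auto
  hence "a = of_int n" by (auto simp: complex_eq_iff)
  thus "a \<in> \<int>" by simp
qed (auto elim!: Ints_cases)

lemma nome_eqI: "a - b \<in> \<int> \<Longrightarrow> nome a = nome b"
  using nome_eq_1_iff[of "a - b"] by (simp add: nome_diff)

lemma nome_eqD: "nome a = nome b \<Longrightarrow> a - b \<in> \<int>"
  using nome_eq_1_iff[of "a - b"] by (simp add: nome_diff)

lemma nome_holomorphic [holomorphic_intros]:
  "f holomorphic_on S \<Longrightarrow> (\<lambda>z. nome (f z)) holomorphic_on S"
  unfolding nome_def by (intro holomorphic_intros)

lemma nome_continuous [continuous_intros]:
  "continuous_on S f \<Longrightarrow> continuous_on S (\<lambda>z. nome (f z))"
  unfolding nome_def by (intro continuous_intros)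

lemma nome_surj: "x \<noteq> 0 \<Longrightarrow> \<exists>a. nome a = x"
  by (rule exI[of _ "Ln x / (2 * of_real pi * \<i>)"]) (simp add: nome_def)

section \<open>The Euler product as a holomorphic function on the unit disc\<close>

definition euler_prod :: "complex \<Rightarrow> complex" where
  "euler_prod q = (\<Prod>n. 1 - q ^ Suc n)"

lemma euler_prod_abs_convergent:
  fixes q :: complex
  assumes "norm q < 1"
  shows "abs_convergent_prod (\<lambda>n. 1 - q ^ Suc n)"
proof -
  have "summable (\<lambda>n. norm q * norm q ^ n)"
    by (intro summable_mult summable_geometric) (use assms in auto)
  thus ?thesis unfolding abs_convergent_prod_conv_summable
    by (simp add: norm_mult norm_power)
qed

lemma euler_prod_convergent:
  fixes q :: complex
  shows "norm q < 1 \<Longrightarrow> convergent_prod (\<lambda>n. 1 - q ^ Suc n)"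
  by (rule abs_convergent_prod_imp_convergent_prod) (rule euler_prod_abs_convergent)

lemma power_Suc_neq_1:
  assumes "norm (q::complex) < 1"
  shows "q ^ Suc n \<noteq> 1"
proof
  assume "q ^ Suc n = 1"
  hence "norm q ^ Suc n = 1" by (metis norm_one norm_power)
  moreover have "norm q ^ Suc n \<le> norm q ^ 1" by (rule power_decreasing) (use assms in auto)
  ultimately show False using assms by simp
qed

lemma euler_prod_nonzero: "norm q < 1 \<Longrightarrow> euler_prod q \<noteq> 0"
  unfolding euler_prod_def
  by (rule prodinf_nonzero[OF euler_prod_convergent]) (use power_Suc_neq_1[of q] in auto)

lemma euler_prod_LIMSEQ:
  assumes "norm q < 1"
  shows "(\<lambda>n. \<Prod>k<n. 1 - q ^ Suc k) \<longlonglongrightarrow> euler_prod q"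
proof -
  have "(\<lambda>n. \<Prod>k\<le>n. 1 - q ^ Suc k) \<longlonglongrightarrow> euler_prod q"
    unfolding euler_prod_def by (rule convergent_prod_LIMSEQ[OF euler_prod_convergent[OF assms]])
  thus ?thesis
    by (subst filterlim_sequentially_Suc [symmetric]) (simp add: lessThan_Suc_atMost)
qed

lemma euler_prod_holomorphic: "euler_prod holomorphic_on ball 0 1"
proof (rule holomorphic_uniform_sequence)
  fix z :: complex assume z: "z \<in> ball 0 1"
  \<comment> \<open>Half way between \<open>norm z\<close> and 1: the disc around \<open>z\<close>
    of radius \<open>r - norm z\<close> lies in \<open>cball 0 r\<close>, where the M-test applies
    with the majorant \<open>r ^ Suc n\<close>.\<close>
  define r where "r = (1 + norm z) / 2"
  have r: "norm z < r" "r < 1" "0 < r" using z norm_ge_zero[of z] by (auto simp: r_def simp del: norm_ge_zero)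
  define d where "d = r - norm z"
  have sub: "cball z d \<subseteq> cball 0 r"
    by (auto simp: d_def cball_subset_cball_iff dist_norm)
  have "uniformly_convergent_on (cball 0 r) (\<lambda>N x. \<Prod>n<N. (1 + - ((x::complex) ^ Suc n)))"
  proof (rule uniformly_convergent_on_prod)
    show "uniformly_convergent_on (cball 0 r) (\<lambda>N x. \<Sum>n<N. norm (- ((x::complex) ^ Suc n)))"
    proof (rule Weierstrass_m_test'[where M = "\<lambda>n. r ^ Suc n"])
      show "summable (\<lambda>n. r ^ Suc n)"
        using r by (subst summable_Suc_iff) (auto intro: summable_geometric)
    next
      fix n and x :: complex assume "x \<in> cball 0 r"
      hence "norm x ^ Suc n \<le> r ^ Suc n" by (intro power_mono) auto
      thus "norm (norm (- (x ^ Suc n))) \<le> r ^ Suc n" by (simp add: norm_power del: power_Suc)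
    qed
  qed (auto intro!: continuous_intros)
  then obtain g where g: "uniform_limit (cball 0 r) (\<lambda>N x. \<Prod>n<N. (1 + - ((x::complex) ^ Suc n))) g sequentially"
    unfolding uniformly_convergent_on_def by blast
  have "uniform_limit (cball 0 r) (\<lambda>N x. \<Prod>n<N. (1 - (x::complex) ^ Suc n)) euler_prod sequentially \<longleftrightarrow>
        uniform_limit (cball 0 r) (\<lambda>N x. \<Prod>n<N. (1 + - ((x::complex) ^ Suc n))) g sequentially"
  proof (intro uniform_limit_cong always_eventually allI ballI)
    fix x :: complex assume x: "x \<in> cball 0 r"
    have "(\<lambda>n. \<Prod>k<n. 1 - x ^ Suc k) \<longlonglongrightarrow> g x"
      using tendsto_uniform_limitI[OF g x] by simp
    moreover have "(\<lambda>n. \<Prod>k<n. 1 - x ^ Suc k) \<longlonglongrightarrow> euler_prod x"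
      by (rule euler_prod_LIMSEQ) (use x r in auto)
    ultimately show "euler_prod x = g x" by (rule LIMSEQ_unique[symmetric])
  qed auto
  with g have "uniform_limit (cball 0 r) (\<lambda>N x. \<Prod>n<N. (1 - (x::complex) ^ Suc n)) euler_prod sequentially"
    by simp
  hence "uniform_limit (cball z d) (\<lambda>N x. \<Prod>n<N. (1 - (x::complex) ^ Suc n)) euler_prod sequentially"
    by (rule uniform_limit_on_subset) (rule sub)
  thus "\<exists>d>0. cball z d \<subseteq> ball 0 1 \<and> uniform_limit (cball z d) (\<lambda>N x. \<Prod>n<N. (1 - (x::complex) ^ Suc n)) euler_prod sequentially"
    using r sub by (intro exI[of _ d]) (auto simp: d_def dest: subsetD)
qed (auto intro!: holomorphic_intros)

lemma euler_prod_0 [simp]: "euler_prod 0 = 1"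
  by (simp add: euler_prod_def)

lemma A_gen_eq:
  assumes "norm q < 1"
  shows "A_gen q = euler_prod (q^2) ^ 3 / euler_prod q ^ 2"
proof -
  have q2: "norm (q^2) < 1" using assms by (simp add: norm_power power_less_one_iff)
  have "A_gen q = (\<Prod>n. (1 - (q^2) ^ Suc n) ^ 3 / (1 - q ^ Suc n) ^ 2)"
    unfolding A_gen_def by (simp only: power_mult)
  also have "\<dots> = (\<Prod>n. (1 - (q^2) ^ Suc n) ^ 3) / (\<Prod>n. (1 - q ^ Suc n) ^ 2)"
    by (intro prodinf_divide[symmetric] convergent_prod_power euler_prod_convergent assms q2)
  also have "\<dots> = euler_prod (q^2) ^ 3 / euler_prod q ^ 2"
    unfolding euler_prod_def
    by (simp only: prodinf_power[OF euler_prod_convergent[OF assms]] prodinf_power[OF euler_prod_convergent[OF q2]])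
  finally show ?thesis .
qed

lemma A_gen_holomorphic: "A_gen holomorphic_on ball 0 1"
proof -
  have "(\<lambda>q. q^2) ` ball (0::complex) 1 \<subseteq> ball 0 1"
    by (auto simp: norm_power power_less_one_iff)
  hence *: "(euler_prod \<circ> (\<lambda>q. q^2)) holomorphic_on ball 0 1"
    by (intro holomorphic_on_compose_gen[OF _ euler_prod_holomorphic]) (auto intro!: holomorphic_intros)
  have "(\<lambda>q. (euler_prod \<circ> (\<lambda>q. q^2)) q ^ 3 / euler_prod q ^ 2) holomorphic_on ball 0 1"
    by (intro holomorphic_intros euler_prod_holomorphic *) (auto simp: euler_prod_nonzero)
  thus ?thesis by (rule holomorphic_transform) (auto simp: A_gen_eq)
qed

lemma A_gen_nonzero: "norm q < 1 \<Longrightarrow> A_gen q \<noteq> 0"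
  by (auto simp: A_gen_eq norm_power power_less_one_iff euler_prod_nonzero)

lemma eta_eq: "eta \<tau> = nome (\<tau> / 24) * euler_prod (nome \<tau>)"
  by (simp add: eta_def nome_def euler_prod_def)

lemma eta_nonzero: "Im \<tau> > 0 \<Longrightarrow> eta \<tau> \<noteq> 0"
  by (simp add: eta_eq euler_prod_nonzero norm_nome_less_1_iff)

lemma open_upper_half_plane: "open upper_half_plane"
  unfolding upper_half_plane_def by (rule open_halfspace_Im_gt)

lemma convex_upper_half_plane: "convex upper_half_plane"
  unfolding upper_half_plane_def by (rule convex_halfspace_Im_gt)

lemma eta_holomorphic: "eta holomorphic_on upper_half_plane"
proof -
  have "nome ` upper_half_plane \<subseteq> ball 0 1"
    by (auto simp: upper_half_plane_def norm_nome_less_1_iff)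
  hence "(euler_prod \<circ> nome) holomorphic_on upper_half_plane"
    by (intro holomorphic_on_compose_gen[OF _ euler_prod_holomorphic])
       (use nome_holomorphic[of "\<lambda>x. x"] in \<open>auto intro!: holomorphic_intros\<close>)
  hence "(\<lambda>\<tau>. nome (\<tau> / 24) * (euler_prod \<circ> nome) \<tau>) holomorphic_on upper_half_plane"
    by (intro holomorphic_on_mult[OF nome_holomorphic] holomorphic_intros) (auto simp: o_def)
  thus ?thesis by (rule holomorphic_transform) (auto simp: eta_eq)
qed

lemma eta_plus_of_int: "eta (\<tau> + of_int n) = nome (of_int n / 24) * eta \<tau>"
  by (simp add: eta_eq add_divide_distrib nome_add)

section \<open>The pentagonal number theorem\<close>

abbreviation pentagonal_term :: "complex \<Rightarrow> nat \<Rightarrow> complex" where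
  "pentagonal_term q s \<equiv> (-1)^s * (q ^ (s * (3 * s + 1) div 2) + q ^ (s * (3 * s - 1) div 2))"

text \<open>Shanks' finite form of the pentagonal number theorem.\<close>

lemma pentagonal_finite:
  fixes q :: complex
  shows "(\<Sum>s\<le>n. (-1)^s * (\<Prod>k\<in>{s..<n}. 1 - q ^ Suc k) * q ^ (s * n + s * Suc s div 2)) =
         1 + (\<Sum>s=1..n. pentagonal_term q s)"
proof (induction n)
  case (Suc n)
  define D where "D n s = (\<Prod>k\<in>{s..<n}. 1 - q ^ Suc k)" for n s
  define T where "T n s = (-1)^s * D n s * q ^ (s * n + s * Suc s div 2)" for n s
  \<comment> \<open>Telescoping certificate: passing from \<open>n\<close> to \<open>Suc n\<close>
    changes the summand at \<open>s\<close> by \<open>U (Suc s) - U s\<close>. For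
    \<open>0 < s \<le> n\<close> it equals \<open>(1 - q ^ s) * T n s\<close>, which vanishes at
    \<open>s = 0\<close>, so the separate value there (where \<open>s - 1\<close> would truncate)
    fits.\<close>
  define U where "U s = (if s = 0 then 0 else (-1)^s * D n (s - 1) * q ^ (s * n + s * Suc s div 2))" for s
  have div2: "(a + 2 * b) div 2 = a div 2 + b" for a b :: nat by simp
  have tri: "Suc s * Suc (Suc s) div 2 = s * Suc s div 2 + Suc s" for s :: nat
  proof -
    have eq: "Suc s * Suc (Suc s) = s * Suc s + 2 * Suc s" by simp
    show ?thesis unfolding eq by (rule div2)
  qed
  have step: "T (Suc n) s - T n s = U (Suc s) - U s" if "s \<le> n" for s
  proof -
    have D1: "D (Suc n) s = D n s * (1 - q ^ Suc n)"
      unfolding D_def using that by (subst prod.atLeastLessThan_Suc) auto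
    have Us: "U s = (1 - q ^ s) * T n s"
    proof (cases s)
      case (Suc s')
      have "D n s' = (1 - q ^ Suc s') * D n (Suc s')"
        unfolding D_def using that Suc by (subst prod.atLeast_Suc_lessThan) auto
      thus ?thesis by (simp add: U_def T_def Suc)
    qed (auto simp: U_def)
    have "U (Suc s) = - ((-1)^s * D n s * q ^ (Suc s * n + Suc s * Suc (Suc s) div 2))"
      by (simp add: U_def)
    also have "Suc s * n + Suc s * Suc (Suc s) div 2 = (s * n + s * Suc s div 2) + s + Suc n"
      unfolding tri by (simp add: algebra_simps)
    also have "- ((-1)^s * D n s * q ^ \<dots>) = - (T n s * q ^ s * q ^ Suc n)"
      by (simp only: power_add T_def) (simp add: algebra_simps)
    finally have US: "U (Suc s) = - (T n s * q ^ s * q ^ Suc n)" .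
    have "T (Suc n) s = T n s * (1 - q ^ Suc n) * q ^ s"
      unfolding T_def D1 by (simp add: power_add algebra_simps)
    thus ?thesis unfolding Us US by (simp add: algebra_simps)
  qed
  \<comment> \<open>The new last summand and the telescoped boundary term \<open>U (Suc n)\<close>
    will be the two powers in \<open>pentagonal_term q (Suc n)\<close>.\<close>
  have "(\<Sum>s\<le>Suc n. T (Suc n) s) = T (Suc n) (Suc n) + (\<Sum>s\<le>n. T n s) + (\<Sum>s\<le>n. T (Suc n) s - T n s)"
    by (simp add: sum_subtractf)
  also have "(\<Sum>s\<le>n. T (Suc n) s - T n s) = (\<Sum>s\<le>n. U (Suc s) - U s)"
    by (intro sum.cong refl step) auto
  also have "\<dots> = U (Suc n)"
  proof -
    have "(\<Sum>s\<le>m. U (Suc s) - U s) = U (Suc m) - U 0" for m by (induction m) auto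
    thus ?thesis by (simp only:) (simp add: U_def)
  qed
  also have "U (Suc n) = (-1)^Suc n * q ^ (Suc n * n + Suc n * Suc (Suc n) div 2)"
    by (simp add: U_def D_def)
  also have "Suc n * n + Suc n * Suc (Suc n) div 2 = Suc n * (3 * Suc n - 1) div 2"
  proof -
    have eq: "Suc n * (3 * Suc n - 1) = Suc n * Suc (Suc n) + 2 * (Suc n * n)" by simp
    show ?thesis unfolding eq div2 by (rule add.commute)
  qed
  also have "T (Suc n) (Suc n) = (-1)^Suc n * q ^ (Suc n * Suc n + Suc n * Suc (Suc n) div 2)"
    by (simp add: T_def D_def)
  also have "Suc n * Suc n + Suc n * Suc (Suc n) div 2 = Suc n * (3 * Suc n + 1) div 2"
  proof -
    have eq: "Suc n * (3 * Suc n + 1) = Suc n * Suc (Suc n) + 2 * (Suc n * Suc n)" by (simp add: algebra_simps)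
    show ?thesis unfolding eq div2 by (rule add.commute)
  qed
  also have "(\<Sum>s\<le>n. T n s) = 1 + (\<Sum>s=1..n. pentagonal_term q s)"
    unfolding T_def D_def by (rule Suc.IH)
  finally have eq: "(\<Sum>s\<le>Suc n. T (Suc n) s) = (-1)^Suc n * q ^ (Suc n * (3 * Suc n + 1) div 2) +
     (1 + (\<Sum>s=1..n. pentagonal_term q s)) +
     (-1)^Suc n * q ^ (Suc n * (3 * Suc n - 1) div 2)" .
  define t where "t s = pentagonal_term q s" for s
  have "(\<Sum>s=1..Suc n. t s) = (\<Sum>s=1..n. t s) + t (Suc n)" by simp
  with eq have "(\<Sum>s\<le>Suc n. T (Suc n) s) = 1 + (\<Sum>s=1..Suc n. t s)"
    by (simp only: t_def distrib_left add_ac)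
  thus ?case by (simp only: T_def D_def t_def)
qed auto

text \<open>In the finite identity the summand \<open>s = 0\<close> is the partial product. Each of
  the others carries a factor \<open>q ^ (s * n)\<close>, and its product is a quotient of partial
  products, bounded because these converge to a nonzero limit. The rest is thus
  \<open>O(n * norm q ^ n)\<close>.\<close>

lemma pentagonal_LIMSEQ:
  fixes q :: complex
  assumes q: "norm q < 1"
  shows "(\<lambda>n. 1 + (\<Sum>s=1..n. pentagonal_term q s)) \<longlonglongrightarrow> euler_prod q"
proof -
  define P where "P n = (\<Prod>k<n. 1 - q ^ Suc k)" for n
  have lim: "P \<longlonglongrightarrow> euler_prod q" unfolding P_def by (rule euler_prod_LIMSEQ[OF q])
  have nz: "P n \<noteq> 0" for n unfolding P_def using power_Suc_neq_1[OF q] by auto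
  obtain B1 where B1: "B1 > 0" "\<And>n. norm (P n) \<le> B1"
    using convergent_imp_Bseq[OF convergentI[OF lim]] by (auto elim: BseqE)
  have "(\<lambda>n. inverse (P n)) \<longlonglongrightarrow> inverse (euler_prod q)"
    by (intro tendsto_inverse lim euler_prod_nonzero q)
  from convergent_imp_Bseq[OF convergentI[OF this]]
  obtain B2 where B2: "B2 > 0" "\<And>n. norm (inverse (P n)) \<le> B2" by (rule BseqE) auto
  have D: "(\<Prod>k\<in>{s..<n}. 1 - q ^ Suc k) = P n * inverse (P s)" if "s \<le> n" for s n
  proof -
    have "P n = P s * (\<Prod>k\<in>{s..<n}. 1 - q ^ Suc k)" unfolding P_def
      using that by (subst prod.union_disjoint [symmetric]) (auto intro!: prod.cong)
    thus ?thesis using nz[of s] by (simp add: field_simps)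
  qed
  define R where "R n = (\<Sum>s=1..n. (-1)^s * (\<Prod>k\<in>{s..<n}. 1 - q ^ Suc k) * q ^ (s * n + s * Suc s div 2))" for n
  have R: "norm (R n) \<le> B1 * B2 * (of_nat n * norm q ^ n)" for n
  proof -
    have "norm (R n) \<le> (\<Sum>s=1..n. B1 * B2 * norm q ^ n)" unfolding R_def
    proof (rule sum_norm_le)
      fix s assume s: "s \<in> {1..n}"
      have "norm ((-1)^s * (\<Prod>k\<in>{s..<n}. 1 - q ^ Suc k) * q ^ (s * n + s * Suc s div 2)) =
            norm (P n) * norm (inverse (P s)) * norm q ^ (s * n + s * Suc s div 2)"
        using s by (subst D) (auto simp: norm_mult norm_power)
      also have "\<dots> \<le> B1 * B2 * norm q ^ n"
      proof (intro mult_mono B1 B2)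
        have "1 * n \<le> s * n" using s by (intro mult_right_mono) auto
        thus "norm q ^ (s * n + s * Suc s div 2) \<le> norm q ^ n"
          using q by (intro power_decreasing order.trans[OF _ le_add1]) auto
      qed (use B1 B2 in auto)
      finally show "norm ((-1)^s * (\<Prod>k\<in>{s..<n}. 1 - q ^ Suc k) * q ^ (s * n + s * Suc s div 2)) \<le> B1 * B2 * norm q ^ n" .
    qed
    thus ?thesis by (simp add: mult_ac)
  qed
  have "(\<lambda>n. of_nat n * norm q ^ n) \<longlonglongrightarrow> 0"
    using powser_times_n_limit_0[of "norm q"] q by simp
  hence "(\<lambda>n. B1 * B2 * (of_nat n * norm q ^ n)) \<longlonglongrightarrow> 0"
    by (rule tendsto_mult_right_zero)
  hence R0: "R \<longlonglongrightarrow> 0"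
    by (rule Lim_null_comparison[rotated]) (use R in auto)
  have "(\<lambda>n. P n + R n) \<longlonglongrightarrow> euler_prod q + 0" by (intro tendsto_add lim R0)
  moreover have "P n + R n = 1 + (\<Sum>s=1..n. pentagonal_term q s)" for n
  proof -
    have "{..n} = insert 0 {1..n}" by auto
    hence "(\<Sum>s\<le>n. (-1)^s * (\<Prod>k\<in>{s..<n}. 1 - q ^ Suc k) * q ^ (s * n + s * Suc s div 2)) = P n + R n"
      by (simp add: P_def R_def lessThan_atLeast0)
    thus ?thesis using pentagonal_finite[of q n] by simp
  qed
  ultimately show ?thesis by simp
qed

section \<open>Theta series\<close>

lemma exp_minus_abs_int_summable: "(\<lambda>n::int. exp (- \<bar>real_of_int n\<bar>)) summable_on UNIV"
proof -
  have *: "(\<lambda>n::nat. exp (- real n)) summable_on UNIV"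
  proof (subst summable_on_UNIV_nonneg_real_iff)
    have "exp (- real n) = exp (-1) ^ n" for n by (simp add: exp_of_nat_mult [symmetric])
    thus "summable (\<lambda>n::nat. exp (- real n))" by (simp add: summable_geometric)
  qed auto
  have 1: "(\<lambda>n::int. exp (- \<bar>real_of_int n\<bar>)) summable_on range int"
    by (subst summable_on_reindex) (use * in \<open>auto simp: o_def\<close>)
  have 2: "(\<lambda>n::int. exp (- \<bar>real_of_int n\<bar>)) summable_on range (\<lambda>n. - int n)"
    by (subst summable_on_reindex) (use * in \<open>auto simp: o_def inj_on_def\<close>)
  have "UNIV = range int \<union> range (\<lambda>n. - int n)"
    by (auto simp: image_iff) (metis int_cases2)
  thus ?thesis using summable_on_union[OF 1 2] by simp
qed

text \<open>Completing the square with \<open>b + 1\<close> in place of \<open>b\<close> leaves the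
  summable factor \<open>exp (- \<bar>x\<bar>)\<close> over.\<close>

lemma gauss_exp_le:
  fixes a b x :: real
  assumes "a > 0"
  shows "exp (- a * x^2 + b * \<bar>x\<bar>) \<le> exp ((b + 1)^2 / (4 * a)) * exp (- \<bar>x\<bar>)"
proof -
  have "0 \<le> (2 * a * \<bar>x\<bar> - (b + 1))^2" by simp
  also have "\<dots> = 4 * a * (a * x^2 - (b + 1) * \<bar>x\<bar>) + (b + 1)^2"
    by (simp add: power2_eq_square algebra_simps)
  finally have "- ((b + 1)^2) \<le> (a * x^2 - (b + 1) * \<bar>x\<bar>) * (4 * a)" by (simp add: algebra_simps)
  hence "- ((b + 1)^2) / (4 * a) \<le> a * x^2 - (b + 1) * \<bar>x\<bar>"
    using assms by (subst pos_divide_le_eq) auto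
  hence "- a * x^2 + b * \<bar>x\<bar> \<le> (b + 1)^2 / (4 * a) - \<bar>x\<bar>" by (simp add: algebra_simps)
  thus ?thesis by (simp add: mult_exp_exp)
qed

lemma gauss_int_summable:
  fixes a b :: real
  assumes "a > 0"
  shows "(\<lambda>n::int. exp (- a * real_of_int n ^ 2 + b * \<bar>real_of_int n\<bar>)) summable_on UNIV"
proof (rule summable_on_comparison_test)
  show "(\<lambda>n::int. exp ((b + 1)^2 / (4 * a)) * exp (- \<bar>real_of_int n\<bar>)) summable_on UNIV"
    by (intro summable_on_cmult_right exp_minus_abs_int_summable)
qed (use gauss_exp_le[OF assms] in auto)

abbreviation theta_term :: "complex \<Rightarrow> complex \<Rightarrow> int \<Rightarrow> complex" where
  "theta_term s z n \<equiv> nome (s * of_int n ^ 2 / 2 + of_int n * z)"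

lemma nome_quadratic_norm_le:
  assumes "norm z \<le> R"
  shows "norm (theta_term s z n)
           \<le> exp (- (pi * Im s) * real_of_int n ^ 2 + (2 * pi * R) * \<bar>real_of_int n\<bar>)"
proof -
  have im: "Im (s * of_int n ^ 2 / 2 + of_int n * z) = Im s * real_of_int n ^ 2 / 2 + real_of_int n * Im z"
    by (simp add: power2_eq_square)
  have "\<bar>real_of_int n * Im z\<bar> \<le> \<bar>real_of_int n\<bar> * R"
    unfolding abs_mult by (intro mult_left_mono order.trans[OF abs_Im_le_cmod assms]) auto
  hence "- (real_of_int n * Im z) \<le> R * \<bar>real_of_int n\<bar>" by (simp add: mult.commute)
  hence "2 * pi * (- (real_of_int n * Im z)) \<le> 2 * pi * (R * \<bar>real_of_int n\<bar>)"
    by (intro mult_left_mono) auto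
  thus ?thesis unfolding norm_nome im by (simp add: algebra_simps)
qed

lemma nome_quadratic_abs_summable:
  assumes "Im s > 0"
  shows "(\<lambda>n::int. norm (theta_term s z n)) summable_on UNIV"
  by (rule summable_on_comparison_test[OF gauss_int_summable[of "pi * Im s" "2 * pi * norm z"]])
     (use assms nome_quadratic_norm_le[OF order.refl] in auto)

text \<open>Jacobi's \<theta>_3, with the variable scaled so that its period is 1 and its
  quasi-period \<open>s\<close>.\<close>

definition jtheta :: "complex \<Rightarrow> complex \<Rightarrow> complex" where
  "jtheta s z = (\<Sum>\<^sub>\<infinity>n\<in>(UNIV::int set). theta_term s z n)"

lemma jtheta_has_sum:
  assumes "Im s > 0"
  shows "((\<lambda>n::int. theta_term s z n) has_sum jtheta s z) UNIV"
  unfolding jtheta_def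
  by (rule has_sum_infsum[OF abs_summable_summable[OF nome_quadratic_abs_summable[OF assms]]])

lemma jtheta_holomorphic:
  assumes "Im s > 0"
  shows "jtheta s holomorphic_on UNIV"
proof -
  have "jtheta s holomorphic_on ball 0 R" for R
  proof (rule holomorphic_uniform_limit)
    show "uniform_limit (cball 0 R) (\<lambda>X z. \<Sum>n\<in>X. theta_term s z n) (jtheta s) (finite_subsets_at_top (UNIV::int set))"
      by (rule Weierstrass_m_test_general'[OF nome_quadratic_norm_le[of _ R] jtheta_has_sum[OF assms] gauss_int_summable])
         (use assms in auto)
  qed (auto intro!: always_eventually continuous_intros holomorphic_intros)
  hence "jtheta s field_differentiable at z" for z
    using holomorphic_on_imp_differentiable_at[of "jtheta s" "ball 0 (norm z + 1)" z] by auto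
  thus ?thesis by (simp add: holomorphic_on_def)
qed

lemma jtheta_plus_1: "jtheta s (z + 1) = jtheta s z"
  unfolding jtheta_def by (intro infsum_cong) (simp add: nome_add algebra_simps)

text \<open>Since s n^2/2 + n s = s (n + 1)^2/2 - s/2, adding \<open>s\<close> to \<open>z\<close>
  amounts to moving the index by one.\<close>

lemma jtheta_plus_period:
  assumes "Im s > 0"
  shows "jtheta s (z + s) = nome (- s / 2 - z) * jtheta s z"
proof -
  have "((\<lambda>n::int. nome (- s / 2 - z) * theta_term s z n) has_sum nome (- s / 2 - z) * jtheta s z) UNIV"
    by (intro has_sum_cmult_right jtheta_has_sum assms)
  also have "?this \<longleftrightarrow> ((\<lambda>n::int. nome (s * of_int n ^ 2 / 2 + of_int n * (z + s))) has_sum nome (- s / 2 - z) * jtheta s z) UNIV"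
  proof (rule has_sum_reindex_bij_witness[of _ "\<lambda>n. n + 1" "\<lambda>n. n - 1"])
    fix n :: int
    have "s * of_int (n - 1) ^ 2 / 2 + of_int (n - 1) * (z + s) = (- s / 2 - z) + (s * of_int n ^ 2 / 2 + of_int n * z)"
      by (simp add: power2_eq_square field_simps)
    thus "nome (s * of_int (n - 1) ^ 2 / 2 + of_int (n - 1) * (z + s)) = nome (- s / 2 - z) * theta_term s z n"
      by (simp only: nome_add)
  qed auto
  finally show ?thesis using jtheta_has_sum[OF assms, of "z + s"] has_sum_unique by blast
qed

lemma has_sum_sum:
  fixes f :: "'i \<Rightarrow> 'a \<Rightarrow> complex"
  assumes "\<And>i. i \<in> I \<Longrightarrow> (f i has_sum S i) A"
  shows "((\<lambda>x. \<Sum>i\<in>I. f i x) has_sum (\<Sum>i\<in>I. S i)) A"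
  using assms by (induction I rule: infinite_finite_induct) (auto intro!: has_sum_add)

text \<open>Induction on the number \<open>m\<close> of residue classes collected so far, for
  \<open>f\<close> cut off to the residues below \<open>m\<close>.\<close>

lemma has_sum_int_mod_split:
  fixes f :: "int \<Rightarrow> complex"
  assumes M: "M > 0" and S: "\<And>r. r < M \<Longrightarrow> ((\<lambda>k. f (int M * k + int r)) has_sum S r) UNIV"
  shows "(f has_sum (\<Sum>r<M. S r)) UNIV"
proof -
  have "((\<lambda>n. if n mod int M < int m then f n else 0) has_sum (\<Sum>r<m. S r)) UNIV" if "m \<le> M" for m
    using that
  proof (induction m)
    case 0
    have "\<not> n mod int M < 0" for n using M by (simp add: not_less)
    thus ?case by simp
  next
    case (Suc m)
    have bij: "bij_betw (\<lambda>k. int M * k + int m) UNIV {n. n mod int M = int m}"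
    proof (rule bij_betwI[where g = "\<lambda>n. n div int M"])
      show "(\<lambda>k. int M * k + int m) \<in> UNIV \<rightarrow> {n. n mod int M = int m}" using Suc.prems by auto
      show "int M * (y div int M) + int m = y" if "y \<in> {n. n mod int M = int m}" for y
        using that by (metis mem_Collect_eq mult_div_mod_eq)
      show "(int M * x + int m) div int M = x" for x
        using Suc.prems M by simp
    qed auto
    have "(f has_sum S m) {n. n mod int M = int m}"
      using S[of m] Suc.prems has_sum_reindex_bij_betw[OF bij, of f "S m"] by simp
    hence 1: "((\<lambda>n. if n mod int M = int m then f n else 0) has_sum S m) UNIV"
      using has_sum_cong_neutral[of UNIV "{n. n mod int M = int m}" "\<lambda>n. if n mod int M = int m then f n else 0" f "S m"] by auto
    have "((\<lambda>n. (if n mod int M < int m then f n else 0) + (if n mod int M = int m then f n else 0)) has_sum ((\<Sum>r<m. S r) + S m)) UNIV"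
      by (intro has_sum_add 1 Suc.IH) (use Suc.prems in auto)
    also have "(\<lambda>n. (if n mod int M < int m then f n else 0) + (if n mod int M = int m then f n else 0)) = (\<lambda>n. if n mod int M < int (Suc m) then f n else 0)"
      by (intro ext) auto
    finally show ?case by simp
  qed
  from this[of M] show ?thesis using M by simp
qed

text \<open>The Kronecker symbol (12/n), the sign attached to q^(n^2/24) in the theta series of
  eta.\<close>

definition chi12 :: "int \<Rightarrow> complex" where
  "chi12 n = (if n mod 12 \<in> {1, 11} then 1 else if n mod 12 \<in> {5, 7} then -1 else 0)"

lemma chi12_cong: "[m = n] (mod 12) \<Longrightarrow> chi12 m = chi12 n"
  by (simp add: chi12_def cong_def)

lemma mod_12_cases:
  obtains "(n::int) mod 12 = 0" | "n mod 12 = 1" | "n mod 12 = 2" | "n mod 12 = 3" | "n mod 12 = 4" | "n mod 12 = 5"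
    | "n mod 12 = 6" | "n mod 12 = 7" | "n mod 12 = 8" | "n mod 12 = 9" | "n mod 12 = 10" | "n mod 12 = 11"
proof -
  have "n mod 12 \<in> {0..<12}" by simp
  also have "{0..<12::int} = {0,1,2,3,4,5,6,7,8,9,10,11}" by (simp add: set_eq_iff) presburger
  finally show ?thesis using that by auto
qed

lemma chi12_minus: "chi12 (- n) = chi12 n"
  by (cases n rule: mod_12_cases) (auto simp: chi12_def zmod_zminus1_eq_if)

lemma chi12_mult: "chi12 (m * n) = chi12 m * chi12 n"
proof -
  let ?R = "{0,1,2,3,4,5,6,7,8,9,10,11} :: int set"
  have *: "\<forall>a\<in>?R. \<forall>b\<in>?R. chi12 (a * b) = chi12 a * chi12 b"
    by (simp add: chi12_def)
  have R: "k mod 12 \<in> ?R" for k :: int by (cases k rule: mod_12_cases) simp_all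
  have "chi12 (m * n) = chi12 ((m mod 12) * (n mod 12))" by (rule chi12_cong) (simp add: cong_def mod_mult_eq)
  also have "\<dots> = chi12 (m mod 12) * chi12 (n mod 12)" by (rule *[THEN bspec, THEN bspec, OF R R])
  also have "\<dots> = chi12 m * chi12 n" by (simp add: chi12_def)
  finally show ?thesis .
qed

lemma chi12_6k1: "chi12 (6 * k + 1) = (if even k then 1 else -1)"
proof (cases "even k")
  case True
  then obtain j where "k = 2 * j" by (elim evenE)
  thus ?thesis by (simp add: chi12_def)
next
  case False
  then obtain j where "k = 2 * j + 1" by (elim oddE)
  hence "6 * k + 1 = 12 * j + 7" by simp
  hence "(6 * k + 1) mod 12 = 7" by simp
  thus ?thesis using False by (simp add: chi12_def)
qed

lemma norm_chi12_le: "norm (chi12 n) \<le> 1"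
  by (simp add: chi12_def)

lemma chi12_eq_0: "n mod 6 \<noteq> 1 \<Longrightarrow> n mod 6 \<noteq> 5 \<Longrightarrow> chi12 n = 0"
proof -
  assume *: "n mod 6 \<noteq> 1" "n mod 6 \<noteq> 5"
  have "n mod 6 = n mod 12 mod 6" by (simp add: mod_mod_cancel)
  thus ?thesis using * by (cases n rule: mod_12_cases) (simp_all add: chi12_def)
qed

abbreviation eta_term :: "complex \<Rightarrow> int \<Rightarrow> complex" where
  "eta_term \<tau> n \<equiv> chi12 n * nome (of_int n ^ 2 * \<tau> / 24)"

text \<open>With n = 6 k + 1 the exponent n^2/24 is 1/24 + k (3 k + 1)/2. The indices
  \<open>k = s\<close> and \<open>k = - s\<close> give the two powers in
  \<open>pentagonal_term\<close>.\<close>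

lemma eta_series_aux:
  assumes "Im \<tau> > 0"
  shows "((\<lambda>k::int. eta_term \<tau> (6 * k + 1)) has_sum eta \<tau>) UNIV"
proof -
  define g where "g k = eta_term \<tau> (6 * k + 1)" for k :: int
  define q where "q = nome \<tau>"
  have q: "norm q < 1" using assms by (simp add: q_def norm_nome_less_1_iff)
  have "(\<lambda>k. norm (g k)) summable_on UNIV"
  proof (rule summable_on_comparison_test)
    show "(\<lambda>k::int. norm (nome (\<tau> / 24)) * norm (nome ((3 * \<tau>) * of_int k ^ 2 / 2 + of_int k * (\<tau> / 2)))) summable_on UNIV"
      using assms by (intro summable_on_cmult_right nome_quadratic_abs_summable) auto
    fix k :: int
    have "of_int (6 * k + 1) ^ 2 * \<tau> / 24 = \<tau> / 24 + ((3 * \<tau>) * of_int k ^ 2 / 2 + of_int k * (\<tau> / 2))"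
      by (simp add: power2_eq_square field_simps)
    hence "norm (g k) = norm (chi12 (6 * k + 1)) * (norm (nome (\<tau> / 24)) * norm (nome ((3 * \<tau>) * of_int k ^ 2 / 2 + of_int k * (\<tau> / 2))))"
      unfolding g_def by (simp only: nome_add norm_mult)
    also have "\<dots> \<le> 1 * (norm (nome (\<tau> / 24)) * norm (nome ((3 * \<tau>) * of_int k ^ 2 / 2 + of_int k * (\<tau> / 2))))"
      by (intro mult_right_mono norm_chi12_le) auto
    finally show "norm (g k) \<le> norm (nome (\<tau> / 24)) * norm (nome ((3 * \<tau>) * of_int k ^ 2 / 2 + of_int k * (\<tau> / 2)))" by simp
  qed auto
  then obtain S where S: "(g has_sum S) UNIV"
    using abs_summable_summable summable_on_def by blast
  \<comment> \<open>Absolute convergence provides an unordered sum, which may be evaluated along the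
    symmetric intervals, where the partial sums are those of the pentagonal number theorem.\<close>
  have flim: "filterlim (\<lambda>n. {- int n..int n}) (finite_subsets_at_top UNIV) sequentially"
    unfolding filterlim_finite_subsets_at_top
  proof safe
    fix X :: "int set" assume "finite X"
    then obtain B where B: "\<And>x. x \<in> X \<Longrightarrow> \<bar>x\<bar> \<le> B"
      using finite_imp_Sup_less by (metis finite_imageI Max_ge image_eqI)
    show "\<forall>\<^sub>F y in sequentially. finite {- int y..int y} \<and> X \<subseteq> {- int y..int y} \<and> {- int y..int y} \<subseteq> UNIV"
      using eventually_ge_at_top[of "nat B"] by eventually_elim (use B in fastforce)
  qed
  have "(\<lambda>n. \<Sum>k\<in>{- int n..int n}. g k) \<longlonglongrightarrow> S"
    using S unfolding has_sum_def by (rule filterlim_compose) (rule flim)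
  moreover have "(\<Sum>k\<in>{- int n..int n}. g k) = nome (\<tau> / 24) * (1 + (\<Sum>s=1..n. pentagonal_term q s))" for n
  proof (induction n)
    case 0
    show ?case by (simp add: g_def chi12_def)
  next
    case (Suc n)
    have "{- int (Suc n)..int (Suc n)} = insert (int (Suc n)) (insert (- int (Suc n)) {- int n..int n})" by auto
    hence "(\<Sum>k\<in>{- int (Suc n)..int (Suc n)}. g k) = g (int (Suc n)) + g (- int (Suc n)) + (\<Sum>k\<in>{- int n..int n}. g k)"
      by (simp add: add_ac)
    moreover have "g (int s) = nome (\<tau> / 24) * ((-1)^s * q ^ (s * (3 * s + 1) div 2))" for s
    proof -
      have "even (s * (3 * s + 1))" by auto
      then obtain m where m: "s * (3 * s + 1) = 2 * m" by (elim evenE)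
      hence m': "of_nat s * (3 * of_nat s + 1) = 2 * (of_nat m :: complex)"
        by (metis of_nat_mult of_nat_add of_nat_1 of_nat_numeral)
      have "(of_int (6 * int s + 1) ^ 2 * \<tau> / 24) = \<tau> / 24 + (of_nat s * (3 * of_nat s + 1)) / 2 * \<tau>"
        by (simp add: power2_eq_square field_simps)
      hence "nome (of_int (6 * int s + 1) ^ 2 * \<tau> / 24) = nome (\<tau> / 24) * q ^ m"
        unfolding m' q_def nome_power by (simp only: nome_add) simp
      thus ?thesis unfolding g_def m chi12_6k1 by simp
    qed
    moreover have "g (- int s) = nome (\<tau> / 24) * ((-1)^s * q ^ (s * (3 * s - 1) div 2))" for s
    proof (cases "s = 0")
      case False
      have "even (s * (3 * s - 1))" using False by auto
      then obtain m where m: "s * (3 * s - 1) = 2 * m" by (elim evenE)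
      have "of_nat s * (3 * of_nat s - 1) = (of_nat (s * (3 * s - 1)) :: complex)"
        using False by (simp add: of_nat_diff)
      hence m': "of_nat s * (3 * of_nat s - 1) = 2 * (of_nat m :: complex)"
        unfolding m by (simp only: of_nat_mult of_nat_numeral)
      have "(of_int (6 * (- int s) + 1) ^ 2 * \<tau> / 24) = \<tau> / 24 + (of_nat s * (3 * of_nat s - 1)) / 2 * \<tau>"
        by (simp add: power2_eq_square field_simps)
      hence "nome (of_int (6 * (- int s) + 1) ^ 2 * \<tau> / 24) = nome (\<tau> / 24) * q ^ m"
        unfolding m' q_def nome_power by (simp only: nome_add) simp
      thus ?thesis unfolding g_def m chi12_6k1 by simp
    qed (simp add: g_def chi12_def)
    ultimately show ?case using Suc.IH
      by (simp only: sum.cl_ivl_Suc) (simp add: algebra_simps del: mult_Suc mult_Suc_right)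
  qed
  ultimately have "(\<lambda>n. nome (\<tau> / 24) * (1 + (\<Sum>s=1..n. pentagonal_term q s))) \<longlonglongrightarrow> S"
    by simp
  moreover have "(\<lambda>n. nome (\<tau> / 24) * (1 + (\<Sum>s=1..n. pentagonal_term q s))) \<longlonglongrightarrow> eta \<tau>"
    unfolding eta_eq q_def[symmetric] by (intro tendsto_mult tendsto_const pentagonal_LIMSEQ q)
  ultimately have "S = eta \<tau>" by (rule LIMSEQ_unique)
  with S show ?thesis unfolding g_def by simp
qed

text \<open>The factor 2 comes from \<open>n\<close> and \<open>- n\<close>: the map
  \<open>k \<mapsto> -1 - k\<close> matches the class of 5 modulo 6 with the negatives of the class
  of 1, and \<open>chi12\<close> kills the other classes.\<close>

lemma eta_series:
  assumes "Im \<tau> > 0"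
  shows "((\<lambda>n::int. eta_term \<tau> n) has_sum 2 * eta \<tau>) UNIV"
proof -
  let ?f = "\<lambda>n::int. eta_term \<tau> n"
  have "(?f has_sum (\<Sum>r<6::nat. if r \<in> {1, 5} then eta \<tau> else 0)) UNIV"
  proof (rule has_sum_int_mod_split)
    fix r :: nat assume "r < 6"
    consider "r = 1" | "r = 5" | "r < 6" "r \<noteq> 1" "r \<noteq> 5" using \<open>r < 6\<close> by blast
    thus "((\<lambda>k. ?f (int 6 * k + int r)) has_sum (if r \<in> {1, 5} then eta \<tau> else 0)) UNIV"
    proof cases
      case 1
      thus ?thesis using eta_series_aux[OF assms] by simp
    next
      case 2
      have "((\<lambda>k. ?f (6 * k + 5)) has_sum eta \<tau>) UNIV \<longleftrightarrow> ((\<lambda>k. ?f (6 * k + 1)) has_sum eta \<tau>) UNIV"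
      proof (rule has_sum_reindex_bij_witness[of _ "\<lambda>k. -1 - k" "\<lambda>k. -1 - k"])
        fix k :: int
        have "6 * (-1 - k) + 1 = - (6 * k + 5)" by simp
        moreover have "(of_int (- (6 * k + 5)) :: complex) ^ 2 = of_int (6 * k + 5) ^ 2"
          by (simp only: of_int_minus power2_minus)
        ultimately show "?f (6 * (-1 - k) + 1) = ?f (6 * k + 5)" by (simp only: chi12_minus)
      qed auto
      thus ?thesis using eta_series_aux[OF assms] 2 by simp
    next
      case 3
      have "chi12 (int 6 * k + int r) = 0" for k
        by (rule chi12_eq_0) (use 3 in auto)
      thus ?thesis using 3 by simp
    qed
  qed auto
  also have "(\<Sum>r<6::nat. if r \<in> {1, 5} then eta \<tau> else 0) = 2 * eta \<tau>"
    by (simp add: eval_nat_numeral)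
  finally show ?thesis .
qed

section \<open>Fourier coefficients of entire periodic functions\<close>

definition period_integral :: "(complex \<Rightarrow> complex) \<Rightarrow> complex" where
  "period_integral p = contour_integral (linepath 0 1) p"

abbreviation fourier_coeff :: "(complex \<Rightarrow> complex) \<Rightarrow> int \<Rightarrow> complex" where
  "fourier_coeff p m \<equiv> period_integral (\<lambda>z. p z * nome (- of_int m * z))"

lemma holomorphic_shift:
  assumes "h holomorphic_on UNIV"
  shows "(\<lambda>z. h (z + w)) holomorphic_on UNIV"
proof -
  have "(h \<circ> (\<lambda>z. z + w)) holomorphic_on UNIV"
    by (rule holomorphic_on_compose_gen[OF _ assms]) (auto intro!: holomorphic_intros)
  thus ?thesis by (simp add: o_def)
qed

text \<open>For a primitive \<open>Q\<close> the difference \<open>Q (z + 1) - Q z\<close> has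
  derivative 0. Since \<open>w\<close> may be any complex number, this also moves the line of
  integration up or down.\<close>

lemma period_integral_shift:
  assumes p: "p holomorphic_on UNIV" and per: "\<And>z. p (z + 1) = p z"
  shows "period_integral (\<lambda>z. p (z + w)) = period_integral p"
proof -
  obtain Q where Q: "\<And>z. (Q has_field_derivative p z) (at z)"
    using holomorphic_convex_primitive'[of UNIV p] p by (metis UNIV_I convex_UNIV open_UNIV)
  have Q': "((\<lambda>z. Q (z + w)) has_field_derivative p (z + w)) (at z)" for z w
    using Q[of "z + w"] by (auto simp: DERIV_shift)
  have val: "period_integral (\<lambda>z. p (z + w)) = Q (1 + w) - Q w" for w
  proof -
    have "((\<lambda>z. p (z + w)) has_contour_integral (Q (pathfinish (linepath 0 1) + w) - Q (pathstart (linepath 0 1) + w))) (linepath 0 1)"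
      by (rule contour_integral_primitive[where S = UNIV, OF _ valid_path_linepath]) (auto intro: Q')
    thus ?thesis unfolding period_integral_def by (simp add: contour_integral_unique)
  qed
  have "((\<lambda>z. Q (z + 1) - Q z) has_field_derivative 0) (at z)" for z
    using DERIV_diff[OF Q'[of 1 z] Q[of z]] by (simp add: per)
  then obtain c where "\<And>z. Q (z + 1) - Q z = c"
    using has_field_derivative_zero_constant[of UNIV "\<lambda>z. Q (z + 1) - Q z"] by auto
  hence "Q (1 + w) - Q w = Q (1 + 0) - Q 0" by (metis add.commute)
  thus ?thesis using val[of w] val[of 0] by simp
qed

lemma period_integral_cmult:
  "p holomorphic_on UNIV \<Longrightarrow> period_integral (\<lambda>z. c * p z) = c * period_integral p"
  unfolding period_integral_def
  by (intro contour_integral_lmul contour_integrable_holomorphic_simple[where S = UNIV]) auto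

lemma period_integral_diff:
  "p holomorphic_on UNIV \<Longrightarrow> r holomorphic_on UNIV \<Longrightarrow>
     period_integral (\<lambda>z. p z - r z) = period_integral p - period_integral r"
  unfolding period_integral_def
  by (intro contour_integral_diff contour_integrable_holomorphic_simple[where S = UNIV]) auto

lemma period_integral_bound:
  assumes "p holomorphic_on UNIV" "\<And>x. x \<in> closed_segment 0 1 \<Longrightarrow> norm (p x) \<le> B"
  shows "norm (period_integral p) \<le> B"
proof -
  have "0 \<le> B" using order.trans[OF norm_ge_zero assms(2)[of 0]] by simp
  moreover have "p contour_integrable_on linepath 0 1"
    using assms by (intro contour_integrable_holomorphic_simple[where S = UNIV]) auto
  ultimately show ?thesis unfolding period_integral_def
    using contour_integral_bound_linepath[of p 0 1 B] assms by auto
qed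

text \<open>The line of integration is moved by one unit in the direction in which
  \<open>nome (- of_int m * z)\<close> decays; on the two shifted segments \<open>h\<close> is
  bounded by compactness.\<close>

lemma fourier_coefficient_bound:
  assumes h: "h holomorphic_on UNIV" and per: "\<And>z. h (z + 1) = h z"
  obtains B where "\<And>m::int. norm (fourier_coeff h m) \<le> B * exp (- 2 * pi * \<bar>real_of_int m\<bar>)"
proof -
  have cont: "continuous_on A h" for A
    using h holomorphic_on_imp_continuous_on holomorphic_on_subset by blast
  have "compact (closed_segment 0 1 :: complex set)" by simp
  hence "bounded ((\<lambda>x. h (x + w)) ` closed_segment 0 1)" for w
    by (intro compact_imp_bounded compact_continuous_image continuous_on_compose2[OF cont[of UNIV]] continuous_intros) auto
  hence "\<exists>B. \<forall>x\<in>closed_segment 0 1. norm (h (x + w)) \<le> B" for w by (auto simp: bounded_iff)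
  then obtain B where B: "\<And>w x. x \<in> closed_segment 0 1 \<Longrightarrow> norm (h (x + w)) \<le> B w" by metis
  have "norm (fourier_coeff h m) \<le> max (B \<i>) (B (- \<i>)) * exp (- 2 * pi * \<bar>real_of_int m\<bar>)" for m :: int
  proof -
    define w where "w = (if m \<ge> 0 then - \<i> else \<i>)"
    have "fourier_coeff h m = period_integral (\<lambda>z. h (z + w) * nome (- of_int m * (z + w)))"
      by (rule period_integral_shift[symmetric])
         (auto intro!: holomorphic_intros h simp: per ring_distribs nome_diff)
    also have "norm \<dots> \<le> max (B \<i>) (B (- \<i>)) * exp (- 2 * pi * \<bar>real_of_int m\<bar>)"
    proof (rule period_integral_bound)
      show "(\<lambda>z. h (z + w) * nome (- of_int m * (z + w))) holomorphic_on UNIV"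
        by (intro holomorphic_intros holomorphic_shift h)
      fix x :: complex assume x: "x \<in> closed_segment 0 1"
      have "Im x = 0" using x by (auto simp: closed_segment_def)
      hence "norm (nome (- of_int m * (x + w))) = exp (- 2 * pi * \<bar>real_of_int m\<bar>)"
        by (auto simp: norm_nome w_def)
      moreover have "norm (h (x + w)) \<le> max (B \<i>) (B (- \<i>))"
        using B[OF x, of w] by (auto simp: w_def split: if_splits)
      ultimately show "norm (h (x + w) * nome (- of_int m * (x + w))) \<le> max (B \<i>) (B (- \<i>)) * exp (- 2 * pi * \<bar>real_of_int m\<bar>)"
        unfolding norm_mult by (simp only:) (intro mult_right_mono, auto)
    qed
    finally show ?thesis .
  qed
  thus ?thesis by (rule that)
qed

lemma fourier_coefficient_limit:
  assumes h: "h holomorphic_on UNIV" and per: "\<And>z. h (z + 1) = h z"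
  assumes m: "filterlim (\<lambda>n. real_of_int \<bar>m n\<bar>) at_top sequentially"
  shows "(\<lambda>n. fourier_coeff h (m n)) \<longlonglongrightarrow> 0"
proof -
  obtain B where B: "\<And>m::int. norm (fourier_coeff h m) \<le> B * exp (- 2 * pi * \<bar>real_of_int m\<bar>)"
    using fourier_coefficient_bound[OF h per] by blast
  have "filterlim (\<lambda>n. (- (2 * pi)) * real_of_int \<bar>m n\<bar>) at_bot sequentially"
    by (rule filterlim_tendsto_neg_mult_at_bot[OF tendsto_const _ m]) auto
  hence "(\<lambda>n. exp ((- (2 * pi)) * real_of_int \<bar>m n\<bar>)) \<longlonglongrightarrow> 0"
    by (rule filterlim_compose[OF exp_at_bot])
  hence "(\<lambda>n. B * exp ((- (2 * pi)) * real_of_int \<bar>m n\<bar>)) \<longlonglongrightarrow> 0"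
    by (rule tendsto_mult_right_zero)
  thus ?thesis
  proof (rule Lim_null_comparison[rotated], intro always_eventually allI)
    fix n show "norm (fourier_coeff h (m n)) \<le> B * exp ((- (2 * pi)) * real_of_int \<bar>m n\<bar>)"
      using B[of "m n"] by simp
  qed
qed

lemma nome_has_field_derivative:
  "(nome has_field_derivative (2 * of_real pi * \<i> * nome z)) (at z)"
  unfolding nome_def by (auto intro!: derivative_eq_intros)

text \<open>\<open>nome z - 1\<close> has simple zeros exactly at the integers, and
  \<open>D z - D 0\<close> vanishes there by periodicity, so the quotient is entire.\<close>

lemma periodic_divide_nome_minus_1:
  assumes D: "D holomorphic_on UNIV" and per: "\<And>z. D (z + 1) = D z"
  obtains h where "h holomorphic_on UNIV" "\<And>z. h (z + 1) = h z" "\<And>z. h z * (nome z - 1) = D z - D 0"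
proof -
  have per_int: "D (z + of_int n) = D z" for z n
  proof -
    have *: "D (z + of_nat k) = D z" for z k
      by (induction k) (use per in \<open>auto simp: add.assoc[symmetric] add.commute[of 1]\<close>)
    show ?thesis
      using *[of z "nat n"] *[of "z + of_int n" "nat (-n)"] by (cases "n \<ge> 0") auto
  qed
  have dD: "(D has_field_derivative deriv D z) (at z)" for z
    using D by (simp add: holomorphic_derivI)
  \<comment> \<open>At the integers the value is the quotient of the two derivatives at 0, the limit
    of the quotient of the difference quotients.\<close>
  define h where "h z = (if nome z = 1 then deriv D 0 / (2 * of_real pi * \<i>) else (D z - D 0) / (nome z - 1))" for z
  have h_per: "h (z + 1) = h z" for z by (simp add: h_def nome_add per)
  have hol: "h holomorphic_on {z. nome z \<noteq> 1}"
  proof -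
    have "(\<lambda>z. (D z - D 0) / (nome z - 1)) holomorphic_on {z. nome z \<noteq> 1}"
      by (intro holomorphic_intros holomorphic_on_subset[OF D]) auto
    thus ?thesis by (rule holomorphic_transform) (auto simp: h_def)
  qed
  have opn: "open {z. nome z \<noteq> 1}"
    by (intro open_Collect_neq continuous_intros)
  have "((\<lambda>z. ((D z - D 0) / (z - 0)) / ((nome z - nome 0) / (z - 0))) \<longlongrightarrow> deriv D 0 / (2 * of_real pi * \<i> * nome 0)) (at 0)"
    using dD[of 0] nome_has_field_derivative[of 0]
    by (intro tendsto_divide) (auto simp: has_field_derivative_iff)
  moreover have "eventually (\<lambda>z. z \<in> ball 0 1 - {0}) (at (0::complex))"
    by (intro eventually_at_in_open) auto
  hence "eventually (\<lambda>z. ((D z - D 0) / (z - 0)) / ((nome z - nome 0) / (z - 0)) = h z) (at 0)"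
  proof eventually_elim
    case (elim z)
    have "nome z \<noteq> 1" unfolding nome_eq_1_iff using elim by (auto elim!: Ints_cases)
    thus ?case using elim by (simp add: h_def)
  qed
  moreover have "h 0 = deriv D 0 / (2 * of_real pi * \<i> * nome 0)" by (simp add: h_def)
  ultimately have lim0: "(h \<longlongrightarrow> h 0) (at 0)" by (simp only:) (rule Lim_transform_eventually)
  have ball: "h holomorphic_on ball 0 1"
  proof (rule no_isolated_singularity'[of "{0}"])
    show "h holomorphic_on ball 0 1 - {0}"
      by (rule holomorphic_on_subset[OF hol]) (auto simp: nome_eq_1_iff elim!: Ints_cases)
    show "(h \<longlongrightarrow> h z) (at z within ball 0 1)" if "z \<in> {0}" for z
      using that lim0 by (auto simp: at_within_open[of 0 "ball 0 1"])
  qed auto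
  have "h field_differentiable at z" for z
  proof (cases "nome z = 1")
    case False
    thus ?thesis using hol opn by (intro holomorphic_on_imp_differentiable_at[of h "{z. nome z \<noteq> 1}"]) auto
  next
    case True
    then obtain n where n: "z = of_int n" by (auto simp: nome_eq_1_iff elim: Ints_cases)
    \<comment> \<open>Periodicity carries differentiability from 0 to the other integers.\<close>
    have "h = (\<lambda>w. h (w - of_int n))"
      using per_int[of "w - of_int n" n for w] by (auto simp: h_def nome_diff fun_eq_iff)
    moreover have "(\<lambda>w. h (w - of_int n)) field_differentiable at z"
    proof -
      have "h field_differentiable at 0" using ball by (intro holomorphic_on_imp_differentiable_at[of h "ball 0 1"]) auto
      then obtain d where "(h has_field_derivative d) (at (z - of_int n))" unfolding n field_differentiable_def by auto
      hence "((\<lambda>w. h (w + - of_int n)) has_field_derivative d) (at z)"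
        by (subst DERIV_shift[symmetric]) simp
      thus ?thesis by (auto simp: field_differentiable_def)
    qed
    ultimately show ?thesis by simp
  qed
  moreover have "h z * (nome z - 1) = D z - D 0" for z
  proof (cases "nome z = 1")
    case True
    then obtain n where n: "z = of_int n" by (auto simp: nome_eq_1_iff elim: Ints_cases)
    show ?thesis using per_int[of 0 n] n by simp
  qed (auto simp: h_def)
  ultimately show ?thesis using that[of h] h_per by (auto simp: holomorphic_on_def)
qed

text \<open>
  Writing \<open>D z - D 0 = h z (nome z - 1)\<close>, the Fourier coefficients of \<open>D - D 0\<close> are differences of
  consecutive coefficients of \<open>h\<close>, and those decay by shifting the line of integration.
\<close>

lemma fourier_coefficients_zero_imp_zero_at_0:
  assumes D: "D holomorphic_on UNIV" and per: "\<And>z. D (z + 1) = D z"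
      and zero: "\<And>m::int. fourier_coeff D m = 0"
  shows "D 0 = 0"
proof -
  obtain h where h: "h holomorphic_on UNIV" "\<And>z. h (z + 1) = h z" "\<And>z. h z * (nome z - 1) = D z - D 0"
    using periodic_divide_nome_minus_1[OF D per] by blast
  define a where "a m = fourier_coeff h m" for m :: int
  define e where "e m = period_integral (\<lambda>z. nome (- of_int m * z))" for m :: int
  have e0: "e 0 = 1" by (simp add: e_def period_integral_def)
  have e: "e m = 0" if "m \<noteq> 0" for m
  proof -
    \<comment> \<open>A shift by half a wavelength flips the sign of the integrand, so
      \<open>e m = - e m\<close>.\<close>
    have "e m = period_integral (\<lambda>z. nome (- of_int m * (z + - 1 / (2 * of_int m))))" unfolding e_def
      by (rule period_integral_shift[symmetric]) (auto intro!: holomorphic_intros simp: ring_distribs nome_diff)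
    also have "(\<lambda>z. nome (- of_int m * (z + - 1 / (2 * of_int m)))) = (\<lambda>z. (-1) * nome (- of_int m * z))"
    proof
      fix z :: complex
      have "- of_int m * (z + - 1 / (2 * of_int m)) = - of_int m * z + 1/2" using that by (simp add: field_simps)
      thus "nome (- of_int m * (z + - 1 / (2 * of_int m))) = (-1) * nome (- of_int m * z)"
        by (simp only: nome_add nome_half) simp
    qed
    also have "period_integral \<dots> = (-1) * e m"
      unfolding e_def by (rule period_integral_cmult) (auto intro!: holomorphic_intros)
    finally show ?thesis by simp
  qed
  have step: "a (m - 1) - a m = - D 0 * e m" for m
  proof -
    have "a (m - 1) - a m = period_integral (\<lambda>z. h z * nome (- of_int (m - 1) * z) - h z * nome (- of_int m * z))"
      unfolding a_def by (rule period_integral_diff[symmetric]) (auto intro!: holomorphic_intros h)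
    also have "(\<lambda>z. h z * nome (- of_int (m - 1) * z) - h z * nome (- of_int m * z)) = (\<lambda>z. D z * nome (- of_int m * z) - D 0 * nome (- of_int m * z))"
    proof
      fix z :: complex
      have "- of_int (m - 1) * z = z + - of_int m * z" by (simp add: algebra_simps)
      hence "h z * nome (- of_int (m - 1) * z) - h z * nome (- of_int m * z) = (h z * (nome z - 1)) * nome (- of_int m * z)"
        by (simp only: nome_add) (simp add: algebra_simps)
      thus "h z * nome (- of_int (m - 1) * z) - h z * nome (- of_int m * z) = D z * nome (- of_int m * z) - D 0 * nome (- of_int m * z)"
        unfolding h(3) by (simp add: algebra_simps)
    qed
    also have "period_integral \<dots> = fourier_coeff D m - period_integral (\<lambda>z. D 0 * nome (- of_int m * z))"
      by (rule period_integral_diff) (auto intro!: holomorphic_intros D)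
    also have "period_integral (\<lambda>z. D 0 * nome (- of_int m * z)) = D 0 * e m"
      unfolding e_def by (rule period_integral_cmult) (auto intro!: holomorphic_intros)
    finally show ?thesis using zero by simp
  qed
  \<comment> \<open>By \<open>step\<close>, \<open>a\<close> is constant on the nonnegative and on
    the negative indices, with a jump of \<open>D 0\<close> between -1 and 0; decay in both
    directions forces both constants to be 0.\<close>
  have pos: "a (int n) = a 0" for n
  proof (induction n)
    case (Suc n)
    thus ?case using step[of "int (Suc n)"] e[of "int (Suc n)"] by simp
  qed auto
  have neg: "a (- 1 - int n) = a (-1)" for n
  proof (induction n)
    case (Suc n)
    have "a (-1 - int (Suc n)) = a (-1 - int n)"
      using step[of "-1 - int n"] e[of "-1 - int n"] by (simp add: algebra_simps)
    thus ?case using Suc by simp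
  qed auto
  have "(\<lambda>n. a (int n)) \<longlonglongrightarrow> 0" unfolding a_def
    by (rule fourier_coefficient_limit[OF h(1,2)]) (simp add: filterlim_real_sequentially)
  hence a0: "a 0 = 0" unfolding pos by (simp add: LIMSEQ_const_iff)
  have "filterlim (\<lambda>n. real_of_int \<bar>- 1 - int n\<bar>) at_top sequentially"
    by (rule filterlim_at_top_mono[OF filterlim_real_sequentially]) auto
  hence "(\<lambda>n. a (- 1 - int n)) \<longlonglongrightarrow> 0" unfolding a_def
    by (rule fourier_coefficient_limit[OF h(1,2)])
  hence "a (-1) = 0" unfolding neg by (simp add: LIMSEQ_const_iff)
  thus ?thesis using step[of 0] a0 e0 by simp
qed

text \<open>Translation by \<open>x\<close> only multiplies the m-th coefficient by
  \<open>nome (of_int m * x)\<close>, so the result at 0 applies to every translate.\<close>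

lemma fourier_coefficients_zero_imp_zero:
  assumes D: "D holomorphic_on UNIV" and per: "\<And>z. D (z + 1) = D z"
      and zero: "\<And>m::int. fourier_coeff D m = 0"
  shows "D x = 0"
proof -
  have D': "(\<lambda>z. D (z + x)) holomorphic_on UNIV"
    by (rule holomorphic_shift[OF D])
  have "D (0 + x) = 0"
  proof (rule fourier_coefficients_zero_imp_zero_at_0[of "\<lambda>z. D (z + x)"])
    fix m :: int
    have "period_integral (\<lambda>z. D (z + x) * nome (- of_int m * z)) = period_integral (\<lambda>z. nome (of_int m * x) * (D (z + x) * nome (- of_int m * (z + x))))"
      by (intro arg_cong[of _ _ period_integral]) (auto simp: fun_eq_iff ring_distribs nome_diff nome_minus)
    also have "\<dots> = nome (of_int m * x) * period_integral (\<lambda>z. D (z + x) * nome (- of_int m * (z + x)))"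
      by (rule period_integral_cmult) (auto intro!: holomorphic_intros D')
    also have "period_integral (\<lambda>z. D (z + x) * nome (- of_int m * (z + x))) = fourier_coeff D m"
      by (rule period_integral_shift) (auto intro!: holomorphic_intros D simp: per ring_distribs nome_diff)
    finally show "period_integral (\<lambda>z. D (z + x) * nome (- of_int m * z)) = 0" using zero by simp
  qed (use D' per[of "z + x" for z] in \<open>auto simp: add_ac\<close>)
  thus ?thesis by simp
qed

text \<open>The quasi-period relates consecutive Fourier coefficients, so a single one determines the function.\<close>

lemma quasiperiodic_zero:
  assumes D: "D holomorphic_on UNIV" and per: "\<And>z. D (z + 1) = D z"
      and quasi: "\<And>z. D (z + w) = c * nome (- z) * D z" and c: "c \<noteq> 0"
      and zero: "period_integral D = 0"
  shows "D x = 0"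
proof (rule fourier_coefficients_zero_imp_zero[OF D per])
  define a where "a m = fourier_coeff D m" for m :: int
  have step: "a m = c * nome (- of_int m * w) * a (m + 1)" for m
  proof -
    have "a m = period_integral (\<lambda>z. D (z + w) * nome (- of_int m * (z + w)))"
      unfolding a_def by (rule period_integral_shift[symmetric])
       (auto intro!: holomorphic_intros D simp: per ring_distribs nome_diff)
    also have "(\<lambda>z. D (z + w) * nome (- of_int m * (z + w))) = (\<lambda>z. (c * nome (- of_int m * w)) * (D z * nome (- of_int (m + 1) * z)))"
    proof
      fix z :: complex
      have "- of_int (m + 1) * z = - z + - of_int m * z" by (simp add: algebra_simps)
      moreover have "- of_int m * (z + w) = - of_int m * w + - of_int m * z" by (simp add: algebra_simps)
      ultimately show "D (z + w) * nome (- of_int m * (z + w)) = (c * nome (- of_int m * w)) * (D z * nome (- of_int (m + 1) * z))"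
        by (simp only: nome_add quasi) (simp add: mult_ac)
    qed
    also have "period_integral \<dots> = (c * nome (- of_int m * w)) * a (m + 1)"
      unfolding a_def by (rule period_integral_cmult) (auto intro!: holomorphic_intros D)
    finally show ?thesis .
  qed
  have a0: "a 0 = 0" using zero by (simp add: a_def)
  have "a (int n) = 0 \<and> a (- int n) = 0" for n
  proof (induction n)
    case (Suc n)
    show ?case using Suc step[of "int n"] step[of "- int (Suc n)"] c by (simp add: add.commute)
  qed (use a0 in auto)
  hence "a m = 0" for m by (metis int_cases2)
  thus "fourier_coeff D m = 0" for m :: int by (simp add: a_def)
qed

text \<open>By \<open>quasiperiodic_zero\<close> such a function is determined by its zeroth Fourier
  coefficient, so these functions form a space of dimension at most one. The point \<open>x0\<close>
  ensures that \<open>E\<close> has a nonzero coefficient to divide by.\<close>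

lemma quasiperiodic_proportional:
  assumes D: "D holomorphic_on UNIV" "\<And>z. D (z + 1) = D z" "\<And>z. D (z + w) = c * nome (- z) * D z"
  assumes E: "E holomorphic_on UNIV" "\<And>z. E (z + 1) = E z" "\<And>z. E (z + w) = c * nome (- z) * E z"
  assumes c: "c \<noteq> 0" and nz: "E x0 \<noteq> 0"
  shows "\<exists>C. \<forall>z. D z = C * E z"
proof -
  have nz': "period_integral E \<noteq> 0" using quasiperiodic_zero[OF E c, of x0] nz by blast
  define C where "C = period_integral D / period_integral E"
  have "D z - C * E z = 0" for z
  proof (rule quasiperiodic_zero[of "\<lambda>z. D z - C * E z" w c])
    show "period_integral (\<lambda>z. D z - C * E z) = 0"
    proof -
      have "period_integral (\<lambda>z. D z - C * E z) = period_integral D - period_integral (\<lambda>z. C * E z)"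
        by (intro period_integral_diff holomorphic_intros D(1) E(1))
      also have "\<dots> = 0" unfolding period_integral_cmult[OF E(1)] using nz' by (simp add: C_def)
      finally show ?thesis .
    qed
  qed (use D E c in \<open>auto intro!: holomorphic_intros simp: algebra_simps\<close>)
  thus ?thesis by auto
qed

section \<open>The inversion formula for theta series\<close>

text \<open>Writing n = M k + r turns each residue class into \<open>jtheta s\<close> at
  \<open>s * z\<close> with z = r/M, together with a Gaussian prefactor: exactly the left side of
  the inversion formula \<open>jtheta_transform\<close>.\<close>

lemma periodic_series_jtheta:
  fixes ch :: "int \<Rightarrow> complex"
  assumes \<tau>: "Im \<tau> > 0" and M: "M > 0" and per: "\<And>n k. ch (int M * k + n) = ch n"
  defines "s \<equiv> of_nat M ^ 2 * \<tau> / 12"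
  shows "((\<lambda>n::int. ch n * nome (of_int n ^ 2 * \<tau> / 24)) has_sum
           (\<Sum>r<M. ch (int r) * (nome (s * (of_nat r / of_nat M)^2 / 2) * jtheta s (s * (of_nat r / of_nat M))))) UNIV"
proof (rule has_sum_int_mod_split[OF M])
  fix r :: nat
  have s: "Im s > 0" using \<tau> M by (simp add: s_def)
  have "((\<lambda>k::int. ch (int r) * (nome (s * (of_nat r / of_nat M)^2 / 2) * nome (s * of_int k ^ 2 / 2 + of_int k * (s * (of_nat r / of_nat M)))))
         has_sum ch (int r) * (nome (s * (of_nat r / of_nat M)^2 / 2) * jtheta s (s * (of_nat r / of_nat M)))) UNIV"
    by (intro has_sum_cmult_right jtheta_has_sum s)
  moreover have "ch (int M * k + int r) * nome (of_int (int M * k + int r) ^ 2 * \<tau> / 24) =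
     ch (int r) * (nome (s * (of_nat r / of_nat M)^2 / 2) * nome (s * of_int k ^ 2 / 2 + of_int k * (s * (of_nat r / of_nat M))))" for k
  proof -
    have "of_int (int M * k + int r) ^ 2 * \<tau> / 24 = s * (of_nat r / of_nat M)^2 / 2 + (s * of_int k ^ 2 / 2 + of_int k * (s * (of_nat r / of_nat M)))"
      unfolding s_def using M by (simp add: power2_eq_square divide_simps) (simp add: algebra_simps)
    thus ?thesis by (simp only: nome_add per)
  qed
  ultimately show "((\<lambda>k. ch (int M * k + int r) * nome (of_int (int M * k + int r) ^ 2 * \<tau> / 24)) has_sum
       ch (int r) * (nome (s * (of_nat r / of_nat M)^2 / 2) * jtheta s (s * (of_nat r / of_nat M)))) UNIV"
    by simp
qed

text \<open>The non-vanishing of eta, visible from its product, replaces a computation of the zeros of theta.\<close>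

lemma jtheta_not_identically_zero:
  assumes "Im s > 0"
  shows "\<exists>z. jtheta s z \<noteq> 0"
proof (rule ccontr)
  assume *: "\<not> ?thesis"
  \<comment> \<open>Chosen so that the series of \<open>eta \<tau>\<close>, split modulo 12, has
    theta parameter 12^2 \<tau>/12 = s.\<close>
  define \<tau> where "\<tau> = s / 12"
  have \<tau>: "Im \<tau> > 0" using assms by (simp add: \<tau>_def)
  have s: "of_nat 12 ^ 2 * \<tau> / 12 = s" by (simp add: \<tau>_def)
  have "chi12 (int 12 * k + n) = chi12 n" for k n by (rule chi12_cong) (simp add: cong_def)
  from periodic_series_jtheta[OF \<tau> _ this] have "((\<lambda>n::int. eta_term \<tau> n) has_sum 0) UNIV"
    using * unfolding s by simp
  hence "2 * eta \<tau> = 0" using eta_series[OF \<tau>] has_sum_unique by blast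
  thus False using eta_nonzero[OF \<tau>] by simp
qed

lemma Im_minus_inverse_pos: "Im s > 0 \<Longrightarrow> Im (- 1 / s) > 0"
  by (auto simp: complex_eq_iff Im_divide power2_eq_square zero_less_divide_iff intro!: add_nonneg_pos)

text \<open>After z -> s z, the prefactor turns the quasi-period \<open>s\<close> into the period 1,
  while the period 1 becomes the quasi-period -1/s. The left side thus obeys the same two laws as
  \<open>jtheta (- 1 / s)\<close>.\<close>

lemma jtheta_transform_ex:
  assumes s: "Im s > 0"
  shows "\<exists>C. \<forall>z. nome (s * z ^ 2 / 2) * jtheta s (s * z) = C * jtheta (- 1 / s) z"
proof -
  have s0: "s \<noteq> 0" using s by auto
  have s': "Im (- 1 / s) > 0" by (rule Im_minus_inverse_pos[OF s])
  obtain x0 where x0: "jtheta (- 1 / s) x0 \<noteq> 0" using jtheta_not_identically_zero[OF s'] by blast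
  show ?thesis
  proof (rule quasiperiodic_proportional[where w = "- 1 / s" and c = "nome (- (- 1 / s) / 2)" and ?x0.0 = x0])
    have "(jtheta s \<circ> (\<lambda>z. s * z)) holomorphic_on UNIV"
      by (rule holomorphic_on_compose_gen[OF _ jtheta_holomorphic[OF s]]) (auto intro!: holomorphic_intros)
    thus "(\<lambda>z. nome (s * z\<^sup>2 / 2) * jtheta s (s * z)) holomorphic_on UNIV"
      by (intro holomorphic_on_mult) (auto simp: o_def intro!: holomorphic_intros)
    show "nome (s * (z + 1)\<^sup>2 / 2) * jtheta s (s * (z + 1)) = nome (s * z\<^sup>2 / 2) * jtheta s (s * z)" for z
    proof -
      have "jtheta s (s * (z + 1)) = nome (- s / 2 - s * z) * jtheta s (s * z)"
        using jtheta_plus_period[OF s, of "s * z"] by (simp add: algebra_simps)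
      moreover have "s * z\<^sup>2 / 2 = s * (z + 1)\<^sup>2 / 2 + (- s / 2 - s * z)"
        by (simp add: power2_eq_square field_simps)
      ultimately show ?thesis by (simp only: nome_add mult.assoc)
    qed
    show "nome (s * (z + - 1 / s)\<^sup>2 / 2) * jtheta s (s * (z + - 1 / s)) = nome (- (- 1 / s) / 2) * nome (- z) * (nome (s * z\<^sup>2 / 2) * jtheta s (s * z))" for z
    proof -
      have "jtheta s (s * z) = jtheta s (s * (z + - 1 / s))"
        using jtheta_plus_1[of s "s * (z + - 1 / s)"] s0 by (simp add: field_simps)
      moreover have "s * (z + - 1 / s)\<^sup>2 / 2 = - (- 1 / s) / 2 + (- z + s * z\<^sup>2 / 2)"
        using s0 by (simp add: power2_eq_square field_simps)
      ultimately show ?thesis by (simp only: nome_add mult.assoc)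
    qed
    show "jtheta (- 1 / s) (z + - 1 / s) = nome (- (- 1 / s) / 2) * nome (- z) * jtheta (- 1 / s) z" for z
    proof -
      have "- (- 1 / s) / 2 - z = - (- 1 / s) / 2 + - z" by simp
      thus ?thesis using jtheta_plus_period[OF s', of z] by (simp only: nome_add)
    qed
  qed (use jtheta_holomorphic[OF s'] jtheta_plus_1 x0 in auto)
qed

text \<open>Classically (-i s)^(-1/2). As a chosen constant of proportionality it involves no branch
  of the root; its scaling law is \<open>theta_factor_scale\<close>.\<close>

definition theta_factor :: "complex \<Rightarrow> complex" where
  "theta_factor s = (SOME C. \<forall>z. nome (s * z ^ 2 / 2) * jtheta s (s * z) = C * jtheta (- 1 / s) z)"

lemma jtheta_transform:
  "Im s > 0 \<Longrightarrow> nome (s * z ^ 2 / 2) * jtheta s (s * z) = theta_factor s * jtheta (- 1 / s) z"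
  using someI_ex[OF jtheta_transform_ex[of s]] unfolding theta_factor_def by blast

text \<open>Poisson summation for a theta series with periodic coefficients: these are replaced by
  their discrete Fourier transform modulo \<open>M\<close>.\<close>

lemma periodic_series_transform:
  fixes ch :: "int \<Rightarrow> complex"
  assumes \<tau>: "Im \<tau> > 0" and M: "M > 0" and per: "\<And>n k. ch (int M * k + n) = ch n"
  assumes L: "((\<lambda>n::int. ch n * nome (of_int n ^ 2 * \<tau> / 24)) has_sum L) UNIV"
  assumes R: "((\<lambda>m::int. (\<Sum>r<M. ch (int r) * nome (of_int m * of_nat r / of_nat M)) * nome (- 6 * of_int m ^ 2 / (of_nat M ^ 2 * \<tau>))) has_sum R) UNIV"
  shows "L = theta_factor (of_nat M ^ 2 * \<tau> / 12) * R"
proof -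
  define s where "s = of_nat M ^ 2 * \<tau> / 12"
  have s: "Im s > 0" using \<tau> M by (simp add: s_def)
  have s': "Im (- 1 / s) > 0" by (rule Im_minus_inverse_pos[OF s])
  have "((\<lambda>m::int. \<Sum>r<M. ch (int r) * nome ((- 1 / s) * of_int m ^ 2 / 2 + of_int m * (of_nat r / of_nat M)))
          has_sum (\<Sum>r<M. ch (int r) * jtheta (- 1 / s) (of_nat r / of_nat M))) UNIV"
    by (intro has_sum_sum has_sum_cmult_right jtheta_has_sum s')
  also have "(\<lambda>m::int. \<Sum>r<M. ch (int r) * nome ((- 1 / s) * of_int m ^ 2 / 2 + of_int m * (of_nat r / of_nat M))) =
      (\<lambda>m::int. (\<Sum>r<M. ch (int r) * nome (of_int m * of_nat r / of_nat M)) * nome (- 6 * of_int m ^ 2 / (of_nat M ^ 2 * \<tau>)))"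
    unfolding sum_distrib_right
  proof (intro ext sum.cong refl)
    fix m :: int and r :: nat
    have "\<tau> \<noteq> 0" using \<tau> by auto
    hence "(- 1 / s) * of_int m ^ 2 / 2 + of_int m * (of_nat r / of_nat M) = of_int m * of_nat r / of_nat M + - 6 * of_int m ^ 2 / (of_nat M ^ 2 * \<tau>)"
      unfolding s_def using M by simp
    thus "ch (int r) * nome ((- 1 / s) * of_int m ^ 2 / 2 + of_int m * (of_nat r / of_nat M)) = ch (int r) * nome (of_int m * of_nat r / of_nat M) * nome (- 6 * of_int m ^ 2 / (of_nat M ^ 2 * \<tau>))"
      by (simp only: nome_add mult.assoc)
  qed
  finally have R': "R = (\<Sum>r<M. ch (int r) * jtheta (- 1 / s) (of_nat r / of_nat M))"
    using R has_sum_unique by blast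
  have "L = (\<Sum>r<M. ch (int r) * (nome (s * (of_nat r / of_nat M)^2 / 2) * jtheta s (s * (of_nat r / of_nat M))))"
    using periodic_series_jtheta[OF \<tau> M per] L has_sum_unique unfolding s_def by blast
  also have "\<dots> = theta_factor s * R"
    unfolding R' jtheta_transform[OF s] sum_distrib_left by (simp add: mult_ac)
  finally show ?thesis unfolding s_def .
qed

lemma nome_geometric_sum:
  assumes "M > 0"
  shows "(\<Sum>r<M. nome (of_int m * of_nat r / of_nat M)) = (if int M dvd m then of_nat M else 0)"
proof (cases "int M dvd m")
  case True
  then obtain k where "m = int M * k" by auto
  hence "nome (of_int m * of_nat r / of_nat M) = 1" for r
    using assms nome_of_int[of "k * int r"] by (simp add: mult_ac)
  thus ?thesis using True by simp
next
  case False
  define x where "x = nome (of_int m / of_nat M)"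
  have "x \<noteq> 1"
  proof
    assume "x = 1"
    then obtain k where "(of_int m / of_nat M :: complex) = of_int k" unfolding x_def nome_eq_1_iff by (elim Ints_cases)
    hence "(of_int m :: complex) = of_int (int M * k)" using assms by (simp add: field_simps)
    hence "m = int M * k" using of_int_eq_iff by blast
    thus False using False by simp
  qed
  moreover have "x ^ M = 1" using assms by (simp add: x_def nome_power)
  moreover have "nome (of_int m * of_nat r / of_nat M) = x ^ r" for r
    by (simp add: x_def nome_power mult_ac)
  ultimately show ?thesis using False by (simp add: sum_gp_strict)
qed

text \<open>The series with terms \<open>nome (s * (n + z)^2 / 2)\<close> is inverted twice,
  directly and after splitting \<open>n\<close> modulo \<open>M\<close>. In the second case the sum
  over the classes keeps only the dual frequencies divisible by \<open>M\<close>, and these form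
  \<open>M\<close> times the first dual series. Comparison at a point where it is nonzero gives the
  law.\<close>

lemma theta_factor_scale:
  assumes s: "Im s > 0" and M: "M > 0"
  shows "theta_factor s = of_nat M * theta_factor (of_nat M ^ 2 * s)"
proof -
  define t where "t = of_nat M ^ 2 * s"
  have t: "Im t > 0" using s M by (simp add: t_def)
  have s': "Im (- 1 / s) > 0" by (rule Im_minus_inverse_pos[OF s])
  have t': "Im (- 1 / t) > 0" by (rule Im_minus_inverse_pos[OF t])
  obtain z where z: "jtheta (- 1 / s) z \<noteq> 0" using jtheta_not_identically_zero[OF s'] by blast
  define f where "f s z = nome (s * z ^ 2 / 2) * jtheta s (s * z)" for s z
  have f: "((\<lambda>n::int. nome (s * (of_int n + z)^2 / 2)) has_sum f s z) UNIV" if "Im s > 0" for s z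
  proof -
    have "((\<lambda>n::int. nome (s * z ^ 2 / 2) * nome (s * of_int n ^ 2 / 2 + of_int n * (s * z))) has_sum f s z) UNIV"
      unfolding f_def by (intro has_sum_cmult_right jtheta_has_sum that)
    also have "(\<lambda>n::int. nome (s * z ^ 2 / 2) * nome (s * of_int n ^ 2 / 2 + of_int n * (s * z))) = (\<lambda>n::int. nome (s * (of_int n + z)^2 / 2))"
      unfolding nome_add[symmetric] by (intro ext arg_cong[of _ _ nome]) (simp add: power2_eq_square field_simps)
    finally show ?thesis .
  qed
  have "((\<lambda>n::int. nome (s * (of_int n + z)^2 / 2)) has_sum (\<Sum>r<M. f t ((of_nat r + z) / of_nat M))) UNIV"
  proof (rule has_sum_int_mod_split[OF M])
    fix r :: nat
    have "s * (of_int (int M * k + int r) + z)^2 / 2 = t * (of_int k + (of_nat r + z) / of_nat M)^2 / 2" for k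
      using M unfolding t_def by (simp add: power2_eq_square field_simps)
    thus "((\<lambda>k. nome (s * (of_int (int M * k + int r) + z)^2 / 2)) has_sum f t ((of_nat r + z) / of_nat M)) UNIV"
      using f[OF t, of "(of_nat r + z) / of_nat M"] by simp
  qed
  with f[OF s] have "f s z = (\<Sum>r<M. f t ((of_nat r + z) / of_nat M))" using has_sum_unique by blast
  hence 1: "theta_factor s * jtheta (- 1 / s) z = theta_factor t * (\<Sum>r<M. jtheta (- 1 / t) ((of_nat r + z) / of_nat M))"
    unfolding f_def jtheta_transform[OF s] jtheta_transform[OF t] by (simp only: sum_distrib_left)
  have "((\<lambda>m::int. \<Sum>r<M. nome ((- 1 / t) * of_int m ^ 2 / 2 + of_int m * ((of_nat r + z) / of_nat M)))
          has_sum (\<Sum>r<M. jtheta (- 1 / t) ((of_nat r + z) / of_nat M))) UNIV"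
    by (intro has_sum_sum jtheta_has_sum t')
  also have "(\<lambda>m::int. \<Sum>r<M. nome ((- 1 / t) * of_int m ^ 2 / 2 + of_int m * ((of_nat r + z) / of_nat M))) =
     (\<lambda>m::int. (if int M dvd m then of_nat M else 0) * nome ((- 1 / t) * of_int m ^ 2 / 2 + of_int m * z / of_nat M))"
    unfolding nome_geometric_sum[OF M, symmetric] sum_distrib_right nome_add[symmetric]
    by (intro ext sum.cong refl arg_cong[of _ _ nome]) (simp add: add_divide_distrib algebra_simps)
  finally have 2: "((\<lambda>m::int. (if int M dvd m then of_nat M else 0) * nome ((- 1 / t) * of_int m ^ 2 / 2 + of_int m * z / of_nat M))
          has_sum (\<Sum>r<M. jtheta (- 1 / t) ((of_nat r + z) / of_nat M))) UNIV" .
  have "((\<lambda>m::int. of_nat M * theta_term (- 1 / s) z m) has_sum (of_nat M * jtheta (- 1 / s) z)) UNIV"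
    by (intro has_sum_cmult_right jtheta_has_sum s')
  also have "?this \<longleftrightarrow> ((\<lambda>m::int. (if int M dvd m then of_nat M else 0) * nome ((- 1 / t) * of_int m ^ 2 / 2 + of_int m * z / of_nat M))
          has_sum (of_nat M * jtheta (- 1 / s) z)) {m. int M dvd m}"
  proof (rule has_sum_reindex_bij_witness[of _ "\<lambda>m. m div int M" "\<lambda>m. int M * m"])
    fix m :: int
    have "(- 1 / t) * of_int (int M * m) ^ 2 / 2 + of_int (int M * m) * z / of_nat M = (- 1 / s) * of_int m ^ 2 / 2 + of_int m * z"
      using M unfolding t_def by (simp add: power2_eq_square)
    thus "(if int M dvd int M * m then of_nat M else 0) * nome ((- 1 / t) * of_int (int M * m) ^ 2 / 2 + of_int (int M * m) * z / of_nat M) =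
          of_nat M * theta_term (- 1 / s) z m" by simp
  qed (use M in auto)
  also have "\<dots> \<longleftrightarrow> ((\<lambda>m::int. (if int M dvd m then of_nat M else 0) * nome ((- 1 / t) * of_int m ^ 2 / 2 + of_int m * z / of_nat M))
          has_sum (of_nat M * jtheta (- 1 / s) z)) UNIV"
    by (rule has_sum_cong_neutral) auto
  finally have "(\<Sum>r<M. jtheta (- 1 / t) ((of_nat r + z) / of_nat M)) = of_nat M * jtheta (- 1 / s) z"
    using 2 has_sum_unique by blast
  with 1 z show ?thesis unfolding t_def by simp
qed

section \<open>Gauss sums and the transformation of eta\<close>

definition root_char :: "nat \<Rightarrow> int \<Rightarrow> complex" where
  "root_char c n = nome (of_int n / of_nat c)"

lemma root_char_0 [simp]: "root_char c 0 = 1"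
  by (simp add: root_char_def)

lemma root_char_add: "root_char c (m + n) = root_char c m * root_char c n"
  by (simp add: root_char_def add_divide_distrib nome_add)

lemma root_char_cong:
  assumes "c > 0" "[m = n] (mod int c)"
  shows "root_char c m = root_char c n"
proof -
  obtain k where "m - n = int c * k" using assms(2) by (metis cong_iff_dvd_diff dvdE)
  hence "(of_int m - of_int n :: complex) = of_nat c * of_int k"
    by (metis of_int_diff of_int_mult of_int_of_nat_eq)
  hence "of_int m / of_nat c - of_int n / of_nat c = (of_int k :: complex)"
    using assms(1) by (simp add: diff_divide_distrib[symmetric])
  thus ?thesis unfolding root_char_def by (intro nome_eqI) auto
qed

lemma root_char_sum:
  assumes "c > 0"
  shows "(\<Sum>r<c. root_char c (m * int r)) = (if int c dvd m then of_nat c else 0)"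
  using nome_geometric_sum[OF assms, of m] by (simp add: root_char_def)

lemma sum_residue_affine:
  fixes h :: "int \<Rightarrow> complex"
  assumes c: "c > 0" and cop: "coprime a (int c)" and per: "\<And>m n. [m = n] (mod int c) \<Longrightarrow> h m = h n"
  shows "(\<Sum>r<c. h (a * int r + t)) = (\<Sum>r<c. h (int r))"
proof -
  define \<phi> where "\<phi> r = nat ((a * int r + t) mod int c)" for r
  have int\<phi>: "int (\<phi> r) = (a * int r + t) mod int c" for r using c by (simp add: \<phi>_def)
  have inj: "inj_on \<phi> {..<c}"
  proof (rule inj_onI)
    fix x y assume xy: "x \<in> {..<c}" "y \<in> {..<c}" "\<phi> x = \<phi> y"
    hence "[a * int x + t = a * int y + t] (mod int c)" using int\<phi>[of x] int\<phi>[of y] by (simp add: cong_def)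
    hence "[a * int x = a * int y] (mod int c)" by (simp add: cong_add_rcancel)
    hence "[int x = int y] (mod int c)" using cop by (simp add: cong_mult_lcancel)
    thus "x = y" using xy by (simp add: cong_def)
  qed
  have sub: "\<phi> ` {..<c} \<subseteq> {..<c}"
  proof safe
    fix r
    have "int (\<phi> r) < int c" unfolding int\<phi> using c by simp
    thus "\<phi> r < c" by simp
  qed
  have "bij_betw \<phi> {..<c} {..<c}"
    using inj sub endo_inj_surj[of "{..<c}" \<phi>] by (auto simp: bij_betw_def)
  hence "(\<Sum>r<c. h (int (\<phi> r))) = (\<Sum>r<c. h (int r))" by (rule sum.reindex_bij_betw)
  moreover have "h (int (\<phi> r)) = h (a * int r + t)" for r
    by (rule per) (simp add: int\<phi>)
  ultimately show ?thesis by simp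
qed

text \<open>Representing residues as b r + a s makes an additive character modulo
  \<open>a * b\<close> split into one modulo \<open>a\<close> in r and one modulo \<open>b\<close>
  in s.\<close>

lemma sum_residue_crt:
  fixes h :: "int \<Rightarrow> complex"
  assumes a: "a > 0" and b: "b > 0" and cop: "coprime (int a) (int b)"
      and per: "\<And>m n. [m = n] (mod int (a * b)) \<Longrightarrow> h m = h n"
  shows "(\<Sum>r<a * b. h (int r)) = (\<Sum>r<a. \<Sum>s<b. h (int b * int r + int a * int s))"
proof -
  define \<phi> where "\<phi> = (\<lambda>(r, s). nat ((int b * int r + int a * int s) mod int (a * b)))"
  have int\<phi>: "int (\<phi> (r, s)) = (int b * int r + int a * int s) mod int (a * b)" for r s
    using a b by (simp add: \<phi>_def)
  have inj: "inj_on \<phi> ({..<a} \<times> {..<b})"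
  proof (rule inj_onI)
    fix x y assume x: "x \<in> {..<a} \<times> {..<b}" and y: "y \<in> {..<a} \<times> {..<b}" and eq: "\<phi> x = \<phi> y"
    obtain r s r' s' where rs: "x = (r, s)" "y = (r', s')" by (cases x, cases y)
    have *: "[int b * int r + int a * int s = int b * int r' + int a * int s'] (mod int (a * b))"
      using eq int\<phi>[of r s] int\<phi>[of r' s'] unfolding rs by (simp add: cong_def)
    have "[int b * int r + int a * int s = int b * int r' + int a * int s'] (mod int a)"
      using * by (rule cong_dvd_modulus) simp
    hence "[int b * int r = int b * int r'] (mod int a)" by (simp add: cong_def)
    hence "[int r = int r'] (mod int a)" using cop by (simp add: cong_mult_lcancel coprime_commute)
    moreover have "[int b * int r + int a * int s = int b * int r' + int a * int s'] (mod int b)"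
      using * by (rule cong_dvd_modulus) simp
    hence "[int a * int s = int a * int s'] (mod int b)" by (simp add: cong_def)
    hence "[int s = int s'] (mod int b)" using cop by (simp add: cong_mult_lcancel)
    ultimately show "x = y" using x y unfolding rs by (simp add: cong_def)
  qed
  have sub: "\<phi> ` ({..<a} \<times> {..<b}) \<subseteq> {..<a * b}"
  proof safe
    fix r s
    have "int (\<phi> (r, s)) < int (a * b)" unfolding int\<phi> using a b by simp
    thus "\<phi> (r, s) < a * b" by (simp only: of_nat_less_iff)
  qed
  have "\<phi> ` ({..<a} \<times> {..<b}) = {..<a * b}"
    by (rule card_subset_eq[OF _ sub]) (simp_all add: card_image[OF inj] card_cartesian_product)
  with inj have "bij_betw \<phi> ({..<a} \<times> {..<b}) {..<a * b}" by (simp add: bij_betw_def)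
  hence "(\<Sum>x\<in>{..<a} \<times> {..<b}. h (int (\<phi> x))) = (\<Sum>r<a * b. h (int r))" by (rule sum.reindex_bij_betw)
  moreover have "h (int (\<phi> x)) = h (int b * int (fst x) + int a * int (snd x))" for x
    by (rule per) (cases x, simp add: int\<phi>)
  ultimately show ?thesis by (simp add: sum.cartesian_product case_prod_unfold)
qed

definition gauss_sum :: "int \<Rightarrow> nat \<Rightarrow> complex" where
  "gauss_sum b c = (\<Sum>r<c. root_char c (b * int r ^ 2))"

text \<open>\<open>B\<close> inverts 4 b, so b (r + 2 B m)^2 is congruent to b r^2 + m r + B m^2,
  and shifting the summation variable leaves the plain Gauss sum.\<close>

lemma gauss_sum_complete_square:
  assumes c: "c > 0" and B: "[4 * b * B = 1] (mod int c)"
  shows "(\<Sum>r<c. root_char c (b * int r ^ 2 + m * int r)) = root_char c (- B * m ^ 2) * gauss_sum b c"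
proof -
  have "(\<Sum>r<c. root_char c (b * int r ^ 2 + m * int r)) = (\<Sum>r<c. root_char c (- B * m ^ 2) * root_char c (b * (1 * int r + 2 * B * m) ^ 2))"
  proof (intro sum.cong refl)
    fix r
    have "[4 * b * B * (m * int r + B * m ^ 2) = 1 * (m * int r + B * m ^ 2)] (mod int c)"
      by (intro cong_mult B cong_refl)
    hence "[b * int r ^ 2 - B * m ^ 2 + 4 * b * B * (m * int r + B * m ^ 2) = b * int r ^ 2 - B * m ^ 2 + 1 * (m * int r + B * m ^ 2)] (mod int c)"
      by (intro cong_add cong_refl)
    moreover have "b * int r ^ 2 - B * m ^ 2 + 4 * b * B * (m * int r + B * m ^ 2) = - B * m ^ 2 + b * (1 * int r + 2 * B * m) ^ 2"
      by (simp add: power2_eq_square algebra_simps)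
    moreover have "b * int r ^ 2 - B * m ^ 2 + 1 * (m * int r + B * m ^ 2) = b * int r ^ 2 + m * int r" by simp
    ultimately have "[- B * m ^ 2 + b * (1 * int r + 2 * B * m) ^ 2 = b * int r ^ 2 + m * int r] (mod int c)" by simp
    from root_char_cong[OF c this] show "root_char c (b * int r ^ 2 + m * int r) = root_char c (- B * m ^ 2) * root_char c (b * (1 * int r + 2 * B * m) ^ 2)"
      by (simp only: root_char_add[symmetric])
  qed
  also have "\<dots> = root_char c (- B * m ^ 2) * (\<Sum>r<c. root_char c (b * (1 * int r + 2 * B * m) ^ 2))"
    by (rule sum_distrib_left[symmetric])
  also have "(\<Sum>r<c. root_char c (b * (1 * int r + 2 * B * m) ^ 2)) = gauss_sum b c"
    unfolding gauss_sum_def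
    by (rule sum_residue_affine[where h = "\<lambda>n. root_char c (b * n ^ 2)"])
       (auto intro!: root_char_cong c cong_mult cong_pow)
  finally show ?thesis .
qed

lemma gauss_sum_mult_square:
  assumes "c > 0" "coprime a (int c)"
  shows "gauss_sum (b * a ^ 2) c = gauss_sum b c"
proof -
  have "(\<Sum>r<c. root_char c (b * (a * int r + 0) ^ 2)) = gauss_sum b c"
    unfolding gauss_sum_def
    by (rule sum_residue_affine[where h = "\<lambda>n. root_char c (b * n ^ 2)"])
       (auto intro!: root_char_cong assms cong_mult cong_pow)
  thus ?thesis by (simp add: gauss_sum_def power_mult_distrib mult_ac)
qed

definition chi12_gauss :: complex where
  "chi12_gauss = (\<Sum>r<12. chi12 (int r) * root_char 12 (int r))"

text \<open>The value of \<open>chi12_gauss\<close> is irrelevant, since it cancels against the factor of automorphy.\<close>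

lemma chi12_gauss_sum: "(\<Sum>r<12. chi12 (int r) * root_char 12 (m * int r)) = chi12 m * chi12_gauss"
proof -
  define S where "S m = (\<Sum>r<12. chi12 (int r) * root_char 12 (m * int r))" for m
  have S: "S m = chi12 a * S (m * a)" if "coprime a 12" for a m
  proof -
    have "(\<Sum>r<12. chi12 (a * int r + 0) * root_char 12 (m * (a * int r + 0))) = S m"
      unfolding S_def
      by (rule sum_residue_affine[where h = "\<lambda>n. chi12 n * root_char 12 (m * n)"])
         (use that in \<open>auto intro!: arg_cong2[of _ _ _ _ "(*)"] chi12_cong root_char_cong cong_mult\<close>)
    thus ?thesis by (simp add: chi12_mult S_def sum_distrib_left mult_ac)
  qed
  have S_cong: "S m = S n" if "[m = n] (mod 12)" for m n
    unfolding S_def by (intro sum.cong refl arg_cong2[of _ _ _ _ "(*)"] root_char_cong cong_mult) (use that in auto)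
  consider "even m" | "3 dvd m" | "coprime m 12"
  proof -
    have "coprime m 12" if "odd m" "\<not> 3 dvd m"
    proof -
      have "coprime m 2" using that by (simp add: coprime_commute coprime_left_2_iff_odd)
      moreover have "coprime m 3" using that prime_imp_coprime[of 3 m] by (simp add: coprime_commute)
      ultimately have "coprime m (2 * 2 * 3)" by (simp only: coprime_mult_right_iff)
      thus ?thesis by simp
    qed
    thus ?thesis using that by blast
  qed
  hence "S m = chi12 m * S 1"
  proof cases
    case 1
    \<comment> \<open>7 is a unit that fixes every even \<open>m\<close> modulo 12 but has character
      -1, so \<open>S m\<close> is its own negative. For multiples of 3 the unit 5 does the
      same.\<close>
    have "chi12 7 = -1" by (simp add: chi12_def)
    moreover have "coprime (7::int) 12" unfolding coprime_iff_invertible_int by (intro exI[of _ 7]) (simp add: cong_def)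
    moreover have "[m * 7 = m] (mod 12)" unfolding cong_iff_dvd_diff using 1 by (elim evenE) simp
    ultimately have "S m = - S m" using S[of 7 m] S_cong[of "m * 7" m] by simp
    hence "S m = 0" by simp
    moreover have "chi12 m = 0" by (rule chi12_eq_0) (use 1 in presburger)+
    ultimately show ?thesis by simp
  next
    case 2
    have "chi12 5 = -1" by (simp add: chi12_def)
    moreover have "coprime (5::int) 12" unfolding coprime_iff_invertible_int by (intro exI[of _ 5]) (simp add: cong_def)
    moreover have "[m * 5 = m] (mod 12)" unfolding cong_iff_dvd_diff using 2 by (elim dvdE) simp
    ultimately have "S m = - S m" using S[of 5 m] S_cong[of "m * 5" m] by simp
    hence "S m = 0" by simp
    moreover have "chi12 m = 0" by (rule chi12_eq_0) (use 2 in presburger)+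
    ultimately show ?thesis by simp
  next
    case 3
    have "chi12 m * chi12 m = 1"
    proof -
      have "odd m" "\<not> 3 dvd m" using coprime_common_divisor[OF 3, of 2] coprime_common_divisor[OF 3, of 3] by auto
      hence "m mod 12 = 1 \<or> m mod 12 = 5 \<or> m mod 12 = 7 \<or> m mod 12 = 11" by presburger
      thus ?thesis by (auto simp: chi12_def)
    qed
    moreover have "S 1 = chi12 m * S m" using S[OF 3, of 1] by simp
    ultimately show ?thesis by (simp add: mult.assoc[symmetric])
  qed
  thus ?thesis by (simp add: S_def chi12_gauss_def)
qed

text \<open>The translate multiplies the n-th term by a phase of period \<open>c\<close>, so the
  coefficients have period 12 c. By the Chinese remainder theorem their Fourier transform is a
  character sum modulo 12 times a quadratic sum with coefficient 12^2 b; completing its square takes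
  the inverse \<open>B\<close> of 4 * 12^2 b = 576 b. The phase left over is quadratic in
  \<open>m\<close> and amounts to a translate of \<open>eta\<close> by - 24 B/c.\<close>

lemma eta_transform_theta_factor:
  assumes \<tau>: "Im \<tau> > 0" and c: "c > 0" "coprime (int c) 12" and B: "[576 * b * B = 1] (mod int c)"
  shows "eta (24 * of_int b / of_nat c + \<tau>) =
           theta_factor (12 * of_nat c ^ 2 * \<tau>) * chi12_gauss * chi12 (int c) * gauss_sum b c *
             eta (- 24 * of_int B / of_nat c - 1 / (of_nat c ^ 2 * \<tau>))"
proof -
  define ch where "ch n = chi12 n * root_char c (b * n ^ 2)" for n
  define \<tau>' where "\<tau>' = - 24 * of_int B / of_nat c - 1 / (of_nat c ^ 2 * \<tau>)"
  define K where "K = chi12_gauss * chi12 (int c) * gauss_sum b c"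
  have ch_cong: "ch m = ch n" if "[m = n] (mod int (12 * c))" for m n
  proof -
    have "[m = n] (mod 12)" "[m = n] (mod int c)"
      using cong_dvd_modulus[OF that, of 12] cong_dvd_modulus[OF that, of "int c"] by auto
    thus ?thesis unfolding ch_def
      by (intro arg_cong2[of _ _ _ _ "(*)"] chi12_cong root_char_cong c cong_mult cong_pow cong_refl)
  qed
  have Im': "Im \<tau>' > 0"
  proof -
    have "Im (of_nat c ^ 2 * \<tau>) > 0" using \<tau> c by simp
    hence "Im (- 1 / (of_nat c ^ 2 * \<tau>)) > 0" by (rule Im_minus_inverse_pos)
    thus ?thesis by (simp add: \<tau>'_def)
  qed
  have "2 * eta (24 * of_int b / of_nat c + \<tau>) = theta_factor (of_nat (12 * c) ^ 2 * \<tau> / 12) * (K * (2 * eta \<tau>'))"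
  proof (rule periodic_series_transform[OF \<tau>, of "12 * c" ch])
    show "12 * c > 0" using c by simp
    show "ch (int (12 * c) * k + n) = ch n" for n k by (rule ch_cong) (simp add: cong_def)
    have "Im (24 * of_int b / of_nat c + \<tau>) > 0" using \<tau> by simp
    from eta_series[OF this]
    have "((\<lambda>n::int. eta_term (24 * of_int b / of_nat c + \<tau>) n) has_sum 2 * eta (24 * of_int b / of_nat c + \<tau>)) UNIV" .
    also have "(\<lambda>n::int. eta_term (24 * of_int b / of_nat c + \<tau>) n) = (\<lambda>n. ch n * nome (of_int n ^ 2 * \<tau> / 24))"
    proof
      fix n :: int
      have "of_int n ^ 2 * (24 * of_int b / of_nat c + \<tau>) / 24 = of_int (b * n ^ 2) / of_nat c + of_int n ^ 2 * \<tau> / 24"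
        using c by (simp add: field_simps)
      thus "eta_term (24 * of_int b / of_nat c + \<tau>) n = ch n * nome (of_int n ^ 2 * \<tau> / 24)"
        by (simp only: nome_add ch_def root_char_def mult.assoc)
    qed
    finally show "((\<lambda>n. ch n * nome (of_int n ^ 2 * \<tau> / 24)) has_sum 2 * eta (24 * of_int b / of_nat c + \<tau>)) UNIV" .
    have inner: "(\<Sum>r<12 * c. ch (int r) * nome (of_int m * of_nat r / of_nat (12 * c))) = K * (chi12 m * root_char c (- B * m ^ 2))" for m
    proof -
      have "(\<Sum>r<12 * c. ch (int r) * nome (of_int m * of_nat r / of_nat (12 * c))) = (\<Sum>r<12 * c. ch (int r) * root_char (12 * c) (m * int r))"
        by (simp add: root_char_def)
      also have "\<dots> = (\<Sum>r<12. \<Sum>s<c. ch (int c * int r + int 12 * int s) * root_char (12 * c) (m * (int c * int r + int 12 * int s)))"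
        by (rule sum_residue_crt[where h = "\<lambda>n. ch n * root_char (12 * c) (m * n)"])
           (use c in \<open>auto intro!: arg_cong2[of _ _ _ _ "(*)"] ch_cong root_char_cong cong_mult simp: coprime_commute\<close>)
      also have "\<dots> = (\<Sum>r<12. \<Sum>s<c. chi12 (int c) * (chi12 (int r) * root_char 12 (m * int r)) * root_char c (b * 12 ^ 2 * int s ^ 2 + m * int s))"
      proof (intro sum.cong refl)
        fix r s
        have "chi12 (int c * int r + int 12 * int s) = chi12 (int c * int r)" by (rule chi12_cong) (simp add: cong_def)
        hence 1: "chi12 (int c * int r + int 12 * int s) = chi12 (int c) * chi12 (int r)" by (simp add: chi12_mult)
        have 2: "root_char c (b * (int c * int r + int 12 * int s) ^ 2) = root_char c (b * 12 ^ 2 * int s ^ 2)"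
        proof (rule root_char_cong[OF c(1)])
          have "b * (int c * int r + int 12 * int s) ^ 2 - b * 12 ^ 2 * int s ^ 2 = int c * (b * (int c * int r ^ 2 + 24 * int r * int s))"
            by (simp add: power2_eq_square algebra_simps)
          thus "[b * (int c * int r + int 12 * int s)\<^sup>2 = b * 12\<^sup>2 * (int s)\<^sup>2] (mod int c)"
            unfolding cong_iff_dvd_diff by simp
        qed
        have "of_int (m * (int c * int r + int 12 * int s)) / of_nat (12 * c) = (of_int (m * int r) / of_nat 12 + of_int (m * int s) / of_nat c :: complex)"
          using c by (simp add: field_simps)
        hence 3: "root_char (12 * c) (m * (int c * int r + int 12 * int s)) = root_char 12 (m * int r) * root_char c (m * int s)"
          unfolding root_char_def by (simp only: nome_add)
        show "ch (int c * int r + int 12 * int s) * root_char (12 * c) (m * (int c * int r + int 12 * int s)) = chi12 (int c) * (chi12 (int r) * root_char 12 (m * int r)) * root_char c (b * 12 ^ 2 * int s ^ 2 + m * int s)"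
          unfolding ch_def 1 2 3 root_char_add by (simp only: mult_ac)
      qed
      also have "\<dots> = chi12 (int c) * (\<Sum>r<12. chi12 (int r) * root_char 12 (m * int r)) * (\<Sum>s<c. root_char c (b * 12 ^ 2 * int s ^ 2 + m * int s))"
        by (simp only: sum_distrib_left sum_distrib_right) (rule sum.swap)
      also have "(\<Sum>s<c. root_char c (b * 12 ^ 2 * int s ^ 2 + m * int s)) = root_char c (- B * m ^ 2) * gauss_sum (b * 12 ^ 2) c"
        by (rule gauss_sum_complete_square[OF c(1)]) (use B in \<open>simp add: mult_ac\<close>)
      also have "gauss_sum (b * 12 ^ 2) c = gauss_sum b c"
        by (rule gauss_sum_mult_square) (use c in \<open>auto simp: coprime_commute\<close>)
      finally show ?thesis by (simp add: chi12_gauss_sum K_def mult_ac)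
    qed
    have "((\<lambda>m::int. K * (eta_term \<tau>' m)) has_sum K * (2 * eta \<tau>')) UNIV"
      by (intro has_sum_cmult_right eta_series Im')
    also have "(\<lambda>m::int. K * (eta_term \<tau>' m)) = (\<lambda>m. K * (chi12 m * root_char c (- B * m ^ 2)) * nome (- 6 * of_int m ^ 2 / (of_nat (12 * c) ^ 2 * \<tau>)))"
    proof
      fix m :: int
      have "\<tau> \<noteq> 0" using \<tau> by auto
      hence "of_int m ^ 2 * \<tau>' / 24 = of_int (- B * m ^ 2) / of_nat c + - 6 * of_int m ^ 2 / (of_nat (12 * c) ^ 2 * \<tau>)"
        unfolding \<tau>'_def using c by (simp add: field_simps power2_eq_square)
      thus "K * (eta_term \<tau>' m) = K * (chi12 m * root_char c (- B * m ^ 2)) * nome (- 6 * of_int m ^ 2 / (of_nat (12 * c) ^ 2 * \<tau>))"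
        by (simp only: nome_add root_char_def mult.assoc)
    qed
    finally show "((\<lambda>m. (\<Sum>r<12 * c. ch (int r) * nome (of_int m * of_nat r / of_nat (12 * c))) * nome (- 6 * of_int m ^ 2 / (of_nat (12 * c) ^ 2 * \<tau>))) has_sum K * (2 * eta \<tau>')) UNIV"
      unfolding inner .
  qed
  also have "of_nat (12 * c) ^ 2 * \<tau> / 12 = 12 * of_nat c ^ 2 * \<tau>" by (simp add: power2_eq_square)
  finally show ?thesis by (simp add: K_def \<tau>'_def mult_ac)
qed

text \<open>Classically (-i \<tau>)^(-1/2).\<close>

definition eta_factor :: "complex \<Rightarrow> complex" where
  "eta_factor \<tau> = eta \<tau> / eta (- 1 / \<tau>)"

lemma eta_factor_nonzero: "Im \<tau> > 0 \<Longrightarrow> eta_factor \<tau> \<noteq> 0"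
  using Im_minus_inverse_pos[of \<tau>] by (auto simp: eta_factor_def eta_nonzero)

text \<open>The case \<open>c = 1\<close>, where all congruences are trivial; it absorbs
  \<open>chi12_gauss\<close> into \<open>eta_factor\<close>.\<close>

lemma eta_factor_eq:
  assumes "Im \<tau> > 0"
  shows "eta_factor \<tau> = theta_factor (12 * \<tau>) * chi12_gauss"
proof -
  have "chi12 1 = 1" by (simp add: chi12_def)
  moreover have "gauss_sum 0 1 = 1" by (simp add: gauss_sum_def)
  ultimately show ?thesis
    using eta_transform_theta_factor[OF assms, of 1 0 0] eta_nonzero[OF Im_minus_inverse_pos[OF assms]]
    by (simp add: eta_factor_def field_simps cong_def)
qed

lemma eta_factor_scale:
  assumes "Im \<tau> > 0" "M > 0"
  shows "eta_factor \<tau> = of_nat M * eta_factor (of_nat M ^ 2 * \<tau>)"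
  using assms theta_factor_scale[of "12 * \<tau>" M] by (simp add: eta_factor_eq mult_ac)

lemma eta_transform:
  assumes \<tau>: "Im \<tau> > 0" and c: "c > 0" "coprime (int c) 12" and B: "[576 * b * B = 1] (mod int c)"
  shows "eta (24 * of_int b / of_nat c + \<tau>) =
           eta_factor \<tau> * chi12 (int c) * (gauss_sum b c / of_nat c) *
             eta (- 24 * of_int B / of_nat c - 1 / (of_nat c ^ 2 * \<tau>))"
proof -
  have "eta_factor \<tau> / of_nat c = theta_factor (12 * of_nat c ^ 2 * \<tau>) * chi12_gauss"
    using eta_factor_scale[OF \<tau> c(1)] eta_factor_eq[of "of_nat c ^ 2 * \<tau>"] \<tau> c by (simp add: mult_ac)
  thus ?thesis unfolding eta_transform_theta_factor[OF assms] by (simp flip: \<open>eta_factor \<tau> / of_nat c = _\<close>)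
qed

lemma eta_factor_continuous: "continuous_on upper_half_plane eta_factor"
proof -
  have cont: "continuous_on upper_half_plane eta"
    by (rule holomorphic_on_imp_continuous_on[OF eta_holomorphic])
  have nz: "x \<noteq> 0" if "x \<in> upper_half_plane" for x using that by (auto simp: upper_half_plane_def)
  have "continuous_on upper_half_plane (\<lambda>\<tau>. eta (- 1 / \<tau>))"
    by (rule continuous_on_compose2[OF cont])
       (use nz Im_minus_inverse_pos in \<open>auto intro!: continuous_intros simp: upper_half_plane_def\<close>)
  thus ?thesis unfolding eta_factor_def[abs_def]
    by (intro continuous_intros cont ballI eta_nonzero Im_minus_inverse_pos) (auto simp: upper_half_plane_def)
qed

text \<open>
  The scaling behaviour under squares of integers extends to squares of rationals and, by continuity,
  to the factor 2; no explicit square root \<open>sqrt (-i\<tau>)\<close> is needed.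
\<close>

lemma eta_factor_double:
  assumes \<tau>: "Im \<tau> > 0"
  shows "eta_factor \<tau> = of_real (sqrt 2) * eta_factor (2 * \<tau>)"
proof -
  have "\<exists>x. \<forall>n. x n \<in> \<rat> \<and> x n > sqrt 2 \<and> x n < sqrt 2 + 1 / real (Suc n)"
  proof (rule choice, rule allI)
    fix n
    have "sqrt 2 < sqrt 2 + 1 / real (Suc n)" by simp
    from Rats_dense_in_real[OF this] show "\<exists>x. x \<in> \<rat> \<and> x > sqrt 2 \<and> x < sqrt 2 + 1 / real (Suc n)" by auto
  qed
  then obtain x where x: "\<And>n. x n \<in> \<rat>" "\<And>n. x n > sqrt 2" "\<And>n. x n < sqrt 2 + 1 / real (Suc n)" by blast
  have "(\<lambda>n. sqrt 2 + 1 / real (Suc n)) \<longlonglongrightarrow> sqrt 2 + 0"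
    by (intro tendsto_add tendsto_const LIMSEQ_Suc[OF lim_1_over_n])
  hence lim: "x \<longlonglongrightarrow> sqrt 2"
    using x by (intro tendsto_sandwich[OF _ _ tendsto_const, of "sqrt 2" x sequentially "\<lambda>n. sqrt 2 + 1 / real (Suc n)"]) (auto intro!: always_eventually less_imp_le)
  have pos: "x n > 0" for n using x(2)[of n] by (smt (verit) real_sqrt_gt_zero)
  have eq: "of_real (x n) * eta_factor (of_real (x n ^ 2) * \<tau>) = eta_factor \<tau>" for n
  proof -
    obtain p q :: nat where q: "q \<noteq> 0" "\<bar>x n\<bar> = real p / real q" using Rats_abs_nat_div_natE[OF x(1)[of n]] by metis
    hence pq: "x n = real p / real q" "p > 0" "q > 0" using pos[of n] by (auto simp: zero_less_divide_iff intro!: Nat.gr0I)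
    \<comment> \<open>With x = p/q, scaling this single point by p^2 and by q^2 reaches x^2 \<tau>
      and \<tau>.\<close>
    define t where "t = \<tau> / of_nat q ^ 2"
    have t: "Im t > 0" using \<tau> pq by (simp add: t_def Im_divide_of_nat)
    have "of_nat q * eta_factor \<tau> = of_nat p * eta_factor (of_nat p ^ 2 * t)"
      using eta_factor_scale[OF t pq(2)] eta_factor_scale[OF t pq(3)] pq by (simp add: t_def)
    moreover have "of_real (x n ^ 2) * \<tau> = of_nat p ^ 2 * t" by (simp add: t_def pq(1) power_divide)
    moreover have "complex_of_real (x n) = of_nat p / of_nat q" by (simp add: pq(1))
    ultimately show ?thesis using pq by (simp only:) (simp add: field_simps)
  qed
  have "(\<lambda>n. of_real (x n) * eta_factor (of_real (x n ^ 2) * \<tau>)) \<longlonglongrightarrow> of_real (sqrt 2) * eta_factor (of_real (sqrt 2 ^ 2) * \<tau>)"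
  proof (intro tendsto_mult tendsto_of_real lim)
    have "isCont eta_factor (of_real (sqrt 2 ^ 2) * \<tau>)"
      using \<tau> by (intro continuous_on_eq_continuous_at[OF open_upper_half_plane, THEN iffD1, OF eta_factor_continuous, rule_format])
        (simp add: upper_half_plane_def)
    thus "(\<lambda>n. eta_factor (of_real (x n ^ 2) * \<tau>)) \<longlonglongrightarrow> eta_factor (of_real (sqrt 2 ^ 2) * \<tau>)"
      by (rule isCont_tendsto_compose) (intro tendsto_intros lim)
  qed
  thus ?thesis unfolding eq by (simp add: LIMSEQ_const_iff)
qed

section \<open>Gauss sums modulo a prime and its square\<close>

definition legendre :: "nat \<Rightarrow> int \<Rightarrow> complex" where
  "legendre l n = of_int (Legendre n (int l))"

lemma legendre_cong:
  assumes "[m = n] (mod int l)"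
  shows "legendre l m = legendre l n"
proof -
  have "[m = 0] (mod int l) \<longleftrightarrow> [n = 0] (mod int l)"
    using assms by (simp add: cong_def)
  moreover have "QuadRes (int l) m \<longleftrightarrow> QuadRes (int l) n"
    using assms by (simp add: QuadRes_def cong_def)
  ultimately show ?thesis by (simp add: legendre_def Legendre_def)
qed

text \<open>Euler's criterion gives the identity modulo \<open>l\<close>. Both sides lie between -1
  and 1, so they differ by at most 2, which is less than \<open>l\<close>.\<close>

lemma legendre_mult:
  assumes l: "prime l" "l > 2"
  shows "legendre l (m * n) = legendre l m * legendre l n"
proof -
  have "[Legendre (m * n) (int l) = (m * n) ^ ((l - 1) div 2)] (mod int l)"
    by (rule euler_criterion[OF l])
  moreover have "[Legendre m (int l) * Legendre n (int l) = m ^ ((l - 1) div 2) * n ^ ((l - 1) div 2)] (mod int l)"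
    by (intro cong_mult euler_criterion[OF l])
  ultimately have "[Legendre (m * n) (int l) = Legendre m (int l) * Legendre n (int l)] (mod int l)"
    by (metis power_mult_distrib cong_sym cong_trans)
  hence "int l dvd Legendre (m * n) (int l) - Legendre m (int l) * Legendre n (int l)"
    by (simp add: cong_iff_dvd_diff)
  moreover have L: "\<bar>Legendre a (int l)\<bar> \<le> 1" for a by (simp add: Legendre_def)
  have "\<bar>Legendre (m * n) (int l)\<bar> \<le> 1" "\<bar>Legendre m (int l)\<bar> * \<bar>Legendre n (int l)\<bar> \<le> 1 * 1"
    using mult_mono[OF L[of m] L[of n]] L[of "m * n"] by auto
  hence "\<bar>Legendre (m * n) (int l) - Legendre m (int l) * Legendre n (int l)\<bar> < int l"
    using l(2) by (simp add: abs_mult[symmetric])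
  ultimately have "Legendre (m * n) (int l) = Legendre m (int l) * Legendre n (int l)"
    using zdvd_not_zless[of "\<bar>Legendre (m * n) (int l) - Legendre m (int l) * Legendre n (int l)\<bar>" "int l"] by fastforce
  thus ?thesis by (simp add: legendre_def)
qed

lemma legendre_square: "\<not> int l dvd n \<Longrightarrow> legendre l n * legendre l n = 1"
  by (auto simp: legendre_def Legendre_def cong_0_iff)

lemma legendre_square_arg: "\<not> int l dvd n \<Longrightarrow> prime l \<Longrightarrow> legendre l (n * n) = 1"
proof -
  assume n: "\<not> int l dvd n" and l: "prime l"
  have "\<not> int l dvd n * n" using n l by (simp add: prime_dvd_mult_iff)
  moreover have "QuadRes (int l) (n * n)" unfolding QuadRes_def
    by (rule exI[of _ n]) (simp add: power2_eq_square)
  ultimately show ?thesis by (simp add: legendre_def Legendre_def cong_0_iff)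
qed

lemma legendre_zero: "int l dvd n \<Longrightarrow> legendre l n = 0"
  by (simp add: legendre_def Legendre_def cong_0_iff)

text \<open>Turns sums over squares into sums over residues with weight 1 + (n/l). Distinct roots of
  one residue add up to \<open>l\<close>, as their sum is a multiple of \<open>l\<close> below 2
  l.\<close>

lemma card_sqrt_mod:
  assumes l: "prime l" "l > 2" and n: "n < l"
  shows "of_nat (card {r \<in> {..<l}. r ^ 2 mod l = n}) = 1 + legendre l (int n)"
proof -
  have eq: "r ^ 2 mod l = n \<longleftrightarrow> [int r ^ 2 = int n] (mod int l)" for r
  proof -
    have "[int r ^ 2 = int n] (mod int l) \<longleftrightarrow> [r ^ 2 = n] (mod l)"
      by (metis cong_int_iff of_nat_power)
    thus ?thesis using n by (simp add: cong_def)
  qed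
  have roots: "r = s \<or> r = l - s" if "r < l" "s < l" "[int r ^ 2 = int s ^ 2] (mod int l)" for r s
  proof -
    have "int l dvd (int r - int s) * (int r + int s)"
      using that(3) by (simp add: cong_iff_dvd_diff power2_eq_square algebra_simps)
    hence "int l dvd int r - int s \<or> int l dvd int (r + s)"
      using l by (simp add: prime_dvd_mult_iff)
    moreover have "r = s" if "int l dvd int r - int s"
    proof -
      have "[int r = int s] (mod int l)" using that by (simp add: cong_iff_dvd_diff)
      thus ?thesis using \<open>r < l\<close> \<open>s < l\<close> by (simp add: cong_def)
    qed
    moreover have "r = s \<or> r = l - s" if "int l dvd int (r + s)"
    proof -
      have "l dvd r + s" using that by (simp only: int_dvd_int_iff)
      then obtain k where k: "r + s = l * k" by (elim dvdE)
      have "l * k < l * 2" unfolding k[symmetric] using \<open>r < l\<close> \<open>s < l\<close> by simp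
      hence "k < 2" by simp
      hence "k = 0 \<or> k = 1" by auto
      thus ?thesis using k by auto
    qed
    ultimately show ?thesis by blast
  qed
  consider "n = 0" | "n \<noteq> 0" "QuadRes (int l) (int n)" | "n \<noteq> 0" "\<not> QuadRes (int l) (int n)" by blast
  thus ?thesis
  proof cases
    case 1
    have "{r \<in> {..<l}. r ^ 2 mod l = n} = {0}"
      using 1 l by (auto simp: dvd_eq_mod_eq_0[symmetric] prime_dvd_power_iff dest: dvd_imp_le)
    thus ?thesis using 1 by (simp add: legendre_zero)
  next
    case 2
    then obtain y where y: "[y ^ 2 = int n] (mod int l)" by (auto simp: QuadRes_def)
    define s where "s = nat (y mod int l)"
    have s: "int s = y mod int l" "s < l" using l by (auto simp: s_def nat_less_iff)
    have "[int s = y] (mod int l)" using s by simp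
    hence sy: "[int s ^ 2 = int n] (mod int l)" using y cong_pow cong_trans by blast
    have "s \<noteq> 0"
    proof
      assume "s = 0"
      hence "int l dvd int n" using sy by (simp add: cong_def mod_eq_0_iff_dvd)
      thus False using 2 n by (simp add: nat_dvd_not_less)
    qed
    have ls: "[int (l - s) ^ 2 = int n] (mod int l)"
    proof -
      have "[int (l - s) = - int s] (mod int l)" using s by (simp add: cong_iff_dvd_diff of_nat_diff)
      hence "[int (l - s) ^ 2 = (- int s) ^ 2] (mod int l)" by (rule cong_pow)
      thus ?thesis using sy cong_trans by fastforce
    qed
    have "{r \<in> {..<l}. r ^ 2 mod l = n} = {s, l - s}"
    proof (intro equalityI subsetI)
      fix r assume "r \<in> {r \<in> {..<l}. r ^ 2 mod l = n}"
      hence r: "r < l" "[int r ^ 2 = int n] (mod int l)" using eq by auto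
      hence "[int r ^ 2 = int s ^ 2] (mod int l)" using sy cong_sym cong_trans by blast
      from roots[OF r(1) s(2) this] show "r \<in> {s, l - s}" by simp
    next
      fix r assume "r \<in> {s, l - s}"
      thus "r \<in> {r \<in> {..<l}. r ^ 2 mod l = n}" using s(2) \<open>s \<noteq> 0\<close> sy ls unfolding eq by auto
    qed
    moreover have "s \<noteq> l - s"
    proof
      assume "s = l - s"
      hence "l = 2 * s" using s by simp
      thus False using l prime_odd_nat[of l] by auto
    qed
    moreover have "\<not> int l dvd int n" using 2 n by (simp add: nat_dvd_not_less)
    ultimately show ?thesis using 2 by (simp add: legendre_def Legendre_def cong_0_iff)
  next
    case 3
    have "{r \<in> {..<l}. r ^ 2 mod l = n} = {}" using 3 eq by (auto simp: QuadRes_def)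
    moreover have "\<not> int l dvd int n" using 3 n by (simp add: nat_dvd_not_less)
    ultimately show ?thesis using 3 by (simp add: legendre_def Legendre_def cong_0_iff)
  qed
qed

text \<open>Grouping by the value of the square gives the weight 1 + (n/l); its summand 1
  contributes a complete sum of a nontrivial character, hence 0.\<close>

lemma gauss_sum_eq_legendre_sum:
  assumes l: "prime l" "l > 2" and b: "\<not> int l dvd b"
  shows "gauss_sum b l = (\<Sum>n<l. legendre l (int n) * root_char l (b * int n))"
proof -
  have l0: "l > 0" using l by simp
  have "gauss_sum b l = (\<Sum>r<l. root_char l (b * int (r ^ 2 mod l)))"
    unfolding gauss_sum_def
  proof (intro sum.cong refl root_char_cong[OF l0] cong_mult cong_refl)
    fix r
    show "[int r ^ 2 = int (r ^ 2 mod l)] (mod int l)" by (simp add: cong_def zmod_int)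
  qed
  also have "\<dots> = (\<Sum>n<l. \<Sum>r\<in>{r\<in>{..<l}. r ^ 2 mod l = n}. root_char l (b * int (r ^ 2 mod l)))"
    by (rule sum.group[symmetric]) (use l0 in auto)
  also have "\<dots> = (\<Sum>n<l. (1 + legendre l (int n)) * root_char l (b * int n))"
  proof (intro sum.cong refl)
    fix n assume n: "n \<in> {..<l}"
    have "(\<Sum>r\<in>{r\<in>{..<l}. r ^ 2 mod l = n}. root_char l (b * int (r ^ 2 mod l))) = (\<Sum>r\<in>{r\<in>{..<l}. r ^ 2 mod l = n}. root_char l (b * int n))"
      by (intro sum.cong) auto
    thus "(\<Sum>r\<in>{r\<in>{..<l}. r ^ 2 mod l = n}. root_char l (b * int (r ^ 2 mod l))) = (1 + legendre l (int n)) * root_char l (b * int n)"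
      using card_sqrt_mod[OF l, of n] n by (simp del: of_nat_power)
  qed
  also have "\<dots> = (\<Sum>n<l. root_char l (b * int n)) + (\<Sum>n<l. legendre l (int n) * root_char l (b * int n))"
    by (simp add: ring_distribs sum.distrib)
  also have "(\<Sum>n<l. root_char l (b * int n)) = 0" using root_char_sum[OF l0, of b] b by simp
  finally show ?thesis by simp
qed

text \<open>For \<open>b\<close> prime to \<open>l\<close> substitute b n for n. If \<open>l\<close>
  divides \<open>b\<close>, both sides vanish because the Legendre symbols sum to 0.\<close>

lemma legendre_sum:
  assumes l: "prime l" "l > 2"
  shows "(\<Sum>n<l. legendre l (int n) * root_char l (b * int n)) = legendre l b * gauss_sum 1 l"
proof (cases "int l dvd b")
  case True
  have l0: "l > 0" using l by simp
  have one: "\<not> int l dvd 1" using l by auto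
  have "root_char l (b * int n) = 1" for n
  proof -
    have "root_char l (b * int n) = root_char l 0" by (rule root_char_cong[OF l0]) (use True in \<open>simp add: cong_0_iff\<close>)
    thus ?thesis by simp
  qed
  moreover have "(\<Sum>n<l. legendre l (int n)) = 0"
  proof -
    \<comment> \<open>The numbers of square roots, 1 + (n/l), add up to \<open>l\<close>.\<close>
    have "(\<Sum>n<l. \<Sum>r\<in>{r\<in>{..<l}. r ^ 2 mod l = n}. 1) = (\<Sum>r<l. 1 :: complex)"
      by (rule sum.group) (use l0 in auto)
    also have "(\<Sum>n<l. \<Sum>r\<in>{r\<in>{..<l}. r ^ 2 mod l = n}. 1) = (\<Sum>n<l. 1 + legendre l (int n))"
      using card_sqrt_mod[OF l] by (intro sum.cong) auto
    finally show ?thesis by (simp add: sum.distrib)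
  qed
  ultimately show ?thesis using True by (simp add: legendre_zero)
next
  case False
  have l0: "l > 0" using l by simp
  have one: "\<not> int l dvd 1" using l by auto
  have cop: "coprime b (int l)" using prime_imp_coprime[of "int l" b] False l by (simp add: coprime_commute)
  have "(\<Sum>n<l. legendre l (b * int n + 0) * root_char l (1 * (b * int n + 0))) = gauss_sum 1 l"
    unfolding gauss_sum_eq_legendre_sum[OF l one]
    by (rule sum_residue_affine[where h = "\<lambda>n. legendre l n * root_char l (1 * n)"])
       (use l0 cop in \<open>auto intro!: arg_cong2[of _ _ _ _ "(*)"] legendre_cong root_char_cong\<close>)
  hence "gauss_sum 1 l = legendre l b * (\<Sum>n<l. legendre l (int n) * root_char l (b * int n))"
    by (simp add: legendre_mult[OF l] sum_distrib_left mult_ac)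
  thus ?thesis using legendre_square[OF False] by (simp add: mult.assoc[symmetric])
qed

lemma gauss_sum_prime:
  assumes l: "prime l" "l > 2" and b: "\<not> int l dvd b"
  shows "gauss_sum b l = legendre l b * gauss_sum 1 l"
  using gauss_sum_eq_legendre_sum[OF assms] legendre_sum[OF l, of b] by simp

text \<open>Replacing r by r + l s multiplies the term by a character modulo \<open>l\<close> in s
  of frequency 2 b r. Averaging over s keeps only the r divisible by \<open>l\<close>: there are
  \<open>l\<close> of them, each contributing 1.\<close>

lemma gauss_sum_prime_square:
  assumes l: "prime l" "l > 2" and b: "\<not> int l dvd b"
  shows "gauss_sum b (l ^ 2) = of_nat l"
proof -
  have l0: "l > 0" "l ^ 2 > 0" using l by simp_all
  define h where "h n = root_char (l ^ 2) (b * n ^ 2)" for n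
  have shift: "(\<Sum>r<l ^ 2. h (1 * int r + int l * int s)) = gauss_sum b (l ^ 2)" for s
    unfolding gauss_sum_def h_def
    by (rule sum_residue_affine[where h = "\<lambda>n. root_char (l ^ 2) (b * n ^ 2)"])
       (use l0 in \<open>auto intro!: root_char_cong cong_mult cong_pow\<close>)
  have split: "h (1 * int r + int l * int s) = h (int r) * root_char l ((2 * b * int r) * int s)" for r s
  proof -
    have "b * (1 * int r + int l * int s) ^ 2 - (b * int r ^ 2 + int l * (2 * b * int r * int s)) = int (l ^ 2) * (b * int s ^ 2)"
      by (simp add: power2_eq_square algebra_simps)
    hence "[b * (1 * int r + int l * int s) ^ 2 = b * int r ^ 2 + int l * (2 * b * int r * int s)] (mod int (l ^ 2))"
      unfolding cong_iff_dvd_diff by simp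
    hence "h (1 * int r + int l * int s) = root_char (l ^ 2) (b * int r ^ 2 + int l * (2 * b * int r * int s))"
      unfolding h_def by (rule root_char_cong[OF l0(2)])
    also have "\<dots> = h (int r) * root_char (l ^ 2) (int l * (2 * b * int r * int s))" by (simp add: root_char_add h_def)
    also have "root_char (l ^ 2) (int l * (2 * b * int r * int s)) = root_char l ((2 * b * int r) * int s)"
      using l0 by (simp add: root_char_def power2_eq_square)
    finally show ?thesis .
  qed
  have dvd: "int l dvd 2 * b * int r \<longleftrightarrow> l dvd r" for r
  proof -
    have "\<not> int l dvd 2" using l zdvd_imp_le[of "int l" 2] by auto
    thus ?thesis using l b by (simp add: prime_dvd_mult_iff)
  qed
  have "of_nat l * gauss_sum b (l ^ 2) = (\<Sum>s<l. \<Sum>r<l ^ 2. h (1 * int r + int l * int s))"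
    unfolding shift by simp
  also have "\<dots> = (\<Sum>r<l ^ 2. \<Sum>s<l. h (int r) * root_char l ((2 * b * int r) * int s))"
    unfolding split by (rule sum.swap)
  also have "\<dots> = (\<Sum>r<l ^ 2. h (int r) * (if l dvd r then of_nat l else 0))"
    by (simp only: sum_distrib_left[symmetric] root_char_sum[OF l0(1)] dvd)
  also have "\<dots> = (\<Sum>r\<in>(\<lambda>k. l * k) ` {..<l}. h (int r) * (if l dvd r then of_nat l else 0))"
  proof (rule sum.mono_neutral_right)
    show "\<forall>r\<in>{..<l ^ 2} - (\<lambda>k. l * k) ` {..<l}. h (int r) * (if l dvd r then of_nat l else 0) = 0"
    proof
      fix r assume r: "r \<in> {..<l ^ 2} - (\<lambda>k. l * k) ` {..<l}"
      have "\<not> l dvd r"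
      proof
        assume "l dvd r"
        then obtain k where "r = l * k" by (elim dvdE)
        thus False using r by (auto simp: power2_eq_square)
      qed
      thus "h (int r) * (if l dvd r then of_nat l else 0) = 0" by simp
    qed
  qed (use l0 in \<open>auto simp: power2_eq_square\<close>)
  also have "\<dots> = (\<Sum>k<l. h (int (l * k)) * of_nat l)"
    by (subst sum.reindex) (use l0 in \<open>auto simp: inj_on_def\<close>)
  also have "\<dots> = (\<Sum>k<l. of_nat l)"
  proof (intro sum.cong refl)
    fix k
    have "h (int (l * k)) = root_char (l ^ 2) 0" unfolding h_def
      by (rule root_char_cong[OF l0(2)]) (simp add: cong_0_iff power_mult_distrib)
    thus "h (int (l * k)) * of_nat l = of_nat l" by simp
  qed
  finally show ?thesis using l0 by simp
qed

lemma prime_gt_3_mod_12: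
  fixes l :: nat
  assumes l: "prime l" "l > 3"
  shows "l mod 12 \<in> {1, 5, 7, 11}"
proof -
  have "odd l" using l prime_odd_nat by auto
  moreover have "\<not> 3 dvd l" using l primes_dvd_imp_eq[of 3 l] by auto
  ultimately show ?thesis by simp presburger
qed

text \<open>Quadratic reciprocity for 3 and \<open>l\<close>, checked in the four classes modulo 12.
  It links the sign in the transformation of eta to the Legendre symbols of the Hecke
  operator.\<close>

lemma chi12_prime:
  assumes l: "prime l" "l > 3"
  shows "chi12 (int l) = legendre l 3"
proof -
  have qr: "Legendre 3 (int l) * Legendre (int l) 3 = (-1) ^ ((3 - 1) div 2 * ((l - 1) div 2))"
    using Quadratic_Reciprocity[of 3 l] l by simp
  have red: "Legendre (int l) 3 = Legendre (int l mod 3) 3"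
    by (simp add: Legendre_def QuadRes_def cong_def)
  have L1: "Legendre 1 3 = 1" unfolding Legendre_def QuadRes_def by (auto simp: cong_def intro: exI[of _ 1])
  have "\<not> QuadRes 3 2"
  proof
    assume "QuadRes 3 2"
    then obtain y :: int where "y ^ 2 mod 3 = 2" by (auto simp: QuadRes_def cong_def)
    moreover have "y ^ 2 mod 3 = (y mod 3) ^ 2 mod 3" by (simp add: power_mod)
    moreover have "y mod 3 = 0 \<or> y mod 3 = 1 \<or> y mod 3 = 2" by presburger
    ultimately show False by auto
  qed
  hence L2: "Legendre 2 3 = -1" by (simp add: Legendre_def cong_def)
  define k where "k = l div 12"
  have lk: "l = 12 * k + l mod 12" by (simp add: k_def)
  consider "l = 12 * k + 1" | "l = 12 * k + 5" | "l = 12 * k + 7" | "l = 12 * k + 11"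
    using prime_gt_3_mod_12[OF l] lk by auto
  thus ?thesis
  proof cases
    case 1
    hence "int l mod 3 = 1" "int l mod 12 = 1" "(l - 1) div 2 = 2 * (3 * k)" by presburger+
    thus ?thesis using qr by (simp add: red L1 legendre_def chi12_def)
  next
    case 2
    hence *: "int l mod 3 = 2" "int l mod 12 = 5" "(l - 1) div 2 = 2 * (3 * k + 1)" by presburger+
    hence "Legendre 3 (int l) = -1" using qr by (simp add: red L2)
    thus ?thesis using * by (simp add: legendre_def chi12_def)
  next
    case 3
    hence *: "int l mod 3 = 1" "int l mod 12 = 7" "(l - 1) div 2 = Suc (2 * (3 * k + 1))" by presburger+
    hence "Legendre 3 (int l) = -1" using qr by (simp add: red L1)
    thus ?thesis using * by (simp add: legendre_def chi12_def)
  next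
    case 4
    hence *: "int l mod 3 = 2" "int l mod 12 = 11" "(l - 1) div 2 = Suc (2 * (3 * k + 2))" by presburger+
    hence "Legendre 3 (int l) = 1" using qr by (simp add: red L2)
    thus ?thesis using * by (simp add: legendre_def chi12_def)
  qed
qed

section \<open>The Hecke sum\<close>

definition F_eta :: "complex \<Rightarrow> complex" where
  "F_eta \<tau> = eta (2 * \<tau>) ^ 3 / eta \<tau> ^ 2"

definition G_eta :: "complex \<Rightarrow> complex" where
  "G_eta \<tau> = eta (\<tau> / 2) ^ 3 / eta \<tau> ^ 2"

text \<open>Factor of automorphy between \<open>F_eta \<tau>\<close> and
  \<open>G_eta (- 1 / \<tau>)\<close>. Its weight 3/2 - 1 = 1/2 makes it scale like
  \<open>eta_factor\<close>.\<close>

definition F_factor :: "complex \<Rightarrow> complex" where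
  "F_factor \<tau> = eta_factor (2 * \<tau>) ^ 3 / eta_factor \<tau> ^ 2"

lemma F_eta_nonzero: "Im \<tau> > 0 \<Longrightarrow> F_eta \<tau> \<noteq> 0"
  by (simp add: F_eta_def eta_nonzero)

lemma F_factor_nonzero: "Im \<tau> > 0 \<Longrightarrow> F_factor \<tau> \<noteq> 0"
  by (simp add: F_factor_def eta_factor_nonzero)

lemma F_factor_scale:
  assumes \<tau>: "Im \<tau> > 0" and M: "M > 0"
  shows "F_factor \<tau> = of_nat M * F_factor (of_nat M ^ 2 * \<tau>)"
proof -
  have 1: "eta_factor (2 * \<tau>) = of_nat M * eta_factor (2 * (of_nat M ^ 2 * \<tau>))"
    using eta_factor_scale[of "2 * \<tau>" M] assms by (simp add: mult_ac)
  have 2: "eta_factor \<tau> = of_nat M * eta_factor (of_nat M ^ 2 * \<tau>)" by (rule eta_factor_scale[OF assms])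
  show ?thesis unfolding F_factor_def 1 2 using M by (simp add: power_mult_distrib eval_nat_numeral)
qed

text \<open>\<open>eta_transform\<close> is used at 2 \<tau> with the pair (2 b, B) and at \<tau>
  with (b, 2 B). Since 1152 = 2 * 576, both satisfy its congruence, and the resulting points are
  \<tau>'/2 and \<tau>', the two arguments in \<open>G_eta \<tau>'\<close>.\<close>

lemma F_eta_transform:
  assumes \<tau>: "Im \<tau> > 0" and c: "c > 0" "coprime (int c) 12" and B: "[1152 * b * B = 1] (mod int c)"
  shows "F_eta (24 * of_int b / of_nat c + \<tau>) =
           F_factor \<tau> * chi12 (int c) * (gauss_sum (2 * b) c ^ 3 / gauss_sum b c ^ 2 / of_nat c) *
             G_eta (- 48 * of_int B / of_nat c - 1 / (of_nat c ^ 2 * \<tau>))"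
proof -
  define \<tau>' where "\<tau>' = - 48 * of_int B / of_nat c - 1 / (of_nat c ^ 2 * \<tau>)"
  have "eta (24 * of_int (2 * b) / of_nat c + 2 * \<tau>) =
           eta_factor (2 * \<tau>) * chi12 (int c) * (gauss_sum (2 * b) c / of_nat c) * eta (- 24 * of_int B / of_nat c - 1 / (of_nat c ^ 2 * (2 * \<tau>)))"
    by (rule eta_transform) (use assms in \<open>auto simp: mult_ac\<close>)
  moreover have "24 * of_int (2 * b) / of_nat c + 2 * \<tau> = 2 * (24 * of_int b / of_nat c + \<tau>)" by (simp add: algebra_simps)
  moreover have "- 24 * of_int B / of_nat c - 1 / (of_nat c ^ 2 * (2 * \<tau>)) = \<tau>' / 2"
    unfolding \<tau>'_def by (simp add: diff_divide_distrib mult_ac)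
  ultimately have 1: "eta (2 * (24 * of_int b / of_nat c + \<tau>)) = eta_factor (2 * \<tau>) * chi12 (int c) * (gauss_sum (2 * b) c / of_nat c) * eta (\<tau>' / 2)"
    by (simp only:)
  have "eta (24 * of_int b / of_nat c + \<tau>) =
           eta_factor \<tau> * chi12 (int c) * (gauss_sum b c / of_nat c) * eta (- 24 * of_int (2 * B) / of_nat c - 1 / (of_nat c ^ 2 * \<tau>))"
    by (rule eta_transform) (use assms in \<open>auto simp: mult_ac\<close>)
  moreover have "- 24 * of_int (2 * B) / of_nat c - 1 / (of_nat c ^ 2 * \<tau>) = \<tau>'" unfolding \<tau>'_def by simp
  ultimately have 2: "eta (24 * of_int b / of_nat c + \<tau>) = eta_factor \<tau> * chi12 (int c) * (gauss_sum b c / of_nat c) * eta \<tau>'" by simp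
  have chi: "chi12 (int c) ^ 3 / chi12 (int c) ^ 2 = chi12 (int c)" by (simp add: chi12_def)
  have cc: "of_nat c ^ 2 / of_nat c ^ 3 = (1 / of_nat c :: complex)" using c by (simp add: eval_nat_numeral)
  have "F_eta (24 * of_int b / of_nat c + \<tau>) = F_factor \<tau> * (chi12 (int c) ^ 3 / chi12 (int c) ^ 2) * (gauss_sum (2 * b) c ^ 3 / gauss_sum b c ^ 2 * (of_nat c ^ 2 / of_nat c ^ 3)) * G_eta \<tau>'"
    unfolding F_eta_def 1 2 F_factor_def G_eta_def by (simp add: power_mult_distrib power_divide mult_ac)
  thus ?thesis unfolding chi cc \<tau>'_def by simp
qed

lemma F_eta_inversion:
  assumes "Im \<tau> > 0"
  shows "F_eta \<tau> = F_factor \<tau> * G_eta (- 1 / \<tau>)"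
  using F_eta_transform[OF assms, of 1 0 0] by (simp add: chi12_def gauss_sum_def cong_def)

lemma F_eta_eq:
  assumes "Im \<tau> > 0"
  shows "F_eta \<tau> = nome (\<tau> / 6) * A_gen (nome \<tau>)"
proof -
  have "nome (\<tau> / 6) * nome (\<tau> / 24) ^ 2 = nome (2 * \<tau> / 24) ^ 3"
    unfolding nome_power nome_add[symmetric] by (rule arg_cong[of _ _ nome]) simp
  hence *: "nome (2 * \<tau> / 24) ^ 3 / nome (\<tau> / 24) ^ 2 = nome (\<tau> / 6)" by (simp add: divide_eq_eq)
  have "nome (2 * \<tau>) = nome \<tau> ^ 2" by (simp add: nome_power)
  hence "F_eta \<tau> = (nome (2 * \<tau> / 24) ^ 3 / nome (\<tau> / 24) ^ 2) * (euler_prod (nome \<tau> ^ 2) ^ 3 / euler_prod (nome \<tau>) ^ 2)"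
    unfolding F_eta_def eta_eq by (simp add: power_mult_distrib)
  thus ?thesis unfolding * using assms by (simp add: A_gen_eq norm_nome_less_1_iff)
qed

lemma eta_compose_holomorphic:
  assumes "h holomorphic_on S" "\<And>z. z \<in> S \<Longrightarrow> Im (h z) > 0"
  shows "(\<lambda>z. eta (h z)) holomorphic_on S"
proof -
  have "(eta \<circ> h) holomorphic_on S"
    by (rule holomorphic_on_compose_gen[OF assms(1) eta_holomorphic]) (use assms(2) in \<open>auto simp: upper_half_plane_def\<close>)
  thus ?thesis by (simp add: o_def)
qed

lemma F_eta_compose_holomorphic:
  assumes h: "h holomorphic_on S" "\<And>z. z \<in> S \<Longrightarrow> Im (h z) > 0"
  shows "(\<lambda>z. F_eta (h z)) holomorphic_on S"
  unfolding F_eta_def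
  by (intro holomorphic_on_divide holomorphic_on_power eta_compose_holomorphic holomorphic_on_mult holomorphic_on_const h)
     (use h(2) in \<open>auto simp: eta_nonzero\<close>)

section \<open>Coefficients of A and the Hecke sum as a sum of translates\<close>

definition A_coeff :: "nat \<Rightarrow> complex" where
  "A_coeff n = fps_nth (fps_expansion A_gen 0) n"

lemma alpha_of_nat: "alpha (of_nat n) = A_coeff n"
  by (simp add: alpha_def A_coeff_def)

lemma A_gen_has_sum:
  assumes "norm q < 1"
  shows "((\<lambda>n. A_coeff n * q ^ n) has_sum A_gen q) UNIV"
proof -
  have exp: "A_gen has_fps_expansion fps_expansion A_gen 0"
    by (rule has_fps_expansion_fps_expansion[of "ball 0 1"]) (auto simp: A_gen_holomorphic)
  have sums: "(\<lambda>n. A_coeff n * z ^ n) sums A_gen z" if "norm z < 1" for z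
    unfolding A_coeff_def
    by (rule has_fps_expansion_imp_sums_complex[OF exp, of 1]) (use that A_gen_holomorphic in \<open>auto simp: one_ereal_def\<close>)
  define r where "r = (1 + norm q) / 2"
  have r: "norm q < r" "r < 1" "0 \<le> r" using assms norm_ge_zero[of q] by (auto simp: r_def simp del: norm_ge_zero)
  have "summable (\<lambda>n. norm (A_coeff n * q ^ n))"
    by (rule powser_insidea[of _ "of_real r"]) (use r sums[of "of_real r"] in \<open>auto simp: sums_iff\<close>)
  thus ?thesis by (rule norm_summable_imp_has_sum) (use sums assms in auto)
qed

abbreviation F_power :: "complex \<Rightarrow> nat \<Rightarrow> complex" where
  "F_power \<tau> n \<equiv> nome (of_nat (6 * n + 1) * \<tau> / 6)"

lemma F_eta_has_sum:
  assumes "Im \<tau> > 0"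
  shows "((\<lambda>n. A_coeff n * F_power \<tau> n) has_sum F_eta \<tau>) UNIV"
proof -
  have "((\<lambda>n. nome (\<tau> / 6) * (A_coeff n * nome \<tau> ^ n)) has_sum F_eta \<tau>) UNIV"
    unfolding F_eta_eq[OF assms] by (intro has_sum_cmult_right A_gen_has_sum) (use assms in \<open>simp add: norm_nome_less_1_iff\<close>)
  moreover have "nome (\<tau> / 6) * (A_coeff n * nome \<tau> ^ n) = A_coeff n * F_power \<tau> n" for n
  proof -
    have "of_nat (6 * n + 1) * \<tau> / 6 = \<tau> / 6 + of_nat n * \<tau>" by (simp add: field_simps)
    thus ?thesis by (simp only: nome_power nome_add) (simp add: mult_ac)
  qed
  ultimately show ?thesis by simp
qed

text \<open>Inversion sends the translate by \<open>b\<close> to one by an inverse of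
  \<open>u * b\<close>. Having this as a permutation of the units allows sums over \<open>b\<close>
  to be reindexed.\<close>

lemma inverse_units_bij:
  fixes c :: nat and u :: int
  assumes c: "c > 0" and u: "coprime u (int c)"
  defines "U \<equiv> {b \<in> {..<c}. coprime (int b) (int c)}"
  obtains \<beta> where "bij_betw \<beta> U U" "\<And>b. b \<in> U \<Longrightarrow> [u * int b * int (\<beta> b) = 1] (mod int c)"
proof -
  have "\<exists>x. x \<in> U \<and> [u * int b * int x = 1] (mod int c)" if "b \<in> U" for b
  proof -
    have "coprime (u * int b) (int c)" using u that by (simp add: U_def)
    then obtain y where y: "[u * int b * y = 1] (mod int c)" using cong_solve_coprime_int by blast
    define x where "x = nat (y mod int c)"
    have x: "int x = y mod int c" "x < c" using c by (auto simp: x_def nat_less_iff)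
    have xy: "[int x = y] (mod int c)" using x by simp
    have 1: "[u * int b * int x = 1] (mod int c)"
      using cong_trans[OF cong_mult[OF cong_refl xy] y] .
    hence "[int x * (u * int b) = 1] (mod int c)" by (simp add: mult_ac)
    hence "coprime (int x) (int c)" using coprime_iff_invertible_int by blast
    thus ?thesis using 1 x(2) by (auto simp: U_def)
  qed
  then obtain \<beta> where \<beta>: "\<And>b. b \<in> U \<Longrightarrow> \<beta> b \<in> U" "\<And>b. b \<in> U \<Longrightarrow> [u * int b * int (\<beta> b) = 1] (mod int c)" by metis
  have "inj_on \<beta> U"
  proof (rule inj_onI)
    fix x y assume xy: "x \<in> U" "y \<in> U" "\<beta> x = \<beta> y"
    have "[u * int x * int (\<beta> x) = u * int y * int (\<beta> x)] (mod int c)"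
      using \<beta>(2)[OF xy(1)] \<beta>(2)[OF xy(2)] xy(3) cong_sym cong_trans by metis
    moreover have "coprime (int (\<beta> x)) (int c)" using \<beta>(1)[OF xy(1)] by (simp add: U_def)
    ultimately have "[u * int x = u * int y] (mod int c)" by (simp add: cong_mult_rcancel)
    hence "[int x = int y] (mod int c)" using u by (simp add: cong_mult_lcancel)
    thus "x = y" using xy by (simp add: U_def cong_def)
  qed
  moreover have "\<beta> ` U \<subseteq> U" using \<beta>(1) by auto
  moreover have "finite U" by (simp add: U_def)
  ultimately have "bij_betw \<beta> U U" using endo_inj_surj[of U \<beta>] by (auto simp: bij_betw_def)
  thus ?thesis using that \<beta>(2) by blast
qed

locale hecke_prime =
  fixes l :: nat
  assumes prime_l: "prime l" and l_gt_3: "l > 3"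
begin

lemma l_gt_2: "l > 2" and l_pos: "l > 0"
  using l_gt_3 by auto

lemma coprime_l_12: "coprime (int l) 12"
proof -
  have "\<not> int l dvd 2" "\<not> int l dvd 3"
    using l_gt_3 zdvd_imp_le[of "int l" 2] zdvd_imp_le[of "int l" 3] by auto
  hence "coprime (int l) 2" "coprime (int l) 3"
    using prime_imp_coprime[of "int l" 2] prime_imp_coprime[of "int l" 3] prime_l by simp_all
  hence "coprime (int l) (2 * 2 * 3)" by (simp only: coprime_mult_right_iff)
  thus ?thesis by simp
qed

lemma coprime_12_power: "coprime (int l) (2 ^ i * 3 ^ j)"
proof -
  have "coprime (int l) (2 * 2 * 3)" using coprime_l_12 by simp
  hence "coprime (int l) 2" "coprime (int l) 3" by (simp_all only: coprime_mult_right_iff)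
  thus ?thesis by simp
qed

text \<open>This will be the order of the pole at the cusp 0.\<close>

definition M :: nat where "M = (l ^ 2 - 1) div 24"

lemma l_square: "l ^ 2 = 24 * M + 1"
proof -
  define k r where "k = l div 12" and "r = l mod 12"
  have lk: "l = 12 * k + r" by (simp add: k_def r_def)
  have "r = 1 \<or> r = 5 \<or> r = 7 \<or> r = 11" using prime_gt_3_mod_12[OF prime_l l_gt_3] by (simp add: r_def)
  hence "\<exists>m. r ^ 2 = 24 * m + 1"
    by (elim disjE) (auto intro: exI[of _ 0] exI[of _ 1] exI[of _ 2] exI[of _ 5])
  then obtain m where m: "r ^ 2 = 24 * m + 1" by blast
  have "l ^ 2 = 24 * (6 * k ^ 2 + k * r + m) + 1"
    unfolding lk using m by (simp add: power2_eq_square algebra_simps)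
  thus ?thesis by (simp add: M_def)
qed

lemma M_pos: "M > 0"
proof (rule ccontr)
  assume "\<not> M > 0"
  hence "l ^ 2 = 1" using l_square by simp
  thus False using l_gt_3 by simp
qed

lemma N_ell_eq: "N_ell l = int (4 * M)"
proof -
  have "int (l ^ 2) = int (24 * M + 1)" using l_square by (rule arg_cong)
  hence "int l ^ 2 - 1 = 6 * (4 * int M)" by simp
  thus ?thesis unfolding N_ell_def by simp
qed

text \<open>The origin of N_l = 4 M: the exponents of \<open>F_eta\<close> are (6 n + 1)/6, and n ->
  l^2 n + 4 M multiplies 6 n + 1 by l^2.\<close>

lemma index_eq: "6 * (l ^ 2 * k + 4 * M) + 1 = l ^ 2 * (6 * k + 1)"
proof -
  have "6 * (l ^ 2 * k + 4 * M) + 1 = l ^ 2 * (6 * k) + (24 * M + 1)" by simp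
  also have "\<dots> = l ^ 2 * (6 * k + 1)" unfolding l_square[symmetric] by simp
  finally show ?thesis .
qed

lemma index_iff: "l ^ 2 dvd 6 * n + 1 \<longleftrightarrow> (\<exists>k. n = l ^ 2 * k + 4 * M)"
proof
  assume "l ^ 2 dvd 6 * n + 1"
  then obtain j where j: "6 * n + 1 = l ^ 2 * j" by (elim dvdE)
  \<comment> \<open>As \<open>l ^ 2\<close> is 1 modulo 6, the cofactor \<open>j\<close> of 6 n + 1
    is again 1 modulo 6.\<close>
  have "j mod 6 = (24 * M + 1) * j mod 6"
  proof -
    have "(24 * M + 1) * j = 6 * (4 * M * j) + j" by (simp add: algebra_simps)
    thus ?thesis by (simp only: mod_mult_self4)
  qed
  also have "\<dots> = (6 * n + 1) mod 6" unfolding j l_square ..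
  also have "\<dots> = 1" by simp
  finally have "j = 6 * (j div 6) + 1" by (metis mult_div_mod_eq)
  hence "6 * n + 1 = l ^ 2 * (6 * (j div 6) + 1)" using j by simp
  also have "\<dots> = 6 * (l ^ 2 * (j div 6) + 4 * M) + 1" by (rule index_eq[symmetric])
  finally have "n = l ^ 2 * (j div 6) + 4 * M" by simp
  thus "\<exists>k. n = l ^ 2 * k + 4 * M" by blast
next
  assume "\<exists>k. n = l ^ 2 * k + 4 * M"
  then obtain k where k: "n = l ^ 2 * k + 4 * M" by blast
  show "l ^ 2 dvd 6 * n + 1" unfolding k index_eq by (rule dvd_triv_left)
qed

definition g :: complex where "g = gauss_sum 1 l"

text \<open>If \<open>g\<close> were 0, \<open>eta_transform\<close> would make \<open>eta\<close>
  vanish at 24/l + i.\<close>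

lemma g_nonzero: "g \<noteq> 0"
proof
  assume "g = 0"
  have "coprime 576 (int l)" using coprime_12_power[of 6 2] by (simp add: coprime_commute)
  then obtain B where B: "[576 * 1 * B = 1] (mod int l)" using cong_solve_coprime_int by auto
  have "eta (24 * of_int 1 / of_nat l + \<i>) = 0"
    using eta_transform[of \<i> l 1 B, OF _ l_pos coprime_l_12 B] \<open>g = 0\<close> by (simp add: g_def)
  thus False using eta_nonzero[of "24 * of_int 1 / of_nat l + \<i>"] by simp
qed

abbreviation "leg \<equiv> legendre l"

abbreviation F_shift :: "complex \<Rightarrow> nat \<Rightarrow> complex" where
  "F_shift \<tau> b \<equiv> F_eta ((\<tau> + 24 * of_nat b) / of_nat (l^2))"

abbreviation F_twist :: "complex \<Rightarrow> nat \<Rightarrow> complex" where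
  "F_twist \<tau> b \<equiv> F_eta (24 * of_nat b / of_nat l + \<tau>)"

text \<open>q^(1/6) times the numerator of \<open>Z_tilde\<close>. A complete character sum modulo
  \<open>l ^ 2\<close> yields l^2, of which 1/l leaves \<open>l\<close>; 1/g cancels the Gauss sum
  produced by the twist, and \<open>leg 6\<close> is the sign from
  \<open>legendre_term\<close>.\<close>

definition Num :: "complex \<Rightarrow> complex" where
  "Num \<tau> = 1 / of_nat l * (\<Sum>b<l^2. F_shift \<tau> b)
     + leg 6 / g * (\<Sum>b<l. leg (int b) * F_twist \<tau> b)
     + F_eta (of_nat (l^2) * \<tau>)"

lemma l_square_dvd_iff: "int (l ^ 2) dvd 4 * int (6 * n + 1) \<longleftrightarrow> l ^ 2 dvd 6 * n + 1"
proof -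
  have "coprime (int (l ^ 2)) (4::int)" using coprime_12_power[of 2 0] by simp
  hence "int (l ^ 2) dvd 4 * int (6 * n + 1) \<longleftrightarrow> int (l ^ 2) dvd int (6 * n + 1)"
    by (rule coprime_dvd_mult_right_iff)
  thus ?thesis by (simp only: int_dvd_int_iff)
qed

lemma has_sum_index:
  assumes "(f has_sum S) UNIV" "\<And>n. (\<nexists>k. n = l ^ 2 * k + 4 * M) \<Longrightarrow> h n = 0"
      and "\<And>k. h (l ^ 2 * k + 4 * M) = (f k :: complex)"
  shows "(h has_sum S) UNIV"
proof -
  have "bij_betw (\<lambda>k. l ^ 2 * k + 4 * M) UNIV {n. \<exists>k. n = l ^ 2 * k + 4 * M}"
    using l_pos by (auto simp: bij_betw_def inj_on_def)
  from has_sum_reindex_bij_betw[OF this, of h S] assms(1,3)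
  have "(h has_sum S) {n. \<exists>k. n = l ^ 2 * k + 4 * M}" by simp
  also have "?this \<longleftrightarrow> (h has_sum S) UNIV" by (rule has_sum_cong_neutral) (use assms(2) in auto)
  finally show ?thesis .
qed

text \<open>Orthogonality of characters: the phase of the n-th term in the translate
  \<open>b\<close> is 4 (6 n + 1) b/l^2, so the translates cancel unless \<open>l ^ 2\<close>
  divides 6 n + 1, and \<open>index_iff\<close> describes these \<open>n\<close>.\<close>

lemma hecke_term_square:
  assumes \<tau>: "Im \<tau> > 0"
  shows "((\<lambda>n. of_nat l * A_coeff (l ^ 2 * n + 4 * M) * F_power \<tau> n) has_sum
           1 / of_nat l * (\<Sum>b<l^2. F_shift \<tau> b)) UNIV"
proof -
  define S where "S = 1 / of_nat l * (\<Sum>b<l^2. F_shift \<tau> b)"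
  define f where "f n = 1 / of_nat l * (\<Sum>b<l^2. A_coeff n * F_power ((\<tau> + 24 * of_nat b) / of_nat (l^2)) n)" for n
  have l2: "l ^ 2 > 0" using l_pos by simp
  have 1: "(f has_sum S) UNIV" unfolding f_def S_def
  proof (intro has_sum_cmult_right has_sum_sum F_eta_has_sum)
    fix b
    have "Im ((\<tau> + 24 * of_nat b) / of_nat (l^2)) = Im \<tau> / real (l ^ 2)" using Im_divide_of_nat[of "\<tau> + 24 * of_nat b" "l^2"] by simp
    thus "Im ((\<tau> + 24 * of_nat b) / of_nat (l^2)) > 0" using \<tau> l_pos by simp
  qed
  have f: "f n = (if l ^ 2 dvd 6 * n + 1 then of_nat l * (A_coeff n * nome (of_nat (6 * n + 1) * \<tau> / (6 * of_nat (l^2)))) else 0)" for n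
  proof -
    have "F_power ((\<tau> + 24 * of_nat b) / of_nat (l^2)) n = nome (of_nat (6 * n + 1) * \<tau> / (6 * of_nat (l^2))) * root_char (l ^ 2) (4 * int (6 * n + 1) * int b)" for b
    proof -
      have "of_nat (6 * n + 1) * ((\<tau> + 24 * of_nat b) / of_nat (l^2)) / 6 = of_nat (6 * n + 1) * \<tau> / (6 * of_nat (l^2)) + of_int (4 * int (6 * n + 1) * int b) / of_nat (l^2)"
        using l_pos by (simp add: field_simps del: of_nat_power of_nat_mult of_nat_add of_nat_Suc)
      thus ?thesis unfolding root_char_def by (simp only: nome_add)
    qed
    hence "f n = 1 / of_nat l * (A_coeff n * nome (of_nat (6 * n + 1) * \<tau> / (6 * of_nat (l^2)))) * (\<Sum>b<l^2. root_char (l ^ 2) (4 * int (6 * n + 1) * int b))"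
      unfolding f_def by (simp only: sum_distrib_left mult_ac)
    also have "(\<Sum>b<l^2. root_char (l ^ 2) (4 * int (6 * n + 1) * int b)) = (if l ^ 2 dvd 6 * n + 1 then of_nat (l ^ 2) else 0)"
      unfolding root_char_sum[OF l2] l_square_dvd_iff ..
    finally show ?thesis using l_pos by (simp add: power2_eq_square)
  qed
  have "bij_betw (\<lambda>k. l ^ 2 * k + 4 * M) UNIV {n. \<exists>k. n = l ^ 2 * k + 4 * M}"
    using l_pos by (auto simp: bij_betw_def inj_on_def)
  moreover have "(f has_sum S) {n. \<exists>k. n = l ^ 2 * k + 4 * M}"
  proof -
    have "f n = 0" if "\<nexists>k. n = l ^ 2 * k + 4 * M" for n
      unfolding f using that index_iff[of n] by (simp only: if_False)
    hence "(f has_sum S) UNIV \<longleftrightarrow> (f has_sum S) {n. \<exists>k. n = l ^ 2 * k + 4 * M}"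
      by (intro has_sum_cong_neutral) auto
    thus ?thesis using 1 by blast
  qed
  ultimately have "((\<lambda>k. f (l ^ 2 * k + 4 * M)) has_sum S) UNIV" by (rule has_sum_reindex_bij_betw[THEN iffD2])
  moreover have "f (l ^ 2 * k + 4 * M) = of_nat l * A_coeff (l ^ 2 * k + 4 * M) * F_power \<tau> k" for k
  proof -
    have *: "x * y * \<tau> / (6 * x) = y * \<tau> / 6" if "x \<noteq> 0" for x y using that by simp
    have e: "of_nat (l ^ 2 * (6 * k + 1)) * \<tau> / (6 * of_nat (l^2)) = of_nat (6 * k + 1) * \<tau> / 6"
      unfolding of_nat_mult[of "l ^ 2"] by (rule *) (use l_pos in simp)
    show ?thesis unfolding f index_eq e by (simp only: dvd_triv_left if_True mult.assoc)
  qed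
  ultimately show ?thesis unfolding S_def by simp
qed

text \<open>36 (n - 4 M) = 6 (6 n + 1) - 6 l^2, and 4 and 36 are squares prime to
  \<open>l\<close>.\<close>

lemma legendre_term:
  "leg (-1) * leg (N_ell l - int n) = leg 6 * leg (4 * int (6 * n + 1))"
proof -
  note mult = legendre_mult[OF prime_l l_gt_2, symmetric]
  have "\<not> int l dvd 6" "\<not> int l dvd 2"
  proof -
    have "\<not> int l dvd 2 ^ i * 3 ^ j" for i j
      using coprime_common_divisor[OF coprime_12_power[of i j], of "int l"] l_gt_3 by auto
    from this[of 1 1] this[of 1 0] show "\<not> int l dvd 6" "\<not> int l dvd 2" by simp_all
  qed
  hence leg36: "leg (6 * 6) = 1" and leg4: "leg (2 * 2) = 1"
    using prime_l legendre_square_arg[of l 6] legendre_square_arg[of l 2] by simp_all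
  have "leg 6 * leg (4 * int (6 * n + 1)) = leg (2 * 2) * leg (6 * int (6 * n + 1))" unfolding mult by (simp add: algebra_simps)
  also have "\<dots> = leg (6 * int (6 * n + 1))" using leg4 by simp
  also have "\<dots> = leg ((6 * 6) * (-1 * (N_ell l - int n)))"
  proof (rule legendre_cong)
    have l2: "6 * int (4 * M) + 1 = int l * int l" using l_square by (simp add: power2_eq_square flip: of_nat_mult)
    have "6 * int (6 * n + 1) - (6 * 6) * (-1 * (N_ell l - int n)) = 6 * (6 * int (4 * M) + 1)"
      unfolding N_ell_eq by (simp add: algebra_simps)
    also have "\<dots> = int l * (6 * int l)" unfolding l2 by simp
    finally show "[6 * int (6 * n + 1) = (6 * 6) * (-1 * (N_ell l - int n))] (mod int l)"
      unfolding cong_iff_dvd_diff by (metis dvd_triv_left)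
  qed
  also have "\<dots> = leg (6 * 6) * (leg (-1) * leg (N_ell l - int n))" unfolding mult ..
  finally show ?thesis using leg36 by simp
qed

text \<open>On the n-th term the sum over \<open>b\<close> is a twisted Gauss sum of frequency 4 (6
  n + 1), evaluated by \<open>legendre_sum\<close>.\<close>

lemma hecke_term_legendre:
  assumes \<tau>: "Im \<tau> > 0"
  shows "((\<lambda>n. leg (-1) * leg (N_ell l - int n) * A_coeff n * F_power \<tau> n) has_sum
           leg 6 / g * (\<Sum>b<l. leg (int b) * F_twist \<tau> b)) UNIV"
proof -
  have "((\<lambda>n. leg 6 / g * (\<Sum>b<l. leg (int b) * (A_coeff n * F_power (24 * of_nat b / of_nat l + \<tau>) n))) has_sum
           leg 6 / g * (\<Sum>b<l. leg (int b) * F_twist \<tau> b)) UNIV"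
    by (intro has_sum_cmult_right has_sum_sum F_eta_has_sum) (use \<tau> in simp)
  moreover have "leg 6 / g * (\<Sum>b<l. leg (int b) * (A_coeff n * F_power (24 * of_nat b / of_nat l + \<tau>) n)) =
     leg (-1) * leg (N_ell l - int n) * A_coeff n * F_power \<tau> n" for n
  proof -
    have "F_power (24 * of_nat b / of_nat l + \<tau>) n = F_power \<tau> n * root_char l (4 * int (6 * n + 1) * int b)" for b
    proof -
      have "of_nat (6 * n + 1) * (24 * of_nat b / of_nat l + \<tau>) / 6 = of_nat (6 * n + 1) * \<tau> / 6 + of_int (4 * int (6 * n + 1) * int b) / of_nat l"
        using l_pos by (simp add: field_simps)
      thus ?thesis unfolding root_char_def by (simp only: nome_add)
    qed
    hence "leg 6 / g * (\<Sum>b<l. leg (int b) * (A_coeff n * F_power (24 * of_nat b / of_nat l + \<tau>) n)) =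
      leg 6 / g * (A_coeff n * F_power \<tau> n) * (\<Sum>b<l. leg (int b) * root_char l (4 * int (6 * n + 1) * int b))"
      by (simp only: sum_distrib_left mult_ac)
    also have "(\<Sum>b<l. leg (int b) * root_char l (4 * int (6 * n + 1) * int b)) = leg (4 * int (6 * n + 1)) * g"
      unfolding g_def by (rule legendre_sum[OF prime_l l_gt_2])
    finally show ?thesis unfolding legendre_term using g_nonzero by simp
  qed
  ultimately show ?thesis by simp
qed

text \<open>F(l^2 \<tau>) has only the exponents with n = l^2 k + 4 M. For every other
  \<open>n\<close> the argument of \<open>alpha\<close> is not a natural number, and the default
  value 0 applies.\<close>

lemma hecke_term_inverse_square:
  assumes \<tau>: "Im \<tau> > 0"
  shows "((\<lambda>n. alpha ((of_nat n - of_int (N_ell l)) / of_nat (l ^ 2)) * F_power \<tau> n) has_sum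
           F_eta (of_nat (l^2) * \<tau>)) UNIV"
proof (rule has_sum_index[OF F_eta_has_sum])
  show "Im (of_nat (l^2) * \<tau>) > 0" using \<tau> l_pos by simp
next
  fix n assume n: "\<nexists>k. n = l ^ 2 * k + 4 * M"
  have "(of_nat n - of_int (N_ell l)) / of_nat (l ^ 2) \<notin> (\<nat> :: rat set)"
  proof
    assume "(of_nat n - of_int (N_ell l)) / of_nat (l ^ 2) \<in> (\<nat> :: rat set)"
    then obtain k where "(of_nat n - of_int (N_ell l)) / of_nat (l ^ 2) = (of_nat k :: rat)" by (elim Nats_cases)
    hence "(of_nat n :: rat) = of_nat (l ^ 2 * k + 4 * M)" using l_pos unfolding N_ell_eq by (simp add: field_simps)
    hence "n = l ^ 2 * k + 4 * M" using of_nat_eq_iff by blast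
    thus False using n by blast
  qed
  thus "alpha ((of_nat n - of_int (N_ell l)) / of_nat (l ^ 2)) * F_power \<tau> n = 0"
    by (simp add: alpha_def)
next
  fix k
  have "(of_nat (l ^ 2 * k + 4 * M) - of_int (N_ell l)) / of_nat (l ^ 2) = (of_nat k :: rat)"
    unfolding N_ell_eq using l_pos by simp
  thus "alpha ((of_nat (l ^ 2 * k + 4 * M) - of_int (N_ell l)) / of_nat (l ^ 2)) * F_power \<tau> (l ^ 2 * k + 4 * M) =
     A_coeff k * F_power (of_nat (l ^ 2) * \<tau>) k"
    unfolding index_eq by (simp only: alpha_of_nat) (simp add: algebra_simps)
qed

lemma Num_has_sum:
  assumes \<tau>: "Im \<tau> > 0"
  shows "((\<lambda>n. Z_coeff l n * nome \<tau> ^ n) has_sum Num \<tau> / nome (\<tau> / 6)) UNIV"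
proof -
  have "((\<lambda>n. (of_nat l * A_coeff (l ^ 2 * n + 4 * M) * F_power \<tau> n
      + leg (-1) * leg (N_ell l - int n) * A_coeff n * F_power \<tau> n
      + alpha ((of_nat n - of_int (N_ell l)) / of_nat (l ^ 2)) * F_power \<tau> n) * inverse (nome (\<tau> / 6)))
     has_sum Num \<tau> * inverse (nome (\<tau> / 6))) UNIV"
    unfolding Num_def by (intro has_sum_cmult_left has_sum_add hecke_term_square hecke_term_legendre hecke_term_inverse_square \<tau>)
  moreover have "(of_nat l * A_coeff (l ^ 2 * n + 4 * M) * F_power \<tau> n
      + leg (-1) * leg (N_ell l - int n) * A_coeff n * F_power \<tau> n
      + alpha ((of_nat n - of_int (N_ell l)) / of_nat (l ^ 2)) * F_power \<tau> n) * inverse (nome (\<tau> / 6)) = Z_coeff l n * nome \<tau> ^ n" for n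
  proof -
    have "of_nat (6 * n + 1) * \<tau> / 6 = of_nat n * \<tau> + \<tau> / 6" by (simp add: field_simps)
    hence 1: "F_power \<tau> n = nome \<tau> ^ n * nome (\<tau> / 6)" by (simp only: nome_add nome_power)
    have "of_nat (l ^ 2 * n) + of_int (N_ell l) = (of_nat (l ^ 2 * n + 4 * M) :: rat)" unfolding N_ell_eq by simp
    hence 2: "alpha (of_nat (l ^ 2 * n) + of_int (N_ell l)) = A_coeff (l ^ 2 * n + 4 * M)" by (simp only: alpha_of_nat)
    show ?thesis unfolding 1 Z_coeff_def 2 alpha_of_nat legendre_def by (simp add: field_simps)
  qed
  ultimately show ?thesis by (simp only: divide_inverse)
qed

lemma Z_tilde_eq:
  assumes \<tau>: "Im \<tau> > 0"
  shows "Z_tilde l \<tau> = Num \<tau> / F_eta \<tau>"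
proof -
  have "(\<Sum>n. Z_coeff l n * nome \<tau> ^ n) = Num \<tau> / nome (\<tau> / 6)"
    using has_sum_imp_sums[OF Num_has_sum[OF \<tau>]] by (simp add: sums_iff)
  thus ?thesis unfolding Z_tilde_def F_eta_eq[OF \<tau>] by simp
qed

lemma Num_holomorphic: "Num holomorphic_on upper_half_plane"
proof -
  have "Im ((\<tau> + 24 * of_nat b) / of_nat (l^2)) > 0" if "Im \<tau> > 0" for \<tau> b
    using that l_pos Im_divide_of_nat[of "\<tau> + 24 * of_nat b" "l^2"] by simp
  thus ?thesis unfolding Num_def[abs_def] using l_pos
    by (intro holomorphic_on_add holomorphic_on_mult holomorphic_on_sum holomorphic_on_const F_eta_compose_holomorphic)
       (auto intro!: holomorphic_intros simp: upper_half_plane_def)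
qed

end

section \<open>Even translations of G and its growth at i infinity\<close>

lemma Im_divide_nat_pos: "Im z > 0 \<Longrightarrow> n > 0 \<Longrightarrow> Im (z / of_nat n) > 0"
  using Im_divide_of_nat[of z n] by simp

lemma G_eta_plus_even: "G_eta (\<tau> + 2 * of_int n) = nome (- of_int n / 24) * G_eta \<tau>"
proof -
  have 1: "eta ((\<tau> + 2 * of_int n) / 2) = nome (of_int n / 24) * eta (\<tau> / 2)"
    using eta_plus_of_int[of "\<tau> / 2" n] by (simp add: add_divide_distrib)
  have 2: "eta (\<tau> + 2 * of_int n) = nome (of_int (2 * n) / 24) * eta \<tau>"
    using eta_plus_of_int[of \<tau> "2 * n"] by simp
  have "nome (- of_int n / 24) * nome (of_int (2 * n) / 24) ^ 2 = nome (of_int n / 24) ^ 3"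
    unfolding nome_power nome_add[symmetric] by (rule arg_cong[of _ _ nome]) simp
  hence "nome (of_int n / 24) ^ 3 / nome (of_int (2 * n) / 24) ^ 2 = nome (- of_int n / 24)" by (simp add: divide_eq_eq)
  thus ?thesis unfolding G_eta_def 1 2 power_mult_distrib times_divide_times_eq[symmetric] by (simp only:)
qed

text \<open>\<open>G_eta\<close> without its leading power, as a function of x =
  \<open>nome (\<tau> / 2)\<close>; the leading exponent is 3/48 - 2/24 = -1/48.\<close>

definition G_prod :: "complex \<Rightarrow> complex" where
  "G_prod x = euler_prod x ^ 3 / euler_prod (x ^ 2) ^ 2"

lemma G_eta_eq: "G_eta \<tau> = nome (- \<tau> / 48) * G_prod (nome (\<tau> / 2))"
proof -
  have "nome (- \<tau> / 48) * nome (\<tau> / 24) ^ 2 = nome (\<tau> / 2 / 24) ^ 3"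
    unfolding nome_power nome_add[symmetric] by (rule arg_cong[of _ _ nome]) simp
  hence *: "nome (\<tau> / 2 / 24) ^ 3 / nome (\<tau> / 24) ^ 2 = nome (- \<tau> / 48)" by (simp add: divide_eq_eq)
  have **: "nome (\<tau> / 2) ^ 2 = nome \<tau>" by (simp add: nome_power)
  show ?thesis unfolding G_eta_def eta_eq G_prod_def ** power_mult_distrib times_divide_times_eq[symmetric] * ..
qed

lemma G_prod_tendsto: "(G_prod \<longlongrightarrow> 1) (nhds 0)"
proof -
  have "isCont euler_prod 0"
    using holomorphic_on_imp_continuous_on[OF euler_prod_holomorphic]
    by (auto simp: continuous_on_eq_continuous_at)
  hence "(euler_prod \<longlongrightarrow> euler_prod 0) (nhds 0)"
    by (simp only: isCont_def tendsto_at_iff_tendsto_nhds)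
  hence e: "(euler_prod \<longlongrightarrow> 1) (nhds 0)" by simp
  have "((\<lambda>x::complex. x ^ 2) \<longlongrightarrow> 0 ^ 2) (nhds 0)" by (rule tendsto_power) (rule filterlim_ident)
  hence "filterlim (\<lambda>x::complex. x ^ 2) (nhds 0) (nhds 0)" by simp
  hence "((\<lambda>x. euler_prod (x ^ 2)) \<longlongrightarrow> 1) (nhds 0)" by (rule filterlim_compose[OF e])
  hence "((\<lambda>x. euler_prod x ^ 3 / euler_prod (x ^ 2) ^ 2) \<longlongrightarrow> 1 ^ 3 / 1 ^ 2) (nhds 0)"
    by (intro tendsto_intros e) auto
  thus ?thesis by (simp add: G_prod_def[abs_def])
qed

abbreviation at_i_infinity :: "complex filter" where
  "at_i_infinity \<equiv> filtercomap Im at_top"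

lemma nome_tendsto_0:
  assumes "a > 0"
  shows "((\<lambda>\<tau>. nome (of_real a * \<tau> + b)) \<longlongrightarrow> 0) at_i_infinity"
proof -
  have "filterlim (\<lambda>y. (- 2 * pi * a) * y) at_bot at_top"
    by (rule filterlim_tendsto_neg_mult_at_bot[OF tendsto_const _ filterlim_ident]) (use assms in simp)
  hence "((\<lambda>y. exp ((- 2 * pi * a) * y)) \<longlongrightarrow> 0) at_top"
    by (rule filterlim_compose[OF exp_at_bot])
  hence "((\<lambda>\<tau>. exp ((- 2 * pi * a) * Im \<tau>)) \<longlongrightarrow> 0) at_i_infinity"
    by (rule filterlim_compose) (rule filterlim_filtercomap)
  moreover have "norm (nome (of_real a * \<tau>)) = exp ((- 2 * pi * a) * Im \<tau>)" for \<tau> by (simp add: norm_nome)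
  ultimately have "((\<lambda>\<tau>. norm (nome (of_real a * \<tau>))) \<longlongrightarrow> 0) at_i_infinity" by (simp only:)
  hence "((\<lambda>\<tau>. nome (of_real a * \<tau>)) \<longlongrightarrow> 0) at_i_infinity" by (rule tendsto_norm_zero_cancel)
  hence "((\<lambda>\<tau>. nome (of_real a * \<tau>) * nome b) \<longlongrightarrow> 0) at_i_infinity" by (rule tendsto_mult_left_zero)
  thus ?thesis by (simp only: nome_add)
qed

lemma G_prod_nome_tendsto:
  assumes "a > 0"
  shows "((\<lambda>\<tau>. G_prod (nome (of_real a * \<tau> + b))) \<longlongrightarrow> 1) at_i_infinity"
  by (rule filterlim_compose[OF G_prod_tendsto nome_tendsto_0[OF assms]])

text \<open>Up to a constant the quotient behaves like \<open>nome\<close> at (1 - a) \<tau>/48,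
  which stays bounded for a \<le> 1, so a positive power of \<open>nome (\<tau> / 2)\<close> forces
  the limit 0. This covers all terms of the inverted Hecke sum except the dilated one.\<close>

lemma G_eta_quotient_tendsto_0:
  assumes a: "0 < a" "a \<le> 1" and m: "m > 0"
  shows "((\<lambda>\<tau>. G_eta (of_real a * \<tau> + b) / G_eta \<tau> * nome (\<tau> / 2) ^ m) \<longlongrightarrow> 0) at_i_infinity"
proof -
  have eq: "G_eta (of_real a * \<tau> + b) / G_eta \<tau> * nome (\<tau> / 2) ^ m =
     nome (- b / 48) * nome (of_real ((1 - a) / 48 + real m / 2) * \<tau> + 0) * (G_prod (nome (of_real (a / 2) * \<tau> + b / 2)) / G_prod (nome (of_real (1/2) * \<tau> + 0)))" for \<tau>
  proof -
    have e1: "(of_real a * \<tau> + b) / 2 = of_real (a / 2) * \<tau> + b / 2" by (simp add: field_simps)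
    have e2: "\<tau> / 2 = of_real (1/2) * \<tau> + 0" by simp
    have "nome (- (of_real a * \<tau> + b) / 48) * nome (\<tau> / 2) ^ m = nome (- b / 48) * nome (of_real ((1 - a) / 48 + real m / 2) * \<tau> + 0) * nome (- \<tau> / 48)"
      unfolding nome_power nome_add[symmetric] by (rule arg_cong[of _ _ nome]) (simp add: field_simps)
    hence "nome (- (of_real a * \<tau> + b) / 48) * nome (\<tau> / 2) ^ m / nome (- \<tau> / 48) = nome (- b / 48) * nome (of_real ((1 - a) / 48 + real m / 2) * \<tau> + 0)"
       by (simp only: nonzero_mult_div_cancel_right[OF nome_nonzero])
    moreover have "x * p / (z * r) * y = (x * y / z) * (p / r)" for x p z r y :: complex by (simp add: mult_ac)
    ultimately show ?thesis unfolding G_eta_eq e1 e2[symmetric] by (simp only:)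
  qed
  have "((\<lambda>\<tau>. nome (- b / 48) * nome (of_real ((1 - a) / 48 + real m / 2) * \<tau> + 0) * (G_prod (nome (of_real (a / 2) * \<tau> + b / 2)) / G_prod (nome (of_real (1/2) * \<tau> + 0))))
      \<longlongrightarrow> nome (- b / 48) * 0 * (1 / 1)) at_i_infinity"
  proof (intro tendsto_mult tendsto_divide tendsto_const)
    show "((\<lambda>\<tau>. nome (of_real ((1 - a) / 48 + real m / 2) * \<tau> + 0)) \<longlongrightarrow> 0) at_i_infinity"
      by (rule nome_tendsto_0) (use a m in \<open>auto intro!: add_nonneg_pos\<close>)
    show "((\<lambda>\<tau>. G_prod (nome (of_real (a / 2) * \<tau> + b / 2))) \<longlongrightarrow> 1) at_i_infinity"
      by (rule G_prod_nome_tendsto) (use a in auto)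
    show "((\<lambda>\<tau>. G_prod (nome (of_real (1/2) * \<tau> + 0))) \<longlongrightarrow> 1) at_i_infinity"
      by (rule G_prod_nome_tendsto) auto
  qed auto
  thus ?thesis unfolding eq by simp
qed

section \<open>Inversion of the Hecke sum\<close>

context hecke_prime
begin

definition U :: "nat \<Rightarrow> nat set" where
  "U c = {b \<in> {..<c}. coprime (int b) (int c)}"

lemma U_prime: "U l = {1..<l}"
proof (intro equalityI subsetI)
  fix b assume b: "b \<in> U l"
  have "b \<noteq> 0"
  proof
    assume "b = 0"
    hence "coprime (0::int) (int l)" using b by (simp add: U_def)
    thus False using l_gt_3 by simp
  qed
  thus "b \<in> {1..<l}" using b by (auto simp: U_def)
next
  fix b assume b: "b \<in> {1..<l}"
  hence "\<not> int l dvd int b" by (simp add: nat_dvd_not_less)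
  hence "coprime (int b) (int l)" using prime_imp_coprime[of "int l" "int b"] prime_l by (simp add: coprime_commute)
  thus "b \<in> U l" using b by (simp add: U_def)
qed

lemma U_not_dvd: "b \<in> U l \<Longrightarrow> \<not> int l dvd int b"
  unfolding U_prime by (simp add: nat_dvd_not_less)

lemma U_square_not_dvd: "b \<in> U (l ^ 2) \<Longrightarrow> \<not> int l dvd int b"
  using l_gt_3 coprime_common_divisor[of "int b" "int l" "int l"] by (auto simp: U_def)

text \<open>Zero, the nonzero multiples of \<open>l\<close> and the units are separated because
  inversion sends them to different parts of the sum.\<close>

lemma sum_split_square:
  fixes f :: "nat \<Rightarrow> complex"
  shows "(\<Sum>b<l^2. f b) = f 0 + (\<Sum>b\<in>U l. f (l * b)) + (\<Sum>b\<in>U (l^2). f b)"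
proof -
  have "{..<l^2} = insert 0 ((\<lambda>b. l * b) ` U l) \<union> U (l^2)"
  proof (intro equalityI subsetI)
    fix b assume b: "b \<in> {..<l^2}"
    show "b \<in> insert 0 ((\<lambda>b. l * b) ` U l) \<union> U (l^2)"
    proof (cases "l dvd b")
      case True
      then obtain k where k: "b = l * k" by (elim dvdE)
      hence "k < l" using b by (simp add: power2_eq_square)
      thus ?thesis using k by (auto simp: U_prime)
    next
      case False
      hence "\<not> int l dvd int b" by simp
      hence "coprime (int b) (int l)" using prime_imp_coprime[of "int l" "int b"] prime_l by (simp add: coprime_commute)
      thus ?thesis using b by (simp add: U_def)
    qed
  next
    fix b assume "b \<in> insert 0 ((\<lambda>b. l * b) ` U l) \<union> U (l^2)"
    thus "b \<in> {..<l^2}" using l_pos by (auto simp: U_def power2_eq_square)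
  qed
  moreover have "(\<Sum>b\<in>insert 0 ((\<lambda>b. l * b) ` U l) \<union> U (l^2). f b) = (\<Sum>b\<in>insert 0 ((\<lambda>b. l * b) ` U l). f b) + (\<Sum>b\<in>U (l^2). f b)"
  proof (rule sum.union_disjoint)
    show "insert 0 ((\<lambda>b. l * b) ` U l) \<inter> U (l^2) = {}" by (auto dest: U_square_not_dvd)
  qed (auto simp: U_def)
  moreover have "(\<Sum>b\<in>insert 0 ((\<lambda>b. l * b) ` U l). f b) = f 0 + (\<Sum>b\<in>(\<lambda>b. l * b) ` U l. f b)"
    by (rule sum.insert) (use l_pos in \<open>auto simp: U_prime\<close>)
  moreover have "(\<Sum>b\<in>(\<lambda>b. l * b) ` U l. f b) = (\<Sum>b\<in>U l. f (l * b))"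
    by (subst sum.reindex) (use l_pos in \<open>auto simp: inj_on_def\<close>)
  ultimately show ?thesis by simp
qed

lemma sum_leg: "(\<Sum>b<l. leg (int b) * f b) = (\<Sum>b\<in>U l. leg (int b) * f b)"
  by (rule sum.mono_neutral_right) (auto simp: U_prime legendre_zero not_less_eq_eq)

abbreviation G_shift :: "complex \<Rightarrow> nat \<Rightarrow> complex" where
  "G_shift \<sigma> b \<equiv> G_eta ((\<sigma> - 48 * of_nat b) / of_nat (l^2))"

abbreviation G_twist :: "complex \<Rightarrow> nat \<Rightarrow> complex" where
  "G_twist \<sigma> b \<equiv> G_eta (\<sigma> - 48 * of_nat b / of_nat l)"

text \<open>The shape of \<open>Num\<close> after inversion. The dilation stems from the zero
  translate of \<open>F_eta\<close>, the twisted sum from its translates by multiples of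
  \<open>l\<close>, and the remaining pieces combine into the full set of translates. The step is 48
  because that is the period of \<open>G_eta\<close>.\<close>

definition H :: "complex \<Rightarrow> complex" where
  "H \<sigma> = G_eta (of_nat (l^2) * \<sigma>)
      + chi12 (int l) * g / of_nat l * (\<Sum>b<l. leg (int b) * G_twist \<sigma> b)
      + 1 / of_nat l * (\<Sum>b<l^2. G_shift \<sigma> b)"

lemma units_reindex:
  assumes "c = l \<or> c = l ^ 2"
  obtains \<beta> where "bij_betw \<beta> (U c) (U c)" "\<And>b. b \<in> U c \<Longrightarrow> [1152 * int b * int (\<beta> b) = 1] (mod int c)"
proof -
  have "c > 0" using assms l_pos by auto
  moreover have "coprime 1152 (int l)" using coprime_12_power[of 7 2] by (simp add: coprime_commute)
  hence "coprime 1152 (int c)" using assms by auto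
  ultimately show ?thesis using inverse_units_bij[of c 1152] that unfolding U_def by blast
qed

text \<open>1152 = 2 * 24^2, so up to a square \<open>B\<close> is inverse to \<open>2 * b\<close>,
  and inverse residues have equal symbols.\<close>

lemma legendre_inverse:
  assumes "[1152 * int b * int B = 1] (mod int l)" "b \<in> U l" "B \<in> U l"
  shows "leg (2 * int b) = leg (int B)"
proof -
  note mult = legendre_mult[OF prime_l l_gt_2]
  have "\<not> int l dvd 24"
    using coprime_common_divisor[OF coprime_12_power[of 3 1], of "int l"] l_gt_3 by auto
  hence 24: "leg (24 * 24) = 1" using prime_l by (rule legendre_square_arg)
  have "leg 1 = 1" using legendre_square_arg[of l 1] prime_l l_gt_3 by auto
  moreover have "leg (1152 * int b * int B) = leg 1" by (rule legendre_cong) (rule assms)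
  moreover have "leg (1152 * int b * int B) = leg ((24 * 24) * ((2 * int b) * int B))" by (rule arg_cong[of _ _ leg]) simp
  ultimately have "leg (24 * 24) * (leg (2 * int b) * leg (int B)) = 1" by (simp only: mult)
  hence "leg (2 * int b) * leg (int B) = 1" using 24 by simp
  moreover have "leg (2 * int b) = leg (2 * int b) * (leg (int B) * leg (int B))"
    unfolding legendre_square[OF U_not_dvd[OF assms(3)]] by simp
  ultimately show ?thesis by (simp only: mult.assoc[symmetric] mult_1_left)
qed

lemma not_dvd_double: "\<not> int l dvd n \<Longrightarrow> \<not> int l dvd 2 * n"
proof -
  have "\<not> int l dvd 2" using l_gt_3 zdvd_imp_le[of "int l" 2] by auto
  thus "\<not> int l dvd n \<Longrightarrow> \<not> int l dvd 2 * n" using prime_l by (simp add: prime_dvd_mult_iff)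
qed

lemma gauss_quotient:
  assumes "b \<in> U l"
  shows "gauss_sum (2 * int b) l ^ 3 / gauss_sum (int b) l ^ 2 = leg (2 * int b) * g"
proof -
  have nd: "\<not> int l dvd int b" "\<not> int l dvd 2 * int b" using U_not_dvd[OF assms] not_dvd_double by auto
  have 1: "leg (2 * int b) ^ 3 = leg (2 * int b)" "leg (int b) ^ 2 = 1"
    using legendre_square[OF nd(1)] legendre_square[OF nd(2)] by (simp_all add: power2_eq_square power3_eq_cube)
  show ?thesis
    unfolding gauss_sum_prime[OF prime_l l_gt_2 nd(1)] gauss_sum_prime[OF prime_l l_gt_2 nd(2)] g_def[symmetric]
      power_mult_distrib 1 using g_nonzero by (simp add: power2_eq_square power3_eq_cube)
qed

lemma coprime_square_12: "coprime (int (l ^ 2)) 12"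
  using coprime_l_12 by simp

lemma F_factor_divide:
  assumes "Im \<tau> > 0"
  shows "F_factor (\<tau> / of_nat (l^2)) = of_nat l * F_factor \<tau>"
  using F_factor_scale[of "\<tau> / of_nat (l^2)" l] Im_divide_nat_pos[OF assms, of "l^2"] l_pos by simp

lemma chi12_square: "chi12 (int (l ^ 2)) = 1"
proof -
  have "chi12 (int (l ^ 2)) = chi12 1"
    by (rule chi12_cong) (auto simp: l_square cong_iff_dvd_diff)
  thus ?thesis by (simp add: chi12_def)
qed

text \<open>The closing bookkeeping of \<open>Num_transform\<close> with sums replaced by atoms:
  \<open>s0\<close>, \<open>s2\<close>, \<open>s3\<close> stand for the \<open>G_shift\<close> parts
  over 0, the multiples of \<open>l\<close> and the units, \<open>s1\<close> for the twisted
  sum.\<close>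

lemma linear_combination:
  fixes L :: complex
  assumes "L \<noteq> 0"
  shows "1 / L * (K * (L * a + x * y * s1 + s3)) + K * (1 / L * s2) + K * (1 / L * s0) =
           K * (a + x * y / L * s1 + 1 / L * (s0 + s2 + s3))"
  using assms by (simp add: field_simps)

text \<open>Piece by piece: \<open>A\<close> and \<open>E\<close> exchange the zero translate with
  the dilation, \<open>B\<close> and \<open>D\<close> exchange the multiples of \<open>l\<close>
  with the twisted sum, and \<open>C\<close> permutes the units.\<close>

lemma Num_transform:
  assumes \<tau>: "Im \<tau> > 0"
  shows "Num \<tau> = F_factor \<tau> * H (- 1 / \<tau>)"
proof -
  define \<sigma> where "\<sigma> = - 1 / \<tau>"
  define K where "K = F_factor \<tau>"
  have \<tau>0: "\<tau> \<noteq> 0" using \<tau> by auto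
  have l0: "(of_nat l :: complex) \<noteq> 0" using l_pos by simp
  have \<tau>l: "Im (\<tau> / of_nat (l^2)) > 0" using Im_divide_nat_pos[OF \<tau>, of "l^2"] l_pos by simp
  have K': "F_factor (\<tau> / of_nat (l^2)) = of_nat l * K" unfolding K_def by (rule F_factor_divide[OF \<tau>])
  obtain \<beta> where \<beta>: "bij_betw \<beta> (U l) (U l)" "\<And>b. b \<in> U l \<Longrightarrow> [1152 * int b * int (\<beta> b) = 1] (mod int l)"
    using units_reindex[of l] by blast
  obtain \<beta>2 where \<beta>2: "bij_betw \<beta>2 (U (l^2)) (U (l^2))" "\<And>b. b \<in> U (l^2) \<Longrightarrow> [1152 * int b * int (\<beta>2 b) = 1] (mod int (l^2))"
    using units_reindex[of "l^2"] by blast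
  have \<beta>U: "\<beta> b \<in> U l" if "b \<in> U l" for b using \<beta>(1) that by (auto simp: bij_betw_def)

  have A: "F_shift \<tau> 0 = K * of_nat l * G_eta (of_nat (l^2) * \<sigma>)"
  proof -
    have "F_eta (\<tau> / of_nat (l^2)) = of_nat l * K * G_eta (- 1 / (\<tau> / of_nat (l^2)))"
      using F_eta_inversion[OF \<tau>l] unfolding K' .
    also have "- 1 / (\<tau> / of_nat (l^2)) = of_nat (l^2) * \<sigma>" by (simp add: \<sigma>_def)
    finally show ?thesis by simp
  qed
  have B: "F_shift \<tau> (l * b) = K * (chi12 (int l) * g * (leg (int (\<beta> b)) * G_twist \<sigma> (\<beta> b)))"
    if b: "b \<in> U l" for b
  proof -
    have "(\<tau> + 24 * of_nat (l * b)) / of_nat (l^2) = 24 * of_int (int b) / of_nat l + \<tau> / of_nat (l^2)"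
      using l0 by (simp add: field_simps power2_eq_square)
    hence "F_shift \<tau> (l * b) = F_eta (24 * of_int (int b) / of_nat l + \<tau> / of_nat (l^2))" by simp
    also have "\<dots> = of_nat l * K * chi12 (int l) * (leg (2 * int b) * g / of_nat l) * G_eta (- 48 * of_int (int (\<beta> b)) / of_nat l - 1 / (of_nat l ^ 2 * (\<tau> / of_nat (l^2))))"
      unfolding F_eta_transform[OF \<tau>l l_pos coprime_l_12 \<beta>(2)[OF b]] K' gauss_quotient[OF b] ..
    also have "- 48 * of_int (int (\<beta> b)) / of_nat l - 1 / (of_nat l ^ 2 * (\<tau> / of_nat (l^2))) = \<sigma> - 48 * of_nat (\<beta> b) / of_nat l"
      using l0 by (simp add: \<sigma>_def)
    also have "leg (2 * int b) = leg (int (\<beta> b))" by (rule legendre_inverse[OF \<beta>(2)[OF b] b \<beta>U[OF b]])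
    finally show ?thesis using l0 by simp
  qed
  \<comment> \<open>Both Gauss sums modulo \<open>l ^ 2\<close> equal \<open>l\<close> and
    \<open>chi12\<close> is 1 there, so no symbol survives; the powers of \<open>l\<close> cancel in
    l * (l^3 / l^2 / l^2) = 1.\<close>
  have C: "F_shift \<tau> b = K * G_shift \<sigma> (\<beta>2 b)"
    if b: "b \<in> U (l^2)" for b
  proof -
    have nd: "\<not> int l dvd int b" "\<not> int l dvd 2 * int b" using U_square_not_dvd[OF b] not_dvd_double by auto
    have l2: "l ^ 2 > 0" using l_pos by simp
    have "(\<tau> + 24 * of_nat b) / of_nat (l^2) = 24 * of_int (int b) / of_nat (l^2) + \<tau> / of_nat (l^2)"
      by (simp add: add_divide_distrib)
    hence "F_shift \<tau> b = F_eta (24 * of_int (int b) / of_nat (l^2) + \<tau> / of_nat (l^2))" by simp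
    also have "\<dots> = of_nat l * K * 1 * (of_nat l ^ 3 / of_nat l ^ 2 / of_nat (l^2)) * G_eta (- 48 * of_int (int (\<beta>2 b)) / of_nat (l^2) - 1 / (of_nat (l^2) ^ 2 * (\<tau> / of_nat (l^2))))"
      unfolding F_eta_transform[OF \<tau>l l2 coprime_square_12 \<beta>2(2)[OF b]] K' chi12_square
        gauss_sum_prime_square[OF prime_l l_gt_2 nd(1)] gauss_sum_prime_square[OF prime_l l_gt_2 nd(2)] ..
    also have "- 48 * of_int (int (\<beta>2 b)) / of_nat (l^2) - 1 / (of_nat (l^2) ^ 2 * (\<tau> / of_nat (l^2))) = (\<sigma> - 48 * of_nat (\<beta>2 b)) / of_nat (l^2)"
      using l0 \<tau>0 by (simp add: \<sigma>_def field_simps power2_eq_square)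
    finally show ?thesis using l0 by (simp add: power2_eq_square power3_eq_cube)
  qed
  have D: "F_twist \<tau> b = K * (chi12 (int l) * g * leg (2 * int b) / of_nat l * G_eta ((\<sigma> - 48 * of_nat (l * \<beta> b)) / of_nat (l^2)))"
    if b: "b \<in> U l" for b
  proof -
    have "F_twist \<tau> b = F_eta (24 * of_int (int b) / of_nat l + \<tau>)" by simp
    also have "\<dots> = K * chi12 (int l) * (leg (2 * int b) * g / of_nat l) * G_eta (- 48 * of_int (int (\<beta> b)) / of_nat l - 1 / (of_nat l ^ 2 * \<tau>))"
      unfolding F_eta_transform[OF \<tau> l_pos coprime_l_12 \<beta>(2)[OF b]] K_def gauss_quotient[OF b] ..
    also have "- 48 * of_int (int (\<beta> b)) / of_nat l - 1 / (of_nat l ^ 2 * \<tau>) = (\<sigma> - 48 * of_nat (l * \<beta> b)) / of_nat (l^2)"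
      using l0 \<tau>0 by (simp add: \<sigma>_def field_simps power2_eq_square)
    finally show ?thesis by simp
  qed
  have E: "F_eta (of_nat (l^2) * \<tau>) = K * (1 / of_nat l * G_shift \<sigma> 0)"
  proof -
    have "Im (of_nat (l^2) * \<tau>) > 0" using \<tau> l_pos by simp
    from F_eta_inversion[OF this] have "F_eta (of_nat (l^2) * \<tau>) = F_factor (of_nat (l^2) * \<tau>) * G_eta (- 1 / (of_nat (l^2) * \<tau>))" .
    also have "F_factor (of_nat (l^2) * \<tau>) = K / of_nat l"
      using F_factor_scale[OF \<tau> l_pos] l0 by (simp add: K_def)
    also have "- 1 / (of_nat (l^2) * \<tau>) = (\<sigma> - 48 * of_nat 0) / of_nat (l^2)" by (simp add: \<sigma>_def)
    finally show ?thesis by simp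
  qed

  \<comment> \<open>By reciprocity \<open>chi12 (int l)\<close> is \<open>leg 3\<close>, so the
    factor \<open>leg 6\<close> in \<open>Num\<close> cancels the sign that \<open>D\<close> leaves
    in the twisted terms.\<close>
  have chi: "leg 6 * (chi12 (int l) * leg 2) = 1"
  proof -
    have "\<not> int l dvd 6" using coprime_common_divisor[OF coprime_12_power[of 1 1], of "int l"] l_gt_3 by auto
    hence "leg (6 * 6) = 1" using prime_l by (rule legendre_square_arg)
    moreover have "leg (6 * 6) = leg (6 * (3 * 2))" by simp
    ultimately show ?thesis unfolding chi12_prime[OF prime_l l_gt_3]
      by (simp only: legendre_mult[OF prime_l l_gt_2])
  qed

  have T1: "(\<Sum>b<l^2. F_shift \<tau> b) =
     K * (of_nat l * G_eta (of_nat (l^2) * \<sigma>) + chi12 (int l) * g * (\<Sum>b\<in>U l. leg (int b) * G_twist \<sigma> b)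
         + (\<Sum>b\<in>U (l^2). G_shift \<sigma> b))"
  proof -
    have "(\<Sum>b\<in>U l. F_shift \<tau> (l * b)) = (\<Sum>b\<in>U l. K * (chi12 (int l) * g * (leg (int (\<beta> b)) * G_twist \<sigma> (\<beta> b))))"
      by (intro sum.cong refl B)
    also have "\<dots> = K * (chi12 (int l) * g * (\<Sum>b\<in>U l. leg (int (\<beta> b)) * G_twist \<sigma> (\<beta> b)))"
      by (simp only: sum_distrib_left)
    also have "(\<Sum>b\<in>U l. leg (int (\<beta> b)) * G_twist \<sigma> (\<beta> b)) = (\<Sum>b\<in>U l. leg (int b) * G_twist \<sigma> b)"
      by (rule sum.reindex_bij_betw[OF \<beta>(1)])
    finally have 1: "(\<Sum>b\<in>U l. F_shift \<tau> (l * b)) = K * (chi12 (int l) * g * (\<Sum>b\<in>U l. leg (int b) * G_twist \<sigma> b))" .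
    have "(\<Sum>b\<in>U (l^2). F_shift \<tau> b) = (\<Sum>b\<in>U (l^2). K * G_shift \<sigma> (\<beta>2 b))"
      by (intro sum.cong refl C)
    also have "\<dots> = K * (\<Sum>b\<in>U (l^2). G_shift \<sigma> (\<beta>2 b))"
      by (simp only: sum_distrib_left)
    also have "(\<Sum>b\<in>U (l^2). G_shift \<sigma> (\<beta>2 b)) = (\<Sum>b\<in>U (l^2). G_shift \<sigma> b)"
      by (rule sum.reindex_bij_betw[OF \<beta>2(1)])
    finally have 2: "(\<Sum>b\<in>U (l^2). F_shift \<tau> b) = K * (\<Sum>b\<in>U (l^2). G_shift \<sigma> b)" .
    show ?thesis unfolding sum_split_square 1 2 A by (simp only: ring_distribs mult.assoc)
  qed
  have T2: "leg 6 / g * (\<Sum>b<l. leg (int b) * F_twist \<tau> b) =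
      K * (1 / of_nat l * (\<Sum>b\<in>U l. G_shift \<sigma> (l * b)))"
  proof -
    have "(\<Sum>b<l. leg (int b) * F_twist \<tau> b) = (\<Sum>b\<in>U l. leg (int b) * F_twist \<tau> b)"
      by (rule sum_leg)
    also have "\<dots> = (\<Sum>b\<in>U l. (K * (chi12 (int l) * leg 2 * g / of_nat l)) * G_eta ((\<sigma> - 48 * of_nat (l * \<beta> b)) / of_nat (l^2)))"
    proof (intro sum.cong refl)
      fix b assume b: "b \<in> U l"
      have "leg (2 * int b) = leg 2 * leg (int b)" by (rule legendre_mult[OF prime_l l_gt_2])
      hence "leg (int b) * F_twist \<tau> b = (leg (int b) * leg (int b)) * ((K * (chi12 (int l) * leg 2 * g / of_nat l)) * G_eta ((\<sigma> - 48 * of_nat (l * \<beta> b)) / of_nat (l^2)))"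
        unfolding D[OF b] by (simp add: mult_ac)
      thus "leg (int b) * F_twist \<tau> b = (K * (chi12 (int l) * leg 2 * g / of_nat l)) * G_eta ((\<sigma> - 48 * of_nat (l * \<beta> b)) / of_nat (l^2))"
        unfolding legendre_square[OF U_not_dvd[OF b]] by simp
    qed
    also have "\<dots> = (K * (chi12 (int l) * leg 2 * g / of_nat l)) * (\<Sum>b\<in>U l. G_eta ((\<sigma> - 48 * of_nat (l * \<beta> b)) / of_nat (l^2)))"
      by (rule sum_distrib_left[symmetric])
    also have "(\<Sum>b\<in>U l. G_eta ((\<sigma> - 48 * of_nat (l * \<beta> b)) / of_nat (l^2))) = (\<Sum>b\<in>U l. G_shift \<sigma> (l * b))"
      by (rule sum.reindex_bij_betw[OF \<beta>(1)])
    finally have "leg 6 / g * (\<Sum>b<l. leg (int b) * F_twist \<tau> b) =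
        (leg 6 * (chi12 (int l) * leg 2)) * (K * (1 / of_nat l * (\<Sum>b\<in>U l. G_shift \<sigma> (l * b))))"
      using g_nonzero by simp
    thus ?thesis unfolding chi by simp
  qed
  show ?thesis
  proof -
    have "Num \<tau> = K * H \<sigma>"
      unfolding Num_def T1 T2 E unfolding H_def sum_leg sum_split_square
      using l0 by (rule linear_combination)
    thus ?thesis unfolding K_def \<sigma>_def .
  qed
qed

text \<open>Numerator and denominator share the factor \<open>F_factor\<close>, so the quotient has
  weight 0.\<close>

lemma Z_tilde_inversion:
  assumes \<sigma>: "Im \<sigma> > 0"
  shows "Z_tilde l (- 1 / \<sigma>) = H \<sigma> / G_eta \<sigma>"
proof -
  have \<tau>: "Im (- 1 / \<sigma>) > 0" by (rule Im_minus_inverse_pos[OF \<sigma>])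
  have [simp]: "- 1 / (- 1 / \<sigma>) = \<sigma>" by simp
  show ?thesis unfolding Z_tilde_eq[OF \<tau>] Num_transform[OF \<tau>] F_eta_inversion[OF \<tau>]
    using F_factor_nonzero[OF \<tau>] by simp
qed

text \<open>All parts acquire the same root of unity as \<open>G_eta\<close> itself: the dilation
  because \<open>l ^ 2\<close> is 1 modulo 24, the translates after a shift of the index.\<close>

lemma H_plus_2: "H (\<sigma> + 2) = nome (- 1 / 24) * H \<sigma>"
proof -
  have l2: "l ^ 2 > 0" using l_pos by simp
  have l2c: "(of_nat (l ^ 2) :: complex) = 24 * of_nat M + 1" unfolding l_square by simp
  have l20: "(of_nat (l ^ 2) :: complex) \<noteq> 0" using l_pos by simp
  have 1: "G_eta (of_nat (l^2) * (\<sigma> + 2)) = nome (- 1 / 24) * G_eta (of_nat (l^2) * \<sigma>)"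
  proof -
    have "of_nat (l^2) * (\<sigma> + 2) = of_nat (l^2) * \<sigma> + 2 * of_int (int (l^2))" by (simp add: algebra_simps)
    moreover have "nome (- of_int (int (l^2)) / 24) = nome (- 1 / 24)"
    proof (rule nome_eqI)
      have "- of_int (int (l^2)) / 24 - - 1 / 24 = (of_int (- int M) :: complex)"
        by (simp add: l2c[simplified] field_simps)
      thus "- of_int (int (l^2)) / 24 - - 1 / 24 \<in> (\<int> :: complex set)" by (simp only: Ints_of_int)
    qed
    ultimately show ?thesis using G_eta_plus_even[of "of_nat (l^2) * \<sigma>" "int (l^2)"] by (simp only:)
  qed
  have 2: "G_twist (\<sigma> + 2) b = nome (- 1 / 24) * G_twist \<sigma> b" for b
    using G_eta_plus_even[of "\<sigma> - 48 * of_nat b / of_nat l" 1] by (simp add: algebra_simps)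
  define h where "h n = G_eta ((\<sigma> - 48 * of_int n) / of_nat (l^2))" for n :: int
  \<comment> \<open>Changing the index by a multiple of \<open>l ^ 2\<close> moves the argument by a
    multiple of 48, a period of \<open>G_eta\<close>.\<close>
  have h_cong: "h m = h n" if "[m = n] (mod int (l ^ 2))" for m n
  proof -
    have "int (l ^ 2) dvd n - m" using that by (simp only: cong_iff_dvd_diff dvd_diff_commute)
    then obtain k where "n - m = int (l ^ 2) * k" by (elim dvdE)
    hence k: "n = m + int (l ^ 2) * k" by (simp only: algebra_simps)
    have "(\<sigma> - 48 * of_int m) / of_nat (l^2) = (\<sigma> - 48 * of_int n) / of_nat (l^2) + 2 * of_int (24 * k)"
      unfolding k using l_pos by (simp add: field_simps)
    hence "h m = nome (- of_int (24 * k) / 24) * h n" unfolding h_def by (simp only: G_eta_plus_even)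
    also have "nome (- of_int (24 * k) / 24) = 1" using nome_of_int[of "-k"] by simp
    finally show ?thesis by simp
  qed
  have 3: "(\<Sum>b<l^2. G_shift (\<sigma> + 2) b) = nome (- 1 / 24) * (\<Sum>b<l^2. G_shift \<sigma> b)"
  proof -
    have "G_shift (\<sigma> + 2) b = nome (- 1 / 24) * h (1 * int b + int M)" for b
    proof -
      \<comment> \<open>2 = 2 l^2 - 48 M: the index moves by \<open>M\<close>, and after division by
        l^2 the argument moves by 2.\<close>
      have "\<sigma> + 2 - 48 * of_nat b = \<sigma> - 48 * of_int (1 * int b + int M) + 2 * of_nat (l ^ 2)"
        unfolding l2c by simp
      hence "(\<sigma> + 2 - 48 * of_nat b) / of_nat (l^2) = (\<sigma> - 48 * of_int (1 * int b + int M)) / of_nat (l^2) + 2 * of_int 1"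
        by (simp only: add_divide_distrib nonzero_mult_div_cancel_right[OF l20] of_int_1 mult_1_right)
      thus ?thesis using G_eta_plus_even[of "(\<sigma> - 48 * of_int (1 * int b + int M)) / of_nat (l^2)" 1]
        unfolding h_def by (simp only: of_int_1)
    qed
    hence "(\<Sum>b<l^2. G_shift (\<sigma> + 2) b) = nome (- 1 / 24) * (\<Sum>b<l^2. h (1 * int b + int M))"
      by (simp only: sum_distrib_left)
    also have "(\<Sum>b<l^2. h (1 * int b + int M)) = (\<Sum>b<l^2. h (int b))"
      by (rule sum_residue_affine[OF l2]) (auto intro: h_cong)
    finally show ?thesis by (simp add: h_def)
  qed
  have s2: "(\<Sum>b<l. leg (int b) * G_twist (\<sigma> + 2) b) = nome (- 1 / 24) * (\<Sum>b<l. leg (int b) * G_twist \<sigma> b)"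
    unfolding 2 sum_distrib_left by (simp only: mult_ac)
  show ?thesis unfolding H_def 1 s2 3 by (simp only: ring_distribs mult_ac)
qed

lemma Z_tilde_inversion_plus_2:
  assumes \<sigma>: "Im \<sigma> > 0"
  shows "Z_tilde l (- 1 / (\<sigma> + 2)) = Z_tilde l (- 1 / \<sigma>)"
proof -
  have "G_eta (\<sigma> + 2) = nome (- 1 / 24) * G_eta \<sigma>" using G_eta_plus_even[of \<sigma> 1] by simp
  moreover have "Im (\<sigma> + 2) > 0" using \<sigma> by simp
  ultimately show ?thesis using Z_tilde_inversion[OF \<sigma>] Z_tilde_inversion[of "\<sigma> + 2"]
    by (simp only: H_plus_2) (simp only: mult_divide_mult_cancel_left[OF nome_nonzero])
qed

text \<open>Only the dilated term contributes: G(l^2 \<sigma>)/G(\<sigma>) behaves like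
  \<open>nome\<close> at - (l^2 - 1) \<sigma>/48 = - M \<sigma>/2. The nonzero limit makes the order
  of the pole exactly \<open>M\<close>.\<close>

lemma Z_tilde_inversion_tendsto:
  "((\<lambda>\<sigma>. H \<sigma> / G_eta \<sigma> * nome (\<sigma> / 2) ^ M) \<longlongrightarrow> 1) at_i_infinity"
proof -
  have l2c: "(of_nat (l ^ 2) :: complex) = 24 * of_nat M + 1" unfolding l_square by simp
  have l1: "1 \<le> real l ^ 2" using l_gt_3 by (simp add: one_le_power)
  define c where "c = chi12 (int l) * g / of_nat l"
  have A: "((\<lambda>\<sigma>. G_eta (of_nat (l^2) * \<sigma>) / G_eta \<sigma> * nome (\<sigma> / 2) ^ M) \<longlongrightarrow> 1) at_i_infinity"
  proof -
    have "((\<lambda>\<sigma>. G_prod (nome (of_real (real (l^2) / 2) * \<sigma> + 0)) / G_prod (nome (of_real (1/2) * \<sigma> + 0))) \<longlongrightarrow> 1 / 1) at_i_infinity"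
      by (intro tendsto_divide G_prod_nome_tendsto) (use l_pos in auto)
    moreover have "G_prod (nome (of_real (real (l^2) / 2) * \<sigma> + 0)) / G_prod (nome (of_real (1/2) * \<sigma> + 0)) = G_eta (of_nat (l^2) * \<sigma>) / G_eta \<sigma> * nome (\<sigma> / 2) ^ M" for \<sigma>
    proof -
      have "nome (- (of_nat (l^2) * \<sigma>) / 48) * nome (\<sigma> / 2) ^ M = nome (- \<sigma> / 48)"
        unfolding nome_power nome_add[symmetric] l2c by (rule arg_cong[of _ _ nome]) (simp add: field_simps)
      hence 1: "nome (- (of_nat (l^2) * \<sigma>) / 48) / nome (- \<sigma> / 48) * nome (\<sigma> / 2) ^ M = 1" by (simp add: field_simps)
      have "G_eta (of_nat (l^2) * \<sigma>) / G_eta \<sigma> * nome (\<sigma> / 2) ^ M =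
        (nome (- (of_nat (l^2) * \<sigma>) / 48) / nome (- \<sigma> / 48) * nome (\<sigma> / 2) ^ M) * (G_prod (nome (of_nat (l^2) * \<sigma> / 2)) / G_prod (nome (\<sigma> / 2)))"
        unfolding G_eta_eq by simp
      also have "\<dots> = G_prod (nome (of_nat (l^2) * \<sigma> / 2)) / G_prod (nome (\<sigma> / 2))" unfolding 1 by simp
      finally show ?thesis by simp
    qed
    ultimately show ?thesis by simp
  qed
  have B: "((\<lambda>\<sigma>. G_twist \<sigma> b / G_eta \<sigma> * nome (\<sigma> / 2) ^ M) \<longlongrightarrow> 0) at_i_infinity" for b
    using G_eta_quotient_tendsto_0[of 1 M "- (48 * of_nat b / of_nat l)"] M_pos by simp
  have C: "((\<lambda>\<sigma>. G_shift \<sigma> b / G_eta \<sigma> * nome (\<sigma> / 2) ^ M) \<longlongrightarrow> 0) at_i_infinity" for b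
  proof -
    have "(\<sigma> - 48 * of_nat b) / of_nat (l^2) = of_real (1 / real (l^2)) * \<sigma> + - (48 * of_nat b / of_nat (l^2))" for \<sigma> :: complex
      by (simp add: diff_divide_distrib)
    thus ?thesis using G_eta_quotient_tendsto_0[of "1 / real (l^2)" M "- (48 * of_nat b / of_nat (l^2))"] M_pos l_pos l1 by simp
  qed
  have "((\<lambda>\<sigma>. G_eta (of_nat (l^2) * \<sigma>) / G_eta \<sigma> * nome (\<sigma> / 2) ^ M
      + c * (\<Sum>b<l. leg (int b) * (G_twist \<sigma> b / G_eta \<sigma> * nome (\<sigma> / 2) ^ M))
      + 1 / of_nat l * (\<Sum>b<l^2. G_shift \<sigma> b / G_eta \<sigma> * nome (\<sigma> / 2) ^ M))
      \<longlongrightarrow> 1 + c * (\<Sum>b<l. leg (int b) * 0) + 1 / of_nat l * (\<Sum>b<l^2. 0)) at_i_infinity"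
    by (intro tendsto_add tendsto_mult tendsto_sum tendsto_const A B C)
  moreover have "H \<sigma> / G_eta \<sigma> * nome (\<sigma> / 2) ^ M = G_eta (of_nat (l^2) * \<sigma>) / G_eta \<sigma> * nome (\<sigma> / 2) ^ M
      + c * (\<Sum>b<l. leg (int b) * (G_twist \<sigma> b / G_eta \<sigma> * nome (\<sigma> / 2) ^ M))
      + 1 / of_nat l * (\<Sum>b<l^2. G_shift \<sigma> b / G_eta \<sigma> * nome (\<sigma> / 2) ^ M)" for \<sigma>
  proof -
    have 1: "(\<Sum>b<l. leg (int b) * (x b / z * y)) = (\<Sum>b<l. leg (int b) * x b) / z * y" for x z y
      by (simp add: sum_distrib_right sum_divide_distrib mult.assoc)
    have 2: "(\<Sum>b<l^2. x b / z * y) = (\<Sum>b<l^2. x b) / z * y" for x and z y :: complex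
      by (simp add: sum_distrib_right sum_divide_distrib)
    have 3: "(a + d * s + e * t) / z * y = a / z * y + d * (s / z * y) + e * (t / z * y)" for a d s e t z y :: complex
      by (simp add: add_divide_distrib ring_distribs mult.assoc)
    show ?thesis unfolding H_def c_def 1 2 3 ..
  qed
  ultimately show ?thesis by simp
qed

end

section \<open>Functions on the level 2 congruence subgroup\<close>

text \<open>Every small nonzero \<open>x\<close> is \<open>nome a\<close> with large
  \<open>Im a\<close>, so a limit towards i infinity, uniform in the real part, becomes a limit at
  0.\<close>

lemma tendsto_at_cusp:
  fixes f V :: "complex \<Rightarrow> complex"
  assumes h: "h > 0" and lim: "(f \<longlongrightarrow> L) at_i_infinity"
      and V: "\<And>\<tau>. Im \<tau> > y \<Longrightarrow> V (nome (\<tau> / of_nat h)) = f \<tau>"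
  shows "(V \<longlongrightarrow> L) (at 0)"
proof (rule tendstoI)
  fix e :: real assume "e > 0"
  hence "eventually (\<lambda>\<tau>. dist (f \<tau>) L < e) at_i_infinity" using lim by (simp add: tendsto_iff)
  then obtain Y where Y: "\<And>\<tau>. Im \<tau> \<ge> Y \<Longrightarrow> dist (f \<tau>) L < e"
    by (auto simp: eventually_filtercomap eventually_at_top_linorder)
  define r where "r = exp (- 2 * pi * (max Y y / real h))"
  have "eventually (\<lambda>x. x \<in> ball 0 r - {0}) (at (0::complex))"
    by (intro eventually_at_in_open) (auto simp: r_def)
  thus "eventually (\<lambda>x. dist (V x) L < e) (at 0)"
  proof eventually_elim
    case (elim x)
    then obtain a where a: "nome a = x" using nome_surj[of x] by auto
    have "exp (- 2 * pi * Im a) < r" using elim norm_nome[of a] unfolding a by simp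
    hence "2 * pi * (max Y y / real h) < 2 * pi * Im a" unfolding r_def exp_less_cancel_iff by simp
    hence "max Y y / real h < Im a" by (rule mult_left_less_imp_less) simp
    hence im: "max Y y < Im (of_nat h * a)" using h by (simp add: field_simps)
    have "dist (f (of_nat h * a)) L < e" by (rule Y) (use im in auto)
    moreover have "V (nome (of_nat h * a / of_nat h)) = f (of_nat h * a)" by (rule V) (use im in auto)
    ultimately show ?case using h a by simp
  qed
qed

lemma periodic_of_int:
  assumes per: "\<And>\<tau>. Im \<tau> > 0 \<Longrightarrow> f (\<tau> + of_nat h) = f \<tau>" and \<tau>: "Im \<tau> > 0"
  shows "f (\<tau> + of_int k * of_nat h) = f \<tau>"
proof -
  have *: "f (\<tau> + of_nat k * of_nat h) = f \<tau>" if "Im \<tau> > 0" for k \<tau>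
    using that
  proof (induction k)
    case (Suc k)
    have "f (\<tau> + of_nat (Suc k) * of_nat h) = f ((\<tau> + of_nat k * of_nat h) + of_nat h)" by (simp add: algebra_simps)
    also have "\<dots> = f (\<tau> + of_nat k * of_nat h)" using Suc.prems by (intro per) simp
    finally show ?case using Suc by simp
  qed auto
  show ?thesis
  proof (cases "k \<ge> 0")
    case True
    thus ?thesis using *[OF \<tau>, of "nat k"] by simp
  next
    case False
    have "Im (\<tau> + of_int k * of_nat h) > 0" using \<tau> by simp
    from *[OF this, of "nat (- k)"] show ?thesis using False by simp
  qed
qed

text \<open>\<open>V\<close> is \<open>f\<close> composed with a logarithm, and periodicity makes it
  independent of the branch. Near each point it can therefore be computed with a branch holomorphic
  there: \<open>Ln x\<close>, or \<open>Ln (- x)\<close> plus \<pi>i across the cut.\<close>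

lemma nome_factor:
  assumes f: "f holomorphic_on upper_half_plane" and h: "h > 0"
      and per: "\<And>\<tau>. Im \<tau> > 0 \<Longrightarrow> f (\<tau> + of_nat h) = f \<tau>"
  obtains V where "V holomorphic_on ball 0 1 - {0}" "\<And>\<tau>. Im \<tau> > 0 \<Longrightarrow> V (nome (\<tau> / of_nat h)) = f \<tau>"
proof -
  define V where "V x = f (of_nat h * (Ln x / (2 * of_real pi * \<i>)))" for x
  have V: "V (nome (\<tau> / of_nat h)) = f \<tau>" if \<tau>: "Im \<tau> > 0" for \<tau>
  proof -
    define b where "b = Ln (nome (\<tau> / of_nat h)) / (2 * of_real pi * \<i>)"
    have "nome b = nome (\<tau> / of_nat h)" unfolding nome_def[of b] by (simp add: b_def)
    then obtain k where k: "b - \<tau> / of_nat h = of_int k" using nome_eqD by (metis Ints_cases)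
    have "of_nat h * b = \<tau> + of_int k * of_nat h" using k h by (simp add: field_simps)
    thus ?thesis unfolding V_def b_def[symmetric] using periodic_of_int[of f h \<tau> k, OF per \<tau>] by simp
  qed
  have branch: "V field_differentiable at x0"
    if L: "L holomorphic_on S" and S: "open S" "S \<subseteq> ball 0 1" "x0 \<in> S" and nome_L: "\<And>x. x \<in> S \<Longrightarrow> nome (L x) = x" for L S x0
  proof -
    have Im: "Im (of_nat h * L x) > 0" if "x \<in> S" for x
    proof -
      have "norm (nome (L x)) < 1" using nome_L[OF that] that S by auto
      thus ?thesis using h by (simp add: norm_nome_less_1_iff)
    qed
    have "(f \<circ> (\<lambda>x. of_nat h * L x)) holomorphic_on S"
      by (rule holomorphic_on_compose_gen[OF _ f]) (use Im L in \<open>auto intro!: holomorphic_intros simp: upper_half_plane_def\<close>)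
    moreover have "(f \<circ> (\<lambda>x. of_nat h * L x)) x = V x" if "x \<in> S" for x
      using V[OF Im[OF that]] nome_L[OF that] h by simp
    ultimately have "V holomorphic_on S" by (rule holomorphic_transform)
    thus ?thesis using S by (intro holomorphic_on_imp_differentiable_at)
  qed
  have "V field_differentiable at x0" if x0: "x0 \<in> ball 0 1 - {0}" for x0
  proof (cases "x0 \<in> \<real>\<^sub>\<le>\<^sub>0")
    case False
    show ?thesis
    proof (rule branch[of "\<lambda>x. Ln x / (2 * of_real pi * \<i>)" "ball 0 1 \<inter> - \<real>\<^sub>\<le>\<^sub>0"])
      show "nome (Ln x / (2 * of_real pi * \<i>)) = x" if "x \<in> ball 0 1 \<inter> - \<real>\<^sub>\<le>\<^sub>0" for x
      proof -
        have "x \<noteq> 0" using that by auto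
        thus ?thesis by (simp add: nome_def)
      qed
    qed (use x0 False in \<open>auto intro!: holomorphic_intros open_Int\<close>)
  next
    case True
    have "- x0 \<notin> \<real>\<^sub>\<le>\<^sub>0"
    proof
      assume "- x0 \<in> \<real>\<^sub>\<le>\<^sub>0"
      with True have "x0 = 0" by (auto simp: complex_nonpos_Reals_iff complex_eq_iff)
      thus False using x0 by simp
    qed
    show ?thesis
    proof (rule branch[of "\<lambda>x. (Ln (- x) + of_real pi * \<i>) / (2 * of_real pi * \<i>)" "ball 0 1 \<inter> {x. - x \<notin> \<real>\<^sub>\<le>\<^sub>0}"])
      have "{x. - x \<notin> \<real>\<^sub>\<le>\<^sub>0} = uminus -` (- \<real>\<^sub>\<le>\<^sub>0 :: complex set)" by auto
      hence "open {x :: complex. - x \<notin> \<real>\<^sub>\<le>\<^sub>0}"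
        by (simp only:) (intro open_vimage continuous_intros, auto)
      thus "open (ball 0 1 \<inter> {x :: complex. - x \<notin> \<real>\<^sub>\<le>\<^sub>0})" by auto
      show "nome ((Ln (- x) + of_real pi * \<i>) / (2 * of_real pi * \<i>)) = x" if "x \<in> ball 0 1 \<inter> {x. - x \<notin> \<real>\<^sub>\<le>\<^sub>0}" for x
      proof -
        have "- x \<noteq> 0" using that by auto
        thus ?thesis by (simp add: nome_def exp_add)
      qed
    qed (use x0 \<open>- x0 \<notin> \<real>\<^sub>\<le>\<^sub>0\<close> in \<open>auto intro!: holomorphic_intros\<close>)
  qed
  hence "V holomorphic_on ball 0 1 - {0}"
    by (auto simp: holomorphic_on_def intro: field_differentiable_at_within)
  thus ?thesis using that V by blast
qed

text \<open>The limit makes the singularity of the factored function at 0 removable, with value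
  \<open>L\<close>.\<close>

lemma cusp_function:
  assumes f: "f holomorphic_on upper_half_plane" and h: "h > 0"
      and per: "\<And>\<tau>. Im \<tau> > 0 \<Longrightarrow> f (\<tau> + of_nat h) = f \<tau>"
      and lim: "((\<lambda>\<tau>. f \<tau> * nome (\<tau> / of_nat h) ^ m) \<longlongrightarrow> L) at_i_infinity"
  obtains V where "V holomorphic_on ball 0 1" "V 0 = L"
     "\<And>\<tau>. Im \<tau> > 0 \<Longrightarrow> f \<tau> * nome (\<tau> / of_nat h) ^ m = V (nome (\<tau> / of_nat h))"
proof -
  have "(\<lambda>\<tau>. f \<tau> * nome (\<tau> / of_nat h) ^ m) holomorphic_on upper_half_plane"
    using h by (intro holomorphic_intros f) auto
  moreover have "f (\<tau> + of_nat h) * nome ((\<tau> + of_nat h) / of_nat h) ^ m = f \<tau> * nome (\<tau> / of_nat h) ^ m" if "Im \<tau> > 0" for \<tau>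
    using h per[OF that] by (simp add: add_divide_distrib nome_add)
  ultimately obtain V where V: "V holomorphic_on ball 0 1 - {0}"
     "\<And>\<tau>. Im \<tau> > 0 \<Longrightarrow> V (nome (\<tau> / of_nat h)) = f \<tau> * nome (\<tau> / of_nat h) ^ m"
    using nome_factor[OF _ h, of "\<lambda>\<tau>. f \<tau> * nome (\<tau> / of_nat h) ^ m"] by blast
  have "(V \<longlongrightarrow> L) (at 0)" by (rule tendsto_at_cusp[OF h lim V(2)])
  moreover define V' where "V' x = (if x = 0 then L else V x)" for x
  have "eventually (\<lambda>x. V x = V' x) (at 0)" by (auto simp: V'_def eventually_at_filter)
  ultimately have lim': "(V' \<longlongrightarrow> V' 0) (at 0)" unfolding V'_def[of 0] by (simp add: Lim_transform_eventually)
  have "V' holomorphic_on ball 0 1"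
  proof (rule no_isolated_singularity'[of "{0}"])
    show "V' holomorphic_on ball 0 1 - {0}" by (rule holomorphic_transform[OF V(1)]) (auto simp: V'_def)
    show "(V' \<longlongrightarrow> V' z) (at z within ball 0 1)" if "z \<in> {0}" for z
      using that lim' by (auto simp: at_within_open[of "0::complex" "ball 0 1"])
  qed auto
  moreover have "f \<tau> * nome (\<tau> / of_nat h) ^ m = V' (nome (\<tau> / of_nat h))" if "Im \<tau> > 0" for \<tau>
    using V(2)[OF that] by (simp add: V'_def)
  ultimately show ?thesis using that[of V'] by (simp add: V'_def)
qed

lemma tendsto_i_infinity:
  assumes V: "V holomorphic_on ball 0 1" and h: "h > 0"
  shows "((\<lambda>\<tau>. V (nome (\<tau> / of_nat h))) \<longlongrightarrow> V 0) at_i_infinity"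
proof -
  have "isCont V 0" using holomorphic_on_imp_continuous_on[OF V] by (auto simp: continuous_on_eq_continuous_at)
  moreover have "((\<lambda>\<tau>. nome (of_real (1 / real h) * \<tau> + 0)) \<longlongrightarrow> 0) at_i_infinity"
    by (rule nome_tendsto_0) (use h in simp)
  ultimately have "((\<lambda>\<tau>. V (nome (of_real (1 / real h) * \<tau> + 0))) \<longlongrightarrow> V 0) at_i_infinity"
    by (rule isCont_tendsto_compose)
  thus ?thesis by simp
qed

text \<open>Invariance under generators of \<open>Gamma0 2\<close> up to sign: the unit translation,
  and the shear that inversion conjugates to \<sigma> -> \<sigma> + 2. The latter reflects the width
  2 of the cusp 0.\<close>

locale gamma0_2_function =
  fixes f :: "complex \<Rightarrow> complex"
  assumes T_invariant: "Im \<tau> > 0 \<Longrightarrow> f (\<tau> + 1) = f \<tau>"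
      and ST2S_invariant: "Im \<sigma> > 0 \<Longrightarrow> f (- 1 / (\<sigma> + 2)) = f (- 1 / \<sigma>)"
begin

lemma T_invariant_int: "Im \<tau> > 0 \<Longrightarrow> f (\<tau> + of_int k) = f \<tau>"
  using periodic_of_int[of f 1 \<tau> k] T_invariant by simp

lemma ST2S_invariant_int: "Im \<sigma> > 0 \<Longrightarrow> f (- 1 / (\<sigma> + 2 * of_int k)) = f (- 1 / \<sigma>)"
  using periodic_of_int[of "\<lambda>\<sigma>. f (- 1 / \<sigma>)" 2 \<sigma> k] ST2S_invariant by (simp add: mult.commute)

text \<open>In the coordinate \<sigma> = -1/\<tau> the shear is \<sigma> -> \<sigma> - 2 k.\<close>

lemma shear_invariant:
  assumes \<tau>: "Im \<tau> > 0"
  shows "f (\<tau> / (2 * of_int k * \<tau> + 1)) = f \<tau>" "Im (\<tau> / (2 * of_int k * \<tau> + 1)) > 0" "2 * of_int k * \<tau> + 1 \<noteq> 0"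
proof -
  have \<tau>0: "\<tau> \<noteq> 0" using \<tau> by auto
  define \<sigma> where "\<sigma> = - 1 / \<tau>"
  have \<sigma>: "Im \<sigma> > 0" unfolding \<sigma>_def by (rule Im_minus_inverse_pos[OF \<tau>])
  have \<sigma>': "Im (\<sigma> + 2 * of_int (- k)) > 0" using \<sigma> by simp
  hence ne: "\<sigma> + 2 * of_int (- k) \<noteq> 0" by force
  have e: "\<sigma> + 2 * of_int (- k) = - (2 * of_int k * \<tau> + 1) / \<tau>" using \<tau>0 by (simp add: \<sigma>_def field_simps)
  show nz: "2 * of_int k * \<tau> + 1 \<noteq> 0"
  proof
    assume "2 * of_int k * \<tau> + 1 = 0"
    with e have "\<sigma> + 2 * of_int (- k) = 0" by (simp only: minus_zero div_0)
    thus False using ne by contradiction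
  qed
  have eq: "- 1 / (\<sigma> + 2 * of_int (- k)) = \<tau> / (2 * of_int k * \<tau> + 1)"
  proof -
    have "- 1 / (- w / t) = t / w" for w t :: complex by simp
    thus ?thesis unfolding e .
  qed
  show "f (\<tau> / (2 * of_int k * \<tau> + 1)) = f \<tau>"
    using ST2S_invariant_int[OF \<sigma>, of "- k"] unfolding eq by (simp add: \<sigma>_def)
  show "Im (\<tau> / (2 * of_int k * \<tau> + 1)) > 0" using Im_minus_inverse_pos[OF \<sigma>'] unfolding eq .
qed

text \<open>Euclidean descent on |c| + |d|. As c is even and d odd, |c| and |d| differ. If |c| is
  the smaller and nonzero, a translation lowers |d|; otherwise a shear replaces |c| by ||c| - 2
  |d||, which is smaller.\<close>

lemma moebius_invariant:
  fixes a b c d :: int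
  assumes "a * d - b * c = 1" "even c" "Im \<tau> > 0"
  shows "f ((of_int a * \<tau> + of_int b) / (of_int c * \<tau> + of_int d)) = f \<tau>"
  using assms
proof (induction "nat (\<bar>c\<bar> + \<bar>d\<bar>)" arbitrary: a b c d \<tau> rule: less_induct)
  case less
  have odd_d: "odd d"
  proof
    assume "even d"
    hence "even (a * d - b * c)" using less.prems(2) by simp
    thus False unfolding less.prems(1) by simp
  qed
  show ?case
  proof (cases "c = 0")
    case True
    hence "a * d = 1" using less.prems by simp
    hence "(a = 1 \<and> d = 1) \<or> (a = -1 \<and> d = -1)" by (rule zmult_eq_1_iff[THEN iffD1])
    thus ?thesis
    proof
      assume "a = 1 \<and> d = 1"
      thus ?thesis using True T_invariant_int[OF less.prems(3), of b] by simp
    next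
      assume *: "a = -1 \<and> d = -1"
      hence "(of_int a * \<tau> + of_int b) / (of_int c * \<tau> + of_int d) = \<tau> + of_int (- b)" using True by simp
      thus ?thesis using T_invariant_int[OF less.prems(3), of "- b"] by (simp only:)
    qed
  next
    case False
    \<comment> \<open>With this sign, subtracting s c from d, or 2 s d from c, acts as a subtraction
      of absolute values.\<close>
    define s where "s = sgn c * sgn d"
    have d0: "d \<noteq> 0" using odd_d by auto
    have s: "s * c = sgn d * \<bar>c\<bar>" "s * d = sgn c * \<bar>d\<bar>"
      by (simp_all add: s_def abs_sgn mult_ac)
    have ne: "\<bar>c\<bar> \<noteq> \<bar>d\<bar>" using less.prems(2) odd_d by (metis dvd_abs_iff)
    show ?thesis
    proof (cases "\<bar>c\<bar> < \<bar>d\<bar>")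
      case True
      define b' d' where "b' = b - s * a" and "d' = d - s * c"
      have "d' = sgn d * (\<bar>d\<bar> - \<bar>c\<bar>)" unfolding d'_def s(1) by (simp add: right_diff_distrib sgn_mult_abs)
      hence "\<bar>d'\<bar> = \<bar>d\<bar> - \<bar>c\<bar>" using d0 True by (simp add: abs_mult)
      hence small: "nat (\<bar>c\<bar> + \<bar>d'\<bar>) < nat (\<bar>c\<bar> + \<bar>d\<bar>)" using False by simp
      have det: "a * d' - b' * c = 1" unfolding b'_def d'_def using less.prems(1) by (simp add: algebra_simps)
      have "Im (\<tau> + of_int s) > 0" using less.prems by simp
      from less.hyps[OF small det less.prems(2) this]
      have "f ((of_int a * (\<tau> + of_int s) + of_int b') / (of_int c * (\<tau> + of_int s) + of_int d')) = f (\<tau> + of_int s)" .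
      also have "of_int a * (\<tau> + of_int s) + of_int b' = of_int a * \<tau> + of_int b" by (simp add: b'_def algebra_simps)
      also have "of_int c * (\<tau> + of_int s) + of_int d' = of_int c * \<tau> + of_int d" by (simp add: d'_def algebra_simps)
      finally show ?thesis using T_invariant_int[OF less.prems(3), of s] by simp
    next
      case False2: False
      define a' c' where "a' = a - 2 * s * b" and "c' = c - 2 * s * d"
      have "c' = sgn c * (\<bar>c\<bar> - 2 * \<bar>d\<bar>)" unfolding c'_def using s(2) by (simp add: right_diff_distrib sgn_mult_abs mult.assoc)
      hence "\<bar>c'\<bar> = \<bar>\<bar>c\<bar> - 2 * \<bar>d\<bar>\<bar>" using False by (simp add: abs_mult)
      moreover have "\<bar>d\<bar> < \<bar>c\<bar>" "0 < \<bar>d\<bar>" using False2 ne d0 by auto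
      ultimately have "\<bar>c'\<bar> < \<bar>c\<bar>" by (simp only: abs_less_iff[of "\<bar>c\<bar> - 2 * \<bar>d\<bar>"]) simp
      hence small: "nat (\<bar>c'\<bar> + \<bar>d\<bar>) < nat (\<bar>c\<bar> + \<bar>d\<bar>)" by (subst nat_less_eq_zless) auto
      have det: "a' * d - b * c' = 1" unfolding a'_def c'_def using less.prems(1) by (simp add: algebra_simps)
      have ev: "even c'" using less.prems(2) by (simp add: c'_def)
      define \<tau>' where "\<tau>' = \<tau> / (2 * of_int s * \<tau> + 1)"
      note sh = shear_invariant[OF less.prems(3), of s, folded \<tau>'_def]
      have "f ((of_int a' * \<tau>' + of_int b) / (of_int c' * \<tau>' + of_int d)) = f \<tau>'"
        by (rule less.hyps[OF small det ev sh(2)])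
      also have "(of_int a' * \<tau>' + of_int b) / (of_int c' * \<tau>' + of_int d) = (of_int a * \<tau> + of_int b) / (of_int c * \<tau> + of_int d)"
      proof -
        define w where "w = 2 * of_int s * \<tau> + 1"
        have w: "w \<noteq> 0" using sh(3) by (simp add: w_def)
        have "(of_int a' * \<tau>' + of_int b) = (of_int a * \<tau> + of_int b) / w"
        proof -
          have "of_int a' * (\<tau> / w) + of_int b = (of_int a' * \<tau> + of_int b * w) / w" using w by (simp add: add_divide_distrib)
          also have "of_int a' * \<tau> + of_int b * w = of_int a * \<tau> + of_int b" by (simp add: w_def a'_def algebra_simps)
          finally show ?thesis unfolding \<tau>'_def w_def[symmetric] .
        qed
        moreover have "(of_int c' * \<tau>' + of_int d) = (of_int c * \<tau> + of_int d) / w"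
        proof -
          have "of_int c' * (\<tau> / w) + of_int d = (of_int c' * \<tau> + of_int d * w) / w" using w by (simp add: add_divide_distrib)
          also have "of_int c' * \<tau> + of_int d * w = of_int c * \<tau> + of_int d" by (simp add: w_def c'_def algebra_simps)
          finally show ?thesis unfolding \<tau>'_def w_def[symmetric] .
        qed
        ultimately show ?thesis using w by simp
      qed
      finally show ?thesis using sh(1) by simp
    qed
  qed
qed

text \<open>\<open>SL2Z\<close> consists of three cosets of \<open>Gamma0 2\<close>, told apart by
  the parities of the bottom row and represented by 1, S and ST.\<close>

lemma moebius_cases:
  fixes a b c d :: int
  assumes det: "a * d - b * c = 1" and \<tau>: "Im \<tau> > 0"
  shows "f ((of_int a * \<tau> + of_int b) / (of_int c * \<tau> + of_int d)) =
           (if even c then f \<tau> else if even d then f (- 1 / \<tau>) else f (- 1 / (\<tau> + 1)))"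
proof -
  have swap: "f ((of_int a * \<tau> + of_int b) / (of_int c * \<tau> + of_int d)) = f (- 1 / \<tau>)"
    if "a * d - b * c = 1" "even d" "Im \<tau> > 0" for a b c d :: int and \<tau>
  proof -
    have \<tau>0: "\<tau> \<noteq> 0" using that by auto
    have "f ((of_int (- b) * (- 1 / \<tau>) + of_int a) / (of_int (- d) * (- 1 / \<tau>) + of_int c)) = f (- 1 / \<tau>)"
      by (rule moebius_invariant) (use that Im_minus_inverse_pos in \<open>auto simp: algebra_simps\<close>)
    moreover have "of_int (- b) * (- 1 / \<tau>) + of_int a = (of_int a * \<tau> + of_int b) / \<tau>"
       "of_int (- d) * (- 1 / \<tau>) + of_int c = (of_int c * \<tau> + of_int d) / \<tau>"
      using \<tau>0 by (simp_all add: field_simps)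
    ultimately show ?thesis using \<tau>0 by simp
  qed
  consider "even c" | "odd c" "even d" | "odd c" "odd d" by blast
  thus ?thesis
  proof cases
    case 1
    thus ?thesis using moebius_invariant[OF det _ \<tau>] by simp
  next
    case 2
    thus ?thesis using swap[OF det _ \<tau>] by simp
  next
    case 3
    have "f ((of_int a * (\<tau> + 1) + of_int (b - a)) / (of_int c * (\<tau> + 1) + of_int (d - c))) = f (- 1 / (\<tau> + 1))"
      by (rule swap) (use 3 det \<tau> in \<open>auto simp: algebra_simps\<close>)
    thus ?thesis using 3 by (simp add: algebra_simps)
  qed
qed

end

text \<open>If \<open>\<bar>Re \<tau>\<bar> \<le> 1/2\<close> and \<open>Im \<tau> < 1/2\<close>, then inversion at least doubles the imaginary part.\<close>

lemma fundamental_domain_reduction: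
  fixes Q :: "complex \<Rightarrow> 'a"
  assumes T: "\<And>\<tau>. Im \<tau> > 0 \<Longrightarrow> Q (\<tau> + 1) = Q \<tau>" and S: "\<And>\<tau>. Im \<tau> > 0 \<Longrightarrow> Q (- 1 / \<tau>) = Q \<tau>"
      and \<tau>: "Im \<tau> > 0"
  shows "\<exists>\<tau>'. \<bar>Re \<tau>'\<bar> \<le> 1 / 2 \<and> Im \<tau>' \<ge> 1 / 2 \<and> Q \<tau>' = Q \<tau>"
proof -
  have shift: "\<exists>\<tau>'. \<bar>Re \<tau>'\<bar> \<le> 1 / 2 \<and> Im \<tau>' = Im \<tau> \<and> Q \<tau>' = Q \<tau>" if \<tau>: "Im \<tau> > 0" for \<tau>
  proof (intro exI conjI)
    define k where "k = - round (Re \<tau>)"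
    show "\<bar>Re (\<tau> + of_int k)\<bar> \<le> 1 / 2" using of_int_round_abs_le[of "Re \<tau>"] by (simp add: k_def abs_minus_commute)
    show "Q (\<tau> + of_int k) = Q \<tau>" using periodic_of_int[of Q 1 \<tau> k] T \<tau> by simp
  qed auto
  \<comment> \<open>Induction on a number of doublings that brings the imaginary part up to
    1/2.\<close>
  have main: "\<exists>\<tau>'. \<bar>Re \<tau>'\<bar> \<le> 1 / 2 \<and> Im \<tau>' \<ge> 1 / 2 \<and> Q \<tau>' = Q \<tau>" if "Im \<tau> > 0" "Im \<tau> * 2 ^ n \<ge> 1 / 2" for n \<tau>
    using that
  proof (induction n arbitrary: \<tau>)
    case 0
    thus ?case using shift[of \<tau>] by auto
  next
    case (Suc n)
    obtain \<tau>' where \<tau>': "\<bar>Re \<tau>'\<bar> \<le> 1 / 2" "Im \<tau>' = Im \<tau>" "Q \<tau>' = Q \<tau>" using shift Suc.prems by blast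
    show ?case
    proof (cases "Im \<tau>' \<ge> 1 / 2")
      case True
      thus ?thesis using \<tau>' by auto
    next
      case False
      have pos: "Im \<tau>' > 0" using \<tau>' Suc.prems by simp
      have "Re \<tau>' ^ 2 \<le> (1 / 2) ^ 2" using \<tau>'(1) by (subst abs_le_square_iff[symmetric]) auto
      moreover have "Im \<tau>' ^ 2 \<le> (1 / 2) ^ 2" using False pos by (intro power_mono) auto
      ultimately have n: "Re \<tau>' ^ 2 + Im \<tau>' ^ 2 \<le> 1 / 2" by (simp add: power_divide)
      have n0: "Re \<tau>' ^ 2 + Im \<tau>' ^ 2 > 0" using pos by (intro add_nonneg_pos) auto
      have "Im (- 1 / \<tau>') = Im \<tau>' / (Re \<tau>' ^ 2 + Im \<tau>' ^ 2)" by (simp add: Im_divide)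
      also have "\<dots> \<ge> 2 * Im \<tau>'"
      proof (subst pos_le_divide_eq[OF n0])
        have "2 * Im \<tau>' * (Re \<tau>' ^ 2 + Im \<tau>' ^ 2) \<le> 2 * Im \<tau>' * (1 / 2)" using n pos by (intro mult_left_mono) auto
        thus "2 * Im \<tau>' * (Re \<tau>' ^ 2 + Im \<tau>' ^ 2) \<le> Im \<tau>'" by simp
      qed
      finally have big: "2 * Im \<tau>' \<le> Im (- 1 / \<tau>')" .
      have "1 / 2 \<le> (2 * Im \<tau>') * 2 ^ n" using Suc.prems \<tau>' by (simp add: mult_ac)
      also have "\<dots> \<le> Im (- 1 / \<tau>') * 2 ^ n" using big by (intro mult_right_mono) auto
      finally have "1 / 2 \<le> Im (- 1 / \<tau>') * 2 ^ n" .
      from Suc.IH[OF Im_minus_inverse_pos[OF pos] this] show ?thesis using S[OF pos] \<tau>' by auto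
    qed
  qed
  obtain n where "1 / (2 * Im \<tau>) < 2 ^ n" using real_arch_pow[of 2 "1 / (2 * Im \<tau>)"] by auto
  hence "1 / 2 \<le> Im \<tau> * 2 ^ n" using \<tau> by (simp add: field_simps)
  thus ?thesis by (rule main[OF \<tau>])
qed

text \<open>Near i infinity |P| is below |P \<tau>|, so by reduction all values at least that large
  occur on a compact box. Hence |P| attains a maximum, \<open>P\<close> is constant by the maximum
  principle, and this contradicts the smaller values near i infinity.\<close>

lemma invariant_vanishing_imp_zero:
  fixes P :: "complex \<Rightarrow> complex"
  assumes hol: "P holomorphic_on upper_half_plane"
      and T: "\<And>\<tau>. Im \<tau> > 0 \<Longrightarrow> P (\<tau> + 1) = P \<tau>" and S: "\<And>\<tau>. Im \<tau> > 0 \<Longrightarrow> P (- 1 / \<tau>) = P \<tau>"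
      and lim: "(P \<longlongrightarrow> 0) at_i_infinity" and \<tau>: "Im \<tau> > 0"
  shows "P \<tau> = 0"
proof (rule ccontr)
  assume nz: "P \<tau> \<noteq> 0"
  hence "eventually (\<lambda>z. dist (P z) 0 < norm (P \<tau>)) at_i_infinity" using lim by (simp add: tendsto_iff)
  then obtain Y where Y: "\<And>z. Im z \<ge> Y \<Longrightarrow> norm (P z) < norm (P \<tau>)"
    by (auto simp: eventually_filtercomap eventually_at_top_linorder)
  define D where "D = cbox (Complex (- 1 / 2) (1 / 2)) (Complex (1 / 2) (max Y 1))"
  have D: "z \<in> D \<longleftrightarrow> \<bar>Re z\<bar> \<le> 1 / 2 \<and> 1 / 2 \<le> Im z \<and> Im z \<le> max Y 1" for z
    by (auto simp: D_def in_cbox_complex_iff)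
  have DH: "D \<subseteq> upper_half_plane" by (auto simp: D upper_half_plane_def)
  have red: "\<exists>z'\<in>D. P z' = P z" if z: "Im z > 0" "norm (P z) \<ge> norm (P \<tau>)" for z
  proof -
    obtain z' where z': "\<bar>Re z'\<bar> \<le> 1 / 2" "Im z' \<ge> 1 / 2" "P z' = P z"
      using fundamental_domain_reduction[of P, OF T S z(1)] by blast
    have "Im z' < Y" using Y[of z'] z z' by force
    thus ?thesis using z' by (intro bexI[of _ z']) (auto simp: D)
  qed
  have "continuous_on D (\<lambda>z. norm (P z))"
    by (intro continuous_intros holomorphic_on_imp_continuous_on holomorphic_on_subset[OF hol DH])
  moreover have "compact D" by (simp add: D_def)
  moreover obtain z0 where z0: "z0 \<in> D" "P z0 = P \<tau>" using red[OF \<tau>] by auto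
  ultimately obtain \<xi> where \<xi>: "\<xi> \<in> D" "\<And>z. z \<in> D \<Longrightarrow> norm (P z) \<le> norm (P \<xi>)"
    using continuous_attains_sup[of D "\<lambda>z. norm (P z)"] by blast
  have max: "norm (P z) \<le> norm (P \<xi>)" if "z \<in> upper_half_plane" for z
  proof (cases "norm (P z) \<ge> norm (P \<tau>)")
    case True
    have "Im z > 0" using that by (simp add: upper_half_plane_def)
    then obtain z' where "z' \<in> D" "P z' = P z" using red[OF _ True] by blast
    thus ?thesis using \<xi>(2)[of z'] by simp
  next
    case False
    thus ?thesis using \<xi>(2)[OF z0(1)] z0(2) by simp
  qed
  have "P constant_on upper_half_plane"
    by (rule maximum_modulus_principle[OF hol open_upper_half_plane convex_connected[OF convex_upper_half_plane] open_upper_half_plane subset_refl _ max])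
       (use \<xi> DH in auto)
  then obtain c where c: "\<And>z. z \<in> upper_half_plane \<Longrightarrow> P z = c" by (auto simp: constant_on_def)
  have "norm (P (Complex 0 (max Y 1))) < norm (P \<tau>)" by (rule Y) simp
  moreover have "P (Complex 0 (max Y 1)) = P \<tau>" using c[of \<tau>] c[of "Complex 0 (max Y 1)"] \<tau> by (simp add: upper_half_plane_def)
  ultimately show False by simp
qed

lemma holomorphic_prod_zero:
  assumes f: "f holomorphic_on S" and g: "g holomorphic_on S" and S: "open S" "connected S"
      and zero: "\<And>z. z \<in> S \<Longrightarrow> f z * g z = 0" and nz: "z0 \<in> S" "f z0 \<noteq> 0" and z: "z \<in> S"
  shows "g z = 0"
proof -
  have "continuous_on S f" by (rule holomorphic_on_imp_continuous_on[OF f])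
  hence "open (S \<inter> f -` (- {0}))" by (rule continuous_open_preimage) (use S in auto)
  moreover have "z0 \<in> S \<inter> f -` (- {0})" using nz by auto
  ultimately show ?thesis
    using analytic_continuation_open[of "S \<inter> f -` (- {0})" S g "\<lambda>_. 0" z] S g z zero by auto
qed

text \<open>The product of \<open>f - c\<close> with its conjugates over the three cosets of \<open>Gamma0 2\<close> is a level 1
  function vanishing at the cusp.\<close>

lemma (in gamma0_2_function) bounded_imp_constant:
  assumes hol: "f holomorphic_on upper_half_plane"
      and lim: "(f \<longlongrightarrow> c) at_i_infinity" and lim0: "((\<lambda>\<sigma>. f (- 1 / \<sigma>)) \<longlongrightarrow> d) at_i_infinity"
      and \<tau>: "Im \<tau> > 0"
  shows "f \<tau> = c"
proof (rule ccontr)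
  assume nz: "f \<tau> \<noteq> c"
  let ?H = "upper_half_plane"
  define f1 f2 f3 where "f1 z = f z - c" and "f2 z = f (- 1 / z) - c" and "f3 z = f (- 1 / (z + 1)) - c" for z
  define P where "P z = f1 z * (f2 z * f3 z)" for z
  have nz0: "z \<noteq> 0" if "Im z > 0" for z using that by auto
  have h1: "f1 holomorphic_on ?H" unfolding f1_def[abs_def] by (intro holomorphic_intros hol)
  have "(f \<circ> (\<lambda>z. - 1 / z)) holomorphic_on ?H"
    by (rule holomorphic_on_compose_gen[OF _ hol])
       (use Im_minus_inverse_pos in \<open>auto intro!: holomorphic_intros simp: upper_half_plane_def\<close>)
  hence h2: "f2 holomorphic_on ?H" unfolding f2_def[abs_def] by (intro holomorphic_on_diff) (simp_all add: o_def)
  have "(f \<circ> (\<lambda>z. - 1 / (z + 1))) holomorphic_on ?H"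
  proof (rule holomorphic_on_compose_gen[OF _ hol])
    have "z + 1 \<noteq> 0" if "z \<in> ?H" for z using nz0[of "z + 1"] that by (auto simp: upper_half_plane_def)
    thus "(\<lambda>z. - 1 / (z + 1)) holomorphic_on ?H" by (intro holomorphic_intros) auto
    show "(\<lambda>z. - 1 / (z + 1)) ` ?H \<subseteq> ?H"
      using Im_minus_inverse_pos[of "z + 1" for z] by (auto simp: upper_half_plane_def)
  qed
  hence h3: "f3 holomorphic_on ?H" unfolding f3_def[abs_def] by (intro holomorphic_on_diff) (simp_all add: o_def)
  have P0: "P z = 0" if "Im z > 0" for z
  proof (rule invariant_vanishing_imp_zero[OF _ _ _ _ that])
    show "P holomorphic_on ?H" unfolding P_def[abs_def] by (intro holomorphic_on_mult h1 h2 h3)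
    fix z assume z: "Im z > 0"
    \<comment> \<open>Translation exchanges \<open>f2\<close> and \<open>f3\<close>; inversion
      exchanges \<open>f1\<close> and \<open>f2\<close> and fixes \<open>f3\<close>.\<close>
    have "f3 (z + 1) = f2 z" using ST2S_invariant[OF z] by (simp add: f2_def f3_def add.assoc)
    moreover have "f2 (z + 1) = f3 z" by (simp add: f2_def f3_def)
    ultimately show "P (z + 1) = P z" using T_invariant[OF z] by (simp add: P_def f1_def mult_ac)
    have "f1 (- 1 / z) = f2 z" by (simp add: f1_def f2_def)
    moreover have "f2 (- 1 / z) = f1 z" by (simp add: f1_def f2_def)
    moreover have "f3 (- 1 / z) = f3 z"
    proof -
      have "Im (z - 1) > 0" using z by simp
      hence z1: "z - 1 \<noteq> 0" "Im (- 1 / (z - 1)) > 0" using Im_minus_inverse_pos nz0 by blast+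
      have "- 1 / (- 1 / z + 1) = - 1 / (z - 1) + of_int (- 1)"
        using z1 nz0[OF z] by (simp add: field_simps)
      hence "f (- 1 / (- 1 / z + 1)) = f (- 1 / (z - 1))" using T_invariant_int[OF z1(2), of "- 1"] by simp
      also have "\<dots> = f (- 1 / (z - 1 + 2))" using ST2S_invariant[OF \<open>Im (z - 1) > 0\<close>] by simp
      also have "z - 1 + 2 = z + 1" by simp
      finally show ?thesis by (simp only: f3_def)
    qed
    ultimately show "P (- 1 / z) = P z" by (simp add: P_def mult_ac)
  next
    have "filterlim (\<lambda>z. z + 1) at_i_infinity at_i_infinity"
      by (simp add: filterlim_filtercomap_iff o_def filterlim_filtercomap)
    hence "((\<lambda>z. f (- 1 / (z + 1))) \<longlongrightarrow> d) at_i_infinity" by (rule filterlim_compose[OF lim0])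
    hence "((\<lambda>z. (f z - c) * ((f (- 1 / z) - c) * (f (- 1 / (z + 1)) - c))) \<longlongrightarrow> (c - c) * ((d - c) * (d - c))) at_i_infinity"
      by (intro tendsto_intros lim lim0)
    thus "(P \<longlongrightarrow> 0) at_i_infinity" by (simp add: P_def[abs_def] f1_def f2_def f3_def)
  qed
  note con = open_upper_half_plane convex_connected[OF convex_upper_half_plane]
  \<comment> \<open>Neither \<open>f1\<close> nor \<open>f2\<close> vanishes identically, so both
    cancel from the zero product and \<open>f3\<close> is 0; yet at -1/\<tau> - 1 it takes the value
    f \<tau> - c.\<close>
  have "f1 \<tau> \<noteq> 0" using nz by (simp add: f1_def)
  have f23: "f2 z * f3 z = 0" if "z \<in> ?H" for z
    by (rule holomorphic_prod_zero[of f1 ?H "\<lambda>z. f2 z * f3 z" \<tau>])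
       (use P0 \<tau> \<open>f1 \<tau> \<noteq> 0\<close> h1 h2 h3 con that in \<open>auto simp: P_def upper_half_plane_def intro!: holomorphic_on_mult\<close>)
  have \<sigma>: "Im (- 1 / \<tau>) > 0" by (rule Im_minus_inverse_pos[OF \<tau>])
  have "f2 (- 1 / \<tau>) \<noteq> 0" using nz by (simp add: f2_def)
  hence f3: "f3 z = 0" if "z \<in> ?H" for z
    using holomorphic_prod_zero[OF h2 h3 con f23 _ _ that, of "- 1 / \<tau>"] \<sigma> by (simp add: upper_half_plane_def)
  have "Im (- 1 / \<tau> - 1) > 0" using \<sigma> by simp
  hence "f3 (- 1 / \<tau> - 1) = 0" by (intro f3) (simp add: upper_half_plane_def)
  thus False using nz by (simp add: f3_def)
qed

section \<open>Polynomials in the Hauptmodul\<close>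

definition Phi2_infinity :: "complex \<Rightarrow> complex" where
  "Phi2_infinity q = q * (euler_prod (q ^ 2) / euler_prod q) ^ 24"

text \<open>The expansion at the cusp 0 in x = \<open>nome (\<sigma> / 2)\<close>, multiplied by
  \<open>x\<close> to remove the simple pole; 2^12 is the 24th power of the square root of
  2.\<close>

definition Phi2_zero :: "complex \<Rightarrow> complex" where
  "Phi2_zero x = 1 / 2 ^ 12 * (euler_prod x / euler_prod (x ^ 2)) ^ 24"

lemma euler_prod_square_holomorphic: "(\<lambda>q. euler_prod (q ^ 2)) holomorphic_on ball 0 1"
proof -
  have "(euler_prod \<circ> (\<lambda>q. q^2)) holomorphic_on ball 0 1"
    by (rule holomorphic_on_compose_gen[OF _ euler_prod_holomorphic])
       (auto intro!: holomorphic_intros simp: norm_power power_less_one_iff)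
  thus ?thesis by (simp add: o_def)
qed

lemma euler_prod_square_nonzero: "norm q < 1 \<Longrightarrow> euler_prod (q ^ 2) \<noteq> 0"
  by (rule euler_prod_nonzero) (simp add: norm_power power_less_one_iff)

lemma Phi2_infinity_holomorphic: "Phi2_infinity holomorphic_on ball 0 1"
  unfolding Phi2_infinity_def[abs_def]
  by (intro holomorphic_intros euler_prod_holomorphic euler_prod_square_holomorphic) (auto simp: euler_prod_nonzero)

lemma Phi2_zero_holomorphic: "Phi2_zero holomorphic_on ball 0 1"
  unfolding Phi2_zero_def[abs_def]
  by (intro holomorphic_intros euler_prod_holomorphic euler_prod_square_holomorphic) (auto simp: euler_prod_square_nonzero)

lemma Phi2_eq: "Phi2 \<tau> = Phi2_infinity (nome \<tau>)"
proof -
  have "nome (\<tau> / 24) * nome (\<tau> / 24) = nome (2 * \<tau> / 24)" unfolding nome_add[symmetric] by simp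
  hence 1: "nome (2 * \<tau> / 24) / nome (\<tau> / 24) = nome (\<tau> / 24)" by (simp add: field_simps)
  have 2: "nome (2 * \<tau>) = nome \<tau> ^ 2" by (simp add: nome_power)
  have 3: "nome (\<tau> / 24) ^ 24 = nome \<tau>" by (simp add: nome_power)
  have "Phi2 \<tau> = (nome (2 * \<tau> / 24) / nome (\<tau> / 24) * (euler_prod (nome \<tau> ^ 2) / euler_prod (nome \<tau>))) ^ 24"
    unfolding Phi2_def eta_eq 2 by simp
  thus ?thesis unfolding 1 power_mult_distrib 3 Phi2_infinity_def .
qed

text \<open>The factors of automorphy at \<sigma>/2 and \<sigma> differ by the root of 2 from
  \<open>eta_factor_double\<close>, and the leading power \<open>nome (- \<sigma> / 48) ^ 24\<close>
  is the inverse of \<open>nome (\<sigma> / 2)\<close>.\<close>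

lemma Phi2_inversion:
  assumes \<sigma>: "Im \<sigma> > 0"
  shows "Phi2 (- 1 / \<sigma>) * nome (\<sigma> / 2) = Phi2_zero (nome (\<sigma> / 2))"
proof -
  have \<sigma>2: "Im (\<sigma> / 2) > 0" using \<sigma> by simp
  have "eta_factor (\<sigma> / 2) = of_real (sqrt 2) * eta_factor \<sigma>" using eta_factor_double[OF \<sigma>2] by simp
  moreover have "eta (2 * (- 1 / \<sigma>)) = eta (\<sigma> / 2) / eta_factor (\<sigma> / 2)"
    using eta_nonzero[OF \<sigma>2] eta_nonzero[OF Im_minus_inverse_pos[OF \<sigma>2]] by (simp add: eta_factor_def field_simps)
  moreover have "eta (- 1 / \<sigma>) = eta \<sigma> / eta_factor \<sigma>"
    using eta_nonzero[OF \<sigma>] eta_nonzero[OF Im_minus_inverse_pos[OF \<sigma>]] by (simp add: eta_factor_def field_simps)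
  ultimately have "eta (2 * (- 1 / \<sigma>)) / eta (- 1 / \<sigma>) = 1 / of_real (sqrt 2) * (eta (\<sigma> / 2) / eta \<sigma>)"
    using eta_factor_nonzero[OF \<sigma>] by simp
  also have "eta (\<sigma> / 2) / eta \<sigma> = nome (- \<sigma> / 48) * (euler_prod (nome (\<sigma> / 2)) / euler_prod (nome (\<sigma> / 2) ^ 2))"
  proof -
    have "nome (- \<sigma> / 48) * nome (\<sigma> / 24) = nome (\<sigma> / 2 / 24)" unfolding nome_add[symmetric]
      by (rule arg_cong[of _ _ nome]) simp
    hence "nome (\<sigma> / 2 / 24) / nome (\<sigma> / 24) = nome (- \<sigma> / 48)" by (simp add: divide_eq_eq)
    moreover have "nome (\<sigma> / 2) ^ 2 = nome \<sigma>" by (simp add: nome_power)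
    ultimately show ?thesis unfolding eta_eq times_divide_times_eq[symmetric] by (simp only:)
  qed
  finally have A: "Phi2 (- 1 / \<sigma>) = (1 / of_real (sqrt 2)) ^ 24 * (nome (- \<sigma> / 48) ^ 24 * (euler_prod (nome (\<sigma> / 2)) / euler_prod (nome (\<sigma> / 2) ^ 2)) ^ 24)"
    unfolding Phi2_def by (simp only: power_mult_distrib)
  have B: "(1 / of_real (sqrt 2)) ^ 24 = (1 / 2 ^ 12 :: complex)"
  proof -
    have "(of_real (sqrt 2) :: complex) ^ 24 = (of_real (sqrt 2) ^ 2) ^ 12" by (simp only: power_mult[symmetric]) simp
    also have "(of_real (sqrt 2) :: complex) ^ 2 = 2" by (simp flip: of_real_power)
    finally show ?thesis by (simp add: power_divide)
  qed
  have C: "nome (- \<sigma> / 48) ^ 24 * nome (\<sigma> / 2) = 1" unfolding nome_power nome_add[symmetric] by simp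
  have "r * (n * e) * x = r * ((n * x) * e)" for r n e x :: complex by (simp only: mult_ac)
  thus ?thesis unfolding Phi2_zero_def A B by (simp only: C mult_1_left)
qed

lemma Phi2_inversion_eq:
  "Im \<sigma> > 0 \<Longrightarrow> Phi2 (- 1 / \<sigma>) = Phi2_zero (nome (\<sigma> / 2)) / nome (\<sigma> / 2)"
  using Phi2_inversion[of \<sigma>] by (simp add: field_simps)

lemma eventually_Im_pos: "eventually (\<lambda>\<tau>. Im \<tau> > 0) at_i_infinity"
  by (rule eventually_filtercomapI[OF eventually_gt_at_top])

text \<open>Induction on the bound \<open>m\<close> for the order of the pole at the cusp 0.
  \<open>U\<close> and \<open>V\<close> record the expansions at the two cusps; \<open>U\<close>
  remains holomorphic since Phi2 is regular at i infinity.\<close>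

lemma polynomial_in_Phi2:
  assumes "gamma0_2_function f" "f holomorphic_on upper_half_plane"
      "U holomorphic_on ball 0 1" "\<And>\<tau>. Im \<tau> > 0 \<Longrightarrow> f \<tau> = U (nome \<tau>)"
      "V holomorphic_on ball 0 1" "\<And>\<sigma>. Im \<sigma> > 0 \<Longrightarrow> f (- 1 / \<sigma>) * nome (\<sigma> / 2) ^ m = V (nome (\<sigma> / 2))"
  shows "\<exists>P :: complex poly. \<forall>\<tau>\<in>upper_half_plane. f \<tau> = poly P (Phi2 \<tau>)"
  using assms
proof (induction m arbitrary: f U V)
  case 0
  interpret gamma0_2_function f by fact
  have "((\<lambda>\<tau>. U (nome (\<tau> / of_nat 1))) \<longlongrightarrow> U 0) at_i_infinity" by (rule tendsto_i_infinity[OF 0(3)]) simp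
  moreover have "eventually (\<lambda>\<tau>. U (nome (\<tau> / of_nat 1)) = f \<tau>) at_i_infinity"
    using eventually_Im_pos by eventually_elim (simp add: 0)
  ultimately have lim: "(f \<longlongrightarrow> U 0) at_i_infinity" by (rule Lim_transform_eventually)
  have "((\<lambda>\<tau>. V (nome (\<tau> / of_nat 2))) \<longlongrightarrow> V 0) at_i_infinity" by (rule tendsto_i_infinity[OF 0(5)]) simp
  moreover have "eventually (\<lambda>\<tau>. V (nome (\<tau> / of_nat 2)) = f (- 1 / \<tau>)) at_i_infinity"
    using eventually_Im_pos by eventually_elim (use 0(6) in simp)
  ultimately have lim0: "((\<lambda>\<sigma>. f (- 1 / \<sigma>)) \<longlongrightarrow> V 0) at_i_infinity" by (rule Lim_transform_eventually)
  have "f \<tau> = poly [:U 0:] (Phi2 \<tau>)" if "\<tau> \<in> upper_half_plane" for \<tau>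
    using bounded_imp_constant[OF 0(2) lim lim0] that by (simp add: upper_half_plane_def)
  thus ?case by blast
next
  case (Suc m)
  interpret gamma0_2_function f by fact
  define c where "c = V 0 / Phi2_zero 0 ^ Suc m"
  define f' where "f' \<tau> = f \<tau> - c * Phi2 \<tau> ^ Suc m" for \<tau>
  define U' where "U' q = U q - c * Phi2_infinity q ^ Suc m" for q
  define V1 where "V1 x = V x - c * Phi2_zero x ^ Suc m" for x
  \<comment> \<open>\<open>c\<close> matches the leading coefficients, so \<open>V1\<close> vanishes
    at 0. Holomorphy of its quotient by \<open>x\<close> says that the bound has dropped by
    one.\<close>
  define V' where "V' x = (if x = 0 then deriv V1 0 else (V1 x - V1 0) / (x - 0))" for x
  have "Phi2_zero 0 \<noteq> 0" by (simp add: Phi2_zero_def)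
  hence V10: "V1 0 = 0" by (simp add: V1_def c_def)
  have U': "U' holomorphic_on ball 0 1" unfolding U'_def[abs_def]
    by (intro holomorphic_intros Suc.prems Phi2_infinity_holomorphic)
  have V1: "V1 holomorphic_on ball 0 1" unfolding V1_def[abs_def]
    by (intro holomorphic_intros Suc.prems Phi2_zero_holomorphic)
  have V': "V' holomorphic_on ball 0 1" unfolding V'_def[abs_def]
    by (rule pole_lemma[OF V1]) simp
  have "gamma0_2_function f'"
  proof
    fix \<tau> :: complex assume \<tau>: "Im \<tau> > 0"
    show "f' (\<tau> + 1) = f' \<tau>" using T_invariant[OF \<tau>] by (simp add: f'_def Phi2_eq nome_add)
    have \<tau>2: "Im (\<tau> + 2) > 0" using \<tau> by simp
    have "nome ((\<tau> + 2) / 2) = nome (\<tau> / 2)" by (simp add: add_divide_distrib nome_add)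
    hence "Phi2 (- 1 / (\<tau> + 2)) = Phi2 (- 1 / \<tau>)"
      unfolding Phi2_inversion_eq[OF \<tau>] Phi2_inversion_eq[OF \<tau>2] by simp
    thus "f' (- 1 / (\<tau> + 2)) = f' (- 1 / \<tau>)" unfolding f'_def ST2S_invariant[OF \<tau>] by simp
  qed
  moreover have fU: "f' \<tau> = U' (nome \<tau>)" if "Im \<tau> > 0" for \<tau>
    using Suc.prems(4)[OF that] by (simp add: f'_def U'_def Phi2_eq)
  moreover have "f' holomorphic_on upper_half_plane"
  proof -
    have "(U' \<circ> nome) holomorphic_on upper_half_plane"
      by (rule holomorphic_on_compose_gen[OF _ U'])
         (use nome_holomorphic[of "\<lambda>x. x"] in \<open>auto simp: upper_half_plane_def norm_nome_less_1_iff\<close>)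
    thus ?thesis by (rule holomorphic_transform) (auto simp: fU upper_half_plane_def)
  qed
  moreover have "f' (- 1 / \<sigma>) * nome (\<sigma> / 2) ^ m = V' (nome (\<sigma> / 2))" if \<sigma>: "Im \<sigma> > 0" for \<sigma>
  proof -
    have "f' (- 1 / \<sigma>) * nome (\<sigma> / 2) ^ Suc m = f (- 1 / \<sigma>) * nome (\<sigma> / 2) ^ Suc m - c * (Phi2 (- 1 / \<sigma>) * nome (\<sigma> / 2)) ^ Suc m"
      unfolding f'_def left_diff_distrib power_mult_distrib mult.assoc ..
    also have "\<dots> = V1 (nome (\<sigma> / 2))" unfolding Suc.prems(6)[OF \<sigma>] Phi2_inversion[OF \<sigma>] V1_def ..
    finally show ?thesis unfolding V'_def using V10 by (simp add: field_simps)
  qed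
  ultimately obtain P where P: "\<forall>\<tau>\<in>upper_half_plane. f' \<tau> = poly P (Phi2 \<tau>)"
    using Suc.IH[of f' U' V'] U' V' by blast
  have "f \<tau> = poly (P + Polynomial.monom c (Suc m)) (Phi2 \<tau>)" if "\<tau> \<in> upper_half_plane" for \<tau>
  proof -
    have "f \<tau> = f' \<tau> + c * Phi2 \<tau> ^ Suc m" by (simp add: f'_def)
    thus ?thesis using P that by (simp add: poly_monom)
  qed
  thus ?case by blast
qed

section \<open>Cusps of the Hecke quotient and the conclusion\<close>

lemma act_eq:
  "act \<gamma> \<tau> = (of_int (\<gamma> $ 1 $ 1) * \<tau> + of_int (\<gamma> $ 1 $ 2)) / (of_int (\<gamma> $ 2 $ 1) * \<tau> + of_int (\<gamma> $ 2 $ 2))"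
  by (simp add: act_def moebius_def)

lemma SL2Z_det: "\<gamma> \<in> SL2Z \<Longrightarrow> \<gamma> $ 1 $ 1 * \<gamma> $ 2 $ 2 - \<gamma> $ 1 $ 2 * \<gamma> $ 2 $ 1 = 1"
  by (simp add: SL2Z_def det_2)

lemma act_cusp_zero: "act cusp_zero \<tau> = - 1 / \<tau>"
  by (simp add: act_eq cusp_zero_def)

lemma act_cusp_infinity: "act cusp_infinity \<tau> = \<tau>"
  by (simp add: act_eq cusp_infinity_def mat_def)

lemma nome_divide: "nome (\<tau> / z) = exp (2 * of_real pi * \<i> * \<tau> / z)"
  by (simp add: nome_def)

context hecke_prime
begin

sublocale Z: gamma0_2_function "Z_tilde l"
proof
  show "Z_tilde l (\<tau> + 1) = Z_tilde l \<tau>" for \<tau> by (simp add: Z_tilde_def nome_add)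
qed (rule Z_tilde_inversion_plus_2)

lemma Z_tilde_holomorphic: "Z_tilde l holomorphic_on upper_half_plane"
proof -
  have "(\<lambda>\<tau>. Num \<tau> / F_eta \<tau>) holomorphic_on upper_half_plane"
    by (intro holomorphic_on_divide Num_holomorphic F_eta_compose_holomorphic)
       (auto simp: upper_half_plane_def F_eta_nonzero)
  thus ?thesis by (rule holomorphic_transform) (auto simp: Z_tilde_eq upper_half_plane_def)
qed

definition Z_infinity :: "complex \<Rightarrow> complex" where
  "Z_infinity q = 1 / A_gen q * (\<Sum>n. Z_coeff l n * q ^ n)"

text \<open>Every nonzero \<open>q\<close> in the disc is some \<open>nome \<tau>\<close>, where
  \<open>Num_has_sum\<close> supplies convergence.\<close>

lemma Z_infinity_holomorphic: "Z_infinity holomorphic_on ball 0 1"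
proof -
  have "(\<lambda>q. \<Sum>n. Z_coeff l n * q ^ n) holomorphic_on ball 0 1"
  proof (rule power_series_holomorphic)
    fix q :: complex assume q: "q \<in> ball 0 1"
    have "summable (\<lambda>n. Z_coeff l n * q ^ n)"
    proof (cases "q = 0")
      case False
      then obtain \<tau> where \<tau>: "nome \<tau> = q" using nome_surj by blast
      hence "Im \<tau> > 0" using q norm_nome_less_1_iff[of \<tau>] by simp
      thus ?thesis using has_sum_imp_sums[OF Num_has_sum] \<tau> sums_iff by blast
    qed (simp add: summable_0_powser)
    thus "(\<lambda>n. Z_coeff l n * (q - 0) ^ n) sums (\<Sum>n. Z_coeff l n * q ^ n)" by (simp add: summable_sums)
  qed
  thus ?thesis unfolding Z_infinity_def[abs_def]
    by (intro holomorphic_intros A_gen_holomorphic) (auto simp: A_gen_nonzero)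
qed

lemma Z_tilde_infinity: "Z_tilde l \<tau> = Z_infinity (nome \<tau>)"
  by (simp add: Z_tilde_def Z_infinity_def)

lemma Z_zero_ex:
  obtains V where "V holomorphic_on ball 0 1" "V 0 = 1"
     "\<And>\<sigma>. Im \<sigma> > 0 \<Longrightarrow> Z_tilde l (- 1 / \<sigma>) * nome (\<sigma> / 2) ^ M = V (nome (\<sigma> / 2))"
proof -
  have "(Z_tilde l \<circ> (\<lambda>\<sigma>. - 1 / \<sigma>)) holomorphic_on upper_half_plane"
    by (rule holomorphic_on_compose_gen[OF _ Z_tilde_holomorphic])
       (use Im_minus_inverse_pos in \<open>auto intro!: holomorphic_intros simp: upper_half_plane_def\<close>)
  hence hol: "(\<lambda>\<sigma>. Z_tilde l (- 1 / \<sigma>)) holomorphic_on upper_half_plane" by (simp add: o_def)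
  have "eventually (\<lambda>\<sigma>. H \<sigma> / G_eta \<sigma> * nome (\<sigma> / 2) ^ M = Z_tilde l (- 1 / \<sigma>) * nome (\<sigma> / of_nat 2) ^ M) at_i_infinity"
    using eventually_Im_pos
  proof eventually_elim
    case (elim \<sigma>)
    show ?case unfolding Z_tilde_inversion[OF elim] by simp
  qed
  hence lim: "((\<lambda>\<sigma>. Z_tilde l (- 1 / \<sigma>) * nome (\<sigma> / of_nat 2) ^ M) \<longlongrightarrow> 1) at_i_infinity"
    by (rule Lim_transform_eventually[OF Z_tilde_inversion_tendsto])
  show ?thesis
    by (rule cusp_function[OF hol _ _ lim]) (use Z.ST2S_invariant that in \<open>auto\<close>)
qed

text \<open>\<open>pole_at_cusp\<close> admits any width and expansion, so all of them must be
  excluded: the finite limit of \<open>Z_tilde l\<close> at i infinity passes to every candidate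
  \<open>F\<close>.\<close>

lemma not_pole_at_infinity: "\<not> pole_at_cusp (Z_tilde l) cusp_infinity"
proof
  assume "pole_at_cusp (Z_tilde l) cusp_infinity"
  then obtain h F y where F: "h > 0" "is_pole F 0"
     "\<And>\<tau>. Im \<tau> > y \<Longrightarrow> Z_tilde l \<tau> = F (nome (\<tau> / of_nat h))"
    unfolding pole_at_cusp_def cusp_expansion_def act_cusp_infinity nome_divide by blast
  have "((\<lambda>\<tau>. Z_infinity (nome (\<tau> / of_nat 1))) \<longlongrightarrow> Z_infinity 0) at_i_infinity"
    by (rule tendsto_i_infinity[OF Z_infinity_holomorphic]) simp
  hence "(Z_tilde l \<longlongrightarrow> Z_infinity 0) at_i_infinity" by (simp add: Z_tilde_infinity[abs_def])
  hence "(F \<longlongrightarrow> Z_infinity 0) (at 0)"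
    using tendsto_at_cusp[of h "Z_tilde l" "Z_infinity 0" y F, OF F(1) _ F(3)[symmetric]] by blast
  thus False using F(2) not_tendsto_and_filterlim_at_infinity[of "at 0" F] by (auto simp: is_pole_def)
qed

lemma Z_tilde_main:
  "weakly_holomorphic_modular_function (Gamma0 2) (Z_tilde l)
     \<and> pole_at_cusp (Z_tilde l) cusp_zero
     \<and> (\<exists>P :: complex poly. \<forall>\<tau>\<in>upper_half_plane. Z_tilde l \<tau> = poly P (Phi2 \<tau>))"
proof -
  obtain V where V: "V holomorphic_on ball 0 1" "V 0 = 1"
     "\<And>\<sigma>. Im \<sigma> > 0 \<Longrightarrow> Z_tilde l (- 1 / \<sigma>) * nome (\<sigma> / 2) ^ M = V (nome (\<sigma> / 2))"
    using Z_zero_ex by blast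
  define W where "W x = V x / x ^ M" for x
  have W: "Z_tilde l (- 1 / \<sigma>) = W (nome (\<sigma> / of_nat 2))" if "Im \<sigma> > 0" for \<sigma>
    using V(3)[OF that] by (simp add: W_def field_simps)
  have "V analytic_on {0}" unfolding analytic_at using V(1) by (intro exI[of _ "ball 0 1"]) auto
  hence W_mer: "W meromorphic_on {0}" unfolding W_def[abs_def]
    by (intro meromorphic_intros analytic_on_imp_meromorphic_on)
  hence W_mer': "(\<lambda>x. W (- x)) meromorphic_on {0}"
    by (rule meromorphic_on_compose) (auto intro!: analytic_intros)
  \<comment> \<open>The pole is genuine because \<open>V 0 = 1\<close> is nonzero and
    \<open>M\<close> is positive.\<close>
  have W_pole: "is_pole W 0" unfolding W_def[abs_def]
    by (rule is_pole_basic'[OF V(1)]) (use V(2) M_pos in auto)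
  have exp0: "cusp_expansion (Z_tilde l) cusp_zero 2 W"
    unfolding cusp_expansion_def act_cusp_zero nome_divide[symmetric] using W_mer W by (auto intro!: exI[of _ 1])
  have "Z_infinity analytic_on {0}"
    unfolding analytic_at using Z_infinity_holomorphic by (intro exI[of _ "ball 0 1"]) auto
  hence Zi_mer: "Z_infinity meromorphic_on {0}" by (rule analytic_on_imp_meromorphic_on)
  have "meromorphic_at_cusp (Z_tilde l) \<gamma>" if \<gamma>: "\<gamma> \<in> SL2Z" for \<gamma>
  proof -
    have eq: "Z_tilde l (act \<gamma> \<tau>) = (if even (\<gamma> $ 2 $ 1) then Z_tilde l \<tau> else if even (\<gamma> $ 2 $ 2) then Z_tilde l (- 1 / \<tau>) else Z_tilde l (- 1 / (\<tau> + 1)))"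
      if "Im \<tau> > 0" for \<tau>
      unfolding act_eq by (rule Z.moebius_cases[OF SL2Z_det[OF \<gamma>] that])
    \<comment> \<open>On the coset of ST the local parameter at \<tau> + 1 is minus that at \<tau>,
      whence the expansion \<open>W (- x)\<close>.\<close>
    have neg: "nome ((\<tau> + 1) / of_nat 2) = - nome (\<tau> / of_nat 2)" for \<tau>
      by (simp add: add_divide_distrib nome_add nome_half)
    consider "even (\<gamma> $ 2 $ 1)" | "odd (\<gamma> $ 2 $ 1)" "even (\<gamma> $ 2 $ 2)" | "odd (\<gamma> $ 2 $ 1)" "odd (\<gamma> $ 2 $ 2)" by blast
    thus ?thesis
    proof cases
      case 1
      hence "cusp_expansion (Z_tilde l) \<gamma> 1 Z_infinity"
        unfolding cusp_expansion_def nome_divide[symmetric] using Zi_mer eq by (auto intro!: exI[of _ 1] simp: Z_tilde_infinity)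
      thus ?thesis unfolding meromorphic_at_cusp_def by blast
    next
      case 2
      hence "cusp_expansion (Z_tilde l) \<gamma> 2 W"
        unfolding cusp_expansion_def nome_divide[symmetric] using W_mer eq W by (auto intro!: exI[of _ 1])
      thus ?thesis unfolding meromorphic_at_cusp_def by blast
    next
      case 3
      have "Z_tilde l (act \<gamma> \<tau>) = W (- nome (\<tau> / of_nat 2))" if "Im \<tau> > 1" for \<tau>
        unfolding neg[symmetric] using eq[of \<tau>] W[of "\<tau> + 1"] 3 that by simp
      hence "cusp_expansion (Z_tilde l) \<gamma> 2 (\<lambda>x. W (- x))"
        unfolding cusp_expansion_def nome_divide[symmetric] using W_mer' by (auto intro!: exI[of _ 1])
      thus ?thesis unfolding meromorphic_at_cusp_def by blast
    qed
  qed
  moreover have "Z_tilde l (act \<gamma> \<tau>) = Z_tilde l \<tau>" if "\<gamma> \<in> Gamma0 2" "\<tau> \<in> upper_half_plane" for \<gamma> \<tau>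
    unfolding act_eq
    by (rule Z.moebius_invariant[OF SL2Z_det])
       (use that in \<open>auto simp: Gamma0_def upper_half_plane_def cong_0_iff\<close>)
  ultimately have "weakly_holomorphic_modular_function (Gamma0 2) (Z_tilde l)"
    unfolding weakly_holomorphic_modular_function_def using Z_tilde_holomorphic by blast
  moreover have "pole_at_cusp (Z_tilde l) cusp_zero"
    unfolding pole_at_cusp_def using exp0 W_pole by blast
  moreover have "\<exists>P :: complex poly. \<forall>\<tau>\<in>upper_half_plane. Z_tilde l \<tau> = poly P (Phi2 \<tau>)"
    by (rule polynomial_in_Phi2[OF Z.gamma0_2_function_axioms Z_tilde_holomorphic Z_infinity_holomorphic Z_tilde_infinity V(1) V(3)])
  ultimately show ?thesis by blast
qed

end

theorem theorem4p8:
  fixes l :: nat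
  assumes "prime l" and "l > 3"
  shows "weakly_holomorphic_modular_function (Gamma0 2) (Z_tilde l)
       \<and> pole_at_cusp (Z_tilde l) cusp_zero
       \<and> \<not> pole_at_cusp (Z_tilde l) cusp_infinity
       \<and> (\<exists>P :: complex poly. \<forall>\<tau>\<in>upper_half_plane. Z_tilde l \<tau> = poly P (Phi2 \<tau>))"
proof -
  interpret hecke_prime l by unfold_locales (use assms in auto)
  show ?thesis using Z_tilde_main not_pole_at_infinity by blast
qed

end
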